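(* Let $d\ge2$ and let $P$ be a rational convex polytope of dimension $d-1$ in $\mathbb{R}^{d-1}$. Choose an integer $m\gg0$ such that $mP$ is a very ample integral convex polytope (any integer $m\ge1$ with $mP$ integral and $m\ge(d-2)n_1$ will do, where $n_1\ge1$ is an integer such that $n_1P$ is an integral polytope). In particular there is a toric pair $(X,D)$, over an algebraically closed field $K$ of characteristic $p>0$, whose associated polytope is $P_D=mP$. Then $P$ tiles the space $\mathbb{R}^{d-1}$ for some $\lambda>0$ if and only if $$\big(e_0(X,D)\big)^{\frac{2-d}{d-1}}\lim_{k\to\infty}\frac{e_{HK}(X,kD)-e_0(X,kD)/d!}{k^{d-2}}=\Big[\frac{d-1}{d}\Big]\big[(d-1)!\big]^{\frac{2-d}{d-1}}.$$ This criterion is independent of the choice of $m$, as the left hand side does not change if $D$ is replaced by a (positive) integral multiple of $D$. Moreover, if $P$ tiles the space $\mathbb{R}^{d-1}$, then it tiles at $\lambda=(\mathrm{Vol}_{d-1}(P))^{-1/(d-1)}$.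
   Context: Tiling: a rational polytope $P\subset\mathbb{R}^{d-1}$ tiles the space $\mathbb{R}^{d-1}$ for (or at) $\lambda>0$ if (1) $\bigcup_{v\in\mathbb{Z}^{d-1}}(v+\lambda P)=\mathbb{R}^{d-1}$, and (2) $\dim\big[(v+\lambda P)\cap(v'+\lambda P)\big]<d-1$ for all $v\ne v'$ in $\mathbb{Z}^{d-1}$. It tiles the space if it does so for some $\lambda>0$. A lattice (integral) polytope $Q\subset\mathbb{R}^{d-1}$ is very ample if for every vertex $w$ of $Q$ the semigroup generated by $\{u-w\mid u\in Q\cap\mathbb{Z}^{d-1}\}$ is saturated in $\mathbb{Z}^{d-1}$. Toric pair: Let $T$ be a torus with cocharacter lattice $N\cong\mathbb{Z}^{d-1}$ and character lattice $M=\mathrm{Hom}(N,\mathbb{Z})$, identified with $\mathbb{Z}^{d-1}$, so $M_{\mathbb{R}}=\mathbb{R}^{d-1}$. A toric pair $(X,D)$ consists of a projective toric variety $X$ of dimension $d-1\ge1$ over $K$, given by a complete fan in $N_{\mathbb{R}}$ whose rays have primitive generators $v_1,\dots,v_n$, and a very ample $T$-Cartier divisor $D=\sum_i a_iD_i$ on $X$ ($a_i\in\mathbb{Z}$, $D_i$ the $T$-invariant prime divisor corresponding to $v_i$). Its associated lattice polytope is $P_D=\{u\in M_{\mathbb{R}}\mid \langle u,v_i\rangle\ge -a_i \text{ for all } i\}$. Homogeneous coordinate ring and multiplicities: if $P_D\cap M=\{u_1,\dots,u_r\}$ and $S\subset M\times\mathbb{Z}$ is the semigroup generated by $(u_1,1),\dots,(u_r,1)$,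 the homogeneous coordinate ring of $(X,D)$ is $R=K[S]=K[\chi^{(u_1,1)},\dots,\chi^{(u_r,1)}]$, a standard graded ring of dimension $d$ with $\deg\chi^{(u_i,1)}=1$ and graded maximal ideal $\mathbf{m}$. $e_0(X,D)=e_0(R,\mathbf{m})$ is the Hilbert-Samuel multiplicity, and $e_{HK}(X,D)=\lim_{n\to\infty}\ell(R/\mathbf{m}^{[q]})/q^{d}$, $q=p^n$, is the Hilbert-Kunz multiplicity, where $\mathbf{m}^{[q]}$ is the ideal generated by $q$-th powers of elements of $\mathbf{m}$. $e_0(X,kD)$, $e_{HK}(X,kD)$ are the same invariants for $(X,kD)$. *)

theory Defs
  imports
    "HOL-Analysis.Analysis"
    "HOL-Algebra.QuotRing"
    "HOL-Algebra.Ideal_Product"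
    "HOL-Library.Extended_Nat"
    "HOL-Library.Poly_Mapping"
    "HOL-Computational_Algebra.Polynomial"
begin

text \<open>Conventions: \<^typ>\<open>int^'n\<close> is the lattice (both \<open>M\<close> and \<open>N\<close>), \<^typ>\<open>real^'n\<close> is the real
  vector space spanned by it, the pairing of \<open>M\<close> and \<open>N\<close> is the inner product, and
  \<open>CARD('n)\<close> plays the role of \<open>d - 1\<close>.\<close>

section \<open>Lattice polytopes and tilings\<close>

definition rvec :: "int^'n \<Rightarrow> real^'n" where
  "rvec u = (\<chi> i. real_of_int (u $ i))"

definition lattice_points :: "(real^'n) set \<Rightarrow> (int^'n) set" where
  "lattice_points Q = {u. rvec u \<in> Q}"

definition dilate :: "real \<Rightarrow> (real^'n) set \<Rightarrow> (real^'n) set" where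
  "dilate c Q = (*\<^sub>R) c ` Q"

definition rational_polytope :: "(real^'n) set \<Rightarrow> bool" where
  "rational_polytope Q \<longleftrightarrow>
     (\<exists>V. finite V \<and> (\<forall>v\<in>V. \<forall>i. v $ i \<in> \<rat>) \<and> Q = convex hull V)"

definition lattice_polytope :: "(real^'n) set \<Rightarrow> bool" where
  "lattice_polytope Q \<longleftrightarrow> (\<exists>V. finite V \<and> Q = convex hull (rvec ` V))"

definition tiles_at :: "(real^'n) set \<Rightarrow> real \<Rightarrow> bool" where
  "tiles_at P l \<longleftrightarrow> l > 0 \<and>
     (\<Union>v. (+) (rvec v) ` dilate l P) = UNIV \<and>
     (\<forall>v v'. v \<noteq> v' \<longrightarrow>
        aff_dim ((+) (rvec v) ` dilate l P \<inter> (+) (rvec v') ` dilate l P) < int CARD('n))"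

definition tiles :: "(real^'n) set \<Rightarrow> bool" where
  "tiles P \<longleftrightarrow> (\<exists>l>0. tiles_at P l)"

text \<open>Semigroups contain 0 throughout.\<close>

inductive_set semigroup_gen :: "'a::comm_monoid_add set \<Rightarrow> 'a set" for G where
  zero: "0 \<in> semigroup_gen G"
| add: "g \<in> G \<Longrightarrow> x \<in> semigroup_gen G \<Longrightarrow> g + x \<in> semigroup_gen G"

definition saturated :: "(int^'n) set \<Rightarrow> bool" where
  "saturated S \<longleftrightarrow> (\<forall>x. \<forall>k::nat. k \<ge> 1 \<and> int k *s x \<in> S \<longrightarrow> x \<in> S)"

definition very_ample_polytope :: "(real^'n) set \<Rightarrow> bool" where
  "very_ample_polytope Q \<longleftrightarrow> lattice_polytope Q \<and>
     (\<forall>w. rvec w extreme_point_of Q \<longrightarrow>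
        saturated (semigroup_gen ((\<lambda>u. u - w) ` lattice_points Q)))"

section \<open>Fans and toric pairs\<close>

definition cone_over :: "(int^'n) set \<Rightarrow> (real^'n) set" where
  "cone_over V = {\<Sum>v\<in>V. c v *\<^sub>R rvec v | c. \<forall>v. c v \<ge> 0}"

definition strongly_convex_rational_cone :: "(real^'n) set \<Rightarrow> bool" where
  "strongly_convex_rational_cone s \<longleftrightarrow>
     (\<exists>V. finite V \<and> s = cone_over V) \<and> s \<inter> uminus ` s = {0}"

text \<open>The library relation \<^const>\<open>face_of\<close> admits the empty face, which is not a cone.\<close>

definition cone_faces :: "(real^'n) set \<Rightarrow> (real^'n) set set" where
  "cone_faces s = {t. t face_of s \<and> t \<noteq> {}}"

definition is_fan :: "(real^'n) set set \<Rightarrow> bool" where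
  "is_fan F \<longleftrightarrow> finite F \<and>
     (\<forall>s\<in>F. strongly_convex_rational_cone s \<and> cone_faces s \<subseteq> F) \<and>
     (\<forall>s\<in>F. \<forall>t\<in>F. s \<inter> t \<in> cone_faces s \<and> s \<inter> t \<in> cone_faces t)"

definition complete_fan :: "(real^'n) set set \<Rightarrow> bool" where
  "complete_fan F \<longleftrightarrow> is_fan F \<and> \<Union>F = UNIV"

definition primitive :: "int^'n \<Rightarrow> bool" where
  "primitive v \<longleftrightarrow> v \<noteq> 0 \<and> (\<forall>w. \<forall>k::nat. v = int k *s w \<longrightarrow> k = 1)"

definition ray_gens :: "(real^'n) set set \<Rightarrow> (int^'n) set" where
  "ray_gens F = {v. primitive v \<and> cone_over {v} \<in> F}"

text \<open>A \<open>T\<close>-invariant Weil divisor \<open>D = \<Sum> a\<^sub>v D\<^sub>v\<close> is given by its coefficient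
  function \<open>a\<close>; only the values of \<open>a\<close> on \<^term>\<open>ray_gens F\<close> matter.\<close>

definition div_polytope :: "(real^'n) set set \<Rightarrow> (int^'n \<Rightarrow> int) \<Rightarrow> (real^'n) set" where
  "div_polytope F a = {u. \<forall>v\<in>ray_gens F. u \<bullet> rvec v \<ge> - real_of_int (a v)}"

text \<open>\<open>trivial_on F a u s\<close>: on the affine chart \<open>U\<^sub>s\<close> the divisor \<open>D + div \<chi>\<^sup>u\<close> is 0, i.e.
  the rational section \<open>\<chi>\<^sup>u\<close> of \<open>\<O>(D)\<close> is a nowhere vanishing regular section on \<open>U\<^sub>s\<close>.\<close>

definition trivial_on :: "(real^'n) set set \<Rightarrow> (int^'n \<Rightarrow> int) \<Rightarrow> int^'n \<Rightarrow> (real^'n) set \<Rightarrow> bool" where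
  "trivial_on F a u s \<longleftrightarrow>
     (\<forall>v\<in>ray_gens F. rvec v \<in> s \<longrightarrow> rvec u \<bullet> rvec v = - real_of_int (a v))"

definition cartier_divisor :: "(real^'n) set set \<Rightarrow> (int^'n \<Rightarrow> int) \<Rightarrow> bool" where
  "cartier_divisor F a \<longleftrightarrow> (\<forall>s\<in>F. \<exists>u. trivial_on F a u s)"

definition nonvanishing_fan :: "(real^'n) set set \<Rightarrow> (int^'n \<Rightarrow> int) \<Rightarrow> int^'n \<Rightarrow> (real^'n) set set" where
  "nonvanishing_fan F a u = {s \<in> F. trivial_on F a u s}"

definition dual_lattice_cone :: "(real^'n) set \<Rightarrow> (int^'n) set" where
  "dual_lattice_cone s = {x. \<forall>y\<in>s. rvec x \<bullet> y \<ge> 0}"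

text \<open>\<open>H\<^sup>0(X, \<O>(D))\<close> has the basis \<open>\<chi>\<^sup>u\<close> for \<open>u\<close> in \<open>P\<^sub>D \<inter> M\<close>.  Very ampleness says that these
  sections generate \<open>\<O>(D)\<close> and that the resulting map to projective space is a closed
  immersion.  The latter is expressed on the standard charts: for each \<open>u\<close> the preimage
  \<open>X\<^sub>u\<close> of the chart \<open>y\<^sub>u \<noteq> 0\<close>, which is the toric variety of \<^term>\<open>nonvanishing_fan F a u\<close>,
  must be affine, i.e. consist of the faces of one cone \<open>s\<close>, and the map
  \<open>K[y\<^sub>w / y\<^sub>u] \<rightarrow> \<O>(X\<^sub>u) = K[dual_lattice_cone s]\<close> sending \<open>y\<^sub>w / y\<^sub>u\<close> to \<open>\<chi>\<close> with exponent
  \<open>w - u\<close> must be surjective; its image is spanned by the semigroup generated by the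
  \<open>w - u\<close>.\<close>

definition very_ample_divisor :: "(real^'n) set set \<Rightarrow> (int^'n \<Rightarrow> int) \<Rightarrow> bool" where
  "very_ample_divisor F a \<longleftrightarrow>
     (\<forall>s\<in>F. \<exists>u\<in>lattice_points (div_polytope F a). trivial_on F a u s) \<and>
     (\<forall>u\<in>lattice_points (div_polytope F a).
        \<exists>s\<in>F. nonvanishing_fan F a u = cone_faces s \<and>
          semigroup_gen ((\<lambda>w. w - u) ` lattice_points (div_polytope F a)) = dual_lattice_cone s)"

text \<open>Projectivity of the toric variety of a complete fan is implied by the very ample divisor.\<close>

definition toric_pair :: "(real^'n) set set \<Rightarrow> (int^'n \<Rightarrow> int) \<Rightarrow> bool" where
  "toric_pair F a \<longleftrightarrow> complete_fan F \<and> cartier_divisor F a \<and> very_ample_divisor F a"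

definition div_mult :: "nat \<Rightarrow> (int^'n \<Rightarrow> int) \<Rightarrow> (int^'n \<Rightarrow> int)" where
  "div_mult k a = (\<lambda>v. int k * a v)"

section \<open>Hilbert--Samuel and Hilbert--Kunz multiplicities\<close>

text \<open>Length of a commutative ring as a module over itself.  For \<open>A = R Quot I\<close> the \<open>R\<close>-submodules
  of \<open>A\<close> are its ideals, so this is the length of the \<open>R\<close>-module \<open>R/I\<close>.\<close>

definition ring_length :: "('a, 'b) ring_scheme \<Rightarrow> enat" where
  "ring_length A = Sup {enat n | n. \<exists>J. (\<forall>i\<le>n. ideal (J i) A) \<and> (\<forall>i<n. J i \<subset> J (Suc i))}"

definition quot_length :: "('a, 'b) ring_scheme \<Rightarrow> 'a set \<Rightarrow> real" where
  "quot_length R I = real (the_enat (ring_length (R Quot I)))"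

primrec ideal_power :: "('a, 'b) ring_scheme \<Rightarrow> 'a set \<Rightarrow> nat \<Rightarrow> 'a set" where
  "ideal_power R I 0 = carrier R"
| "ideal_power R I (Suc n) = ideal_prod R (ideal_power R I n) I"

definition frobenius_power :: "('a, 'b) ring_scheme \<Rightarrow> 'a set \<Rightarrow> nat \<Rightarrow> 'a set" where
  "frobenius_power R I q = genideal R ((\<lambda>x. x [^]\<^bsub>R\<^esub> q) ` I)"

text \<open>In the following \<open>d\<close> stands for the dimension of the ring \<open>R\<close>.\<close>

definition hilbert_samuel_seq :: "nat \<Rightarrow> ('a, 'b) ring_scheme \<Rightarrow> 'a set \<Rightarrow> nat \<Rightarrow> real" where
  "hilbert_samuel_seq d R I n = fact d * quot_length R (ideal_power R I n) / real n ^ d"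

definition hilbert_kunz_seq :: "nat \<Rightarrow> nat \<Rightarrow> ('a, 'b) ring_scheme \<Rightarrow> 'a set \<Rightarrow> nat \<Rightarrow> real" where
  "hilbert_kunz_seq p d R I n = quot_length R (frobenius_power R I (p ^ n)) / real (p ^ n) ^ d"

section \<open>Homogeneous coordinate ring of a toric pair\<close>

text \<open>\<^typ>\<open>'m \<Rightarrow>\<^sub>0 'k\<close> is the monoid algebra of \<open>'m\<close> over \<open>'k\<close>, and
  \<^term>\<open>Poly_Mapping.single s 1\<close> is the character \<open>\<chi>\<^sup>s\<close>.\<close>

definition semigroup_ring :: "'m::comm_monoid_add set \<Rightarrow> ('m \<Rightarrow>\<^sub>0 'k::field) ring" where
  "semigroup_ring S =
     \<lparr>carrier = {f. Poly_Mapping.keys f \<subseteq> S}, mult = (*), one = 1, zero = 0, add = (+)\<rparr>"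

definition degree_one_points :: "(real^'n) set set \<Rightarrow> (int^'n \<Rightarrow> int) \<Rightarrow> ((int^'n) \<times> int) set" where
  "degree_one_points F a = (\<lambda>u. (u, 1)) ` lattice_points (div_polytope F a)"

definition coord_ring ::
  "(real^'n) set set \<Rightarrow> (int^'n \<Rightarrow> int) \<Rightarrow> (((int^'n) \<times> int) \<Rightarrow>\<^sub>0 'k::field) ring" where
  "coord_ring F a = semigroup_ring (semigroup_gen (degree_one_points F a))"

definition max_ideal ::
  "(real^'n) set set \<Rightarrow> (int^'n \<Rightarrow> int) \<Rightarrow> (((int^'n) \<times> int) \<Rightarrow>\<^sub>0 'k::field) set" where
  "max_ideal F a =
     genideal (coord_ring F a) ((\<lambda>s. Poly_Mapping.single s 1) ` degree_one_points F a)"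

definition e0_seq ::
  "'k::field itself \<Rightarrow> (real^'n) set set \<Rightarrow> (int^'n \<Rightarrow> int) \<Rightarrow> nat \<Rightarrow> real" where
  "e0_seq _ F a = hilbert_samuel_seq (CARD('n) + 1)
     (coord_ring F a :: (((int^'n) \<times> int) \<Rightarrow>\<^sub>0 'k) ring) (max_ideal F a)"

definition e0 :: "'k::field itself \<Rightarrow> (real^'n) set set \<Rightarrow> (int^'n \<Rightarrow> int) \<Rightarrow> real" where
  "e0 K F a = lim (e0_seq K F a)"

definition eHK_seq ::
  "'k::field itself \<Rightarrow> (real^'n) set set \<Rightarrow> (int^'n \<Rightarrow> int) \<Rightarrow> nat \<Rightarrow> real" where
  "eHK_seq _ F a = hilbert_kunz_seq CHAR('k) (CARD('n) + 1)
     (coord_ring F a :: (((int^'n) \<times> int) \<Rightarrow>\<^sub>0 'k) ring) (max_ideal F a)"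

definition eHK :: "'k::field itself \<Rightarrow> (real^'n) set set \<Rightarrow> (int^'n \<Rightarrow> int) \<Rightarrow> real" where
  "eHK K F a = lim (eHK_seq K F a)"

text \<open>The left-hand side of the criterion and the sequence whose limit occurs in it; \<open>d\<close> is always
  \<open>CARD('n) + 1\<close>.\<close>

definition criterion_seq ::
  "'k::field itself \<Rightarrow> nat \<Rightarrow> (real^'n) set set \<Rightarrow> (int^'n \<Rightarrow> int) \<Rightarrow> nat \<Rightarrow> real" where
  "criterion_seq K d F a k =
     (eHK K F (div_mult k a) - e0 K F (div_mult k a) / fact d) / real k ^ (d - 2)"

definition criterion_lhs ::
  "'k::field itself \<Rightarrow> nat \<Rightarrow> (real^'n) set set \<Rightarrow> (int^'n \<Rightarrow> int) \<Rightarrow> real" where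
  "criterion_lhs K d F a =
     e0 K F a powr ((2 - real d) / (real d - 1)) * lim (criterion_seq K d F a)"

end

theory Submission imports Defs begin

text \<open>Write \<open>D = d - 1\<close> and \<open>Q = P\<^sub>D\<close>, of volume \<open>V\<close>. The length of \<open>R/m\<^sup>[\<^sup>q\<^sup>]\<close> counts the points of the
  semigroup \<open>S\<close> outside the union of the translates of \<open>S\<close> by the \<open>q(u\<^sub>i,1)\<close>, and up to a bounded shift
  \<open>S\<close> consists of all lattice points of the cone over \<open>Q\<close>. Hence \<open>e\<^sub>H\<^sub>K(X,kD)\<close> is the volume of the cone
  over \<open>kQ\<close> minus its translates by the points \<open>(u,1)\<close> with \<open>u\<close> a lattice point of \<open>kQ\<close>. The part below
  height 1 contributes \<open>e\<^sub>0/d!\<close>. At height \<open>1 + s/k\<close> what remains is \<open>(k + s)Q\<close> minus the translates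
  \<open>u + sQ\<close>, whose volume is asymptotic to \<open>k\<^sup>D V\<close> times the proportion \<open>gap s\<close> of space left uncovered
  by all lattice translates of \<open>sQ\<close>. The limit is therefore \<open>V\<close> times the integral of \<open>gap\<close> over \<open>s > 0\<close>.
  Since \<open>gap s \<ge> max 0 (1 - s\<^sup>D V)\<close>, this is at least the value in the theorem, and equality forces
  \<open>gap s = 0\<close> at the critical scale \<open>s\<^sup>D V = 1\<close>: the translates then cover space, and by volume they
  overlap only in null sets.\<close>

section \<open>Lengths of monomial quotients of semigroup rings\<close>

text \<open>Three passages to the limit shape the proof. The bounded shift between S and the lattice
  points of the cone exists because differences of elements of S fill the whole lattice; saturation
  at a single vertex yields this, and it passes on to kQ. The limit in k is taken under the integral
  over s because the shells vanish once s reaches the number of lattice points of Q, whatever k is: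
  a point that high in the cone always has a generator to subtract. Equality of the integrals gives
  \<open>gap s = 0\<close> only for almost every s above the critical scale, so local finiteness and
  closedness have to carry the covering down to that scale. The normalisation by e_0 makes the left
  side invariant under dilation: as e_0 = D! V, the exponent (2-d)/(d-1) leaves the factor V^(1/D),
  the reciprocal of the critical scale, and the integral of max 0 (1 - s^D V) is that scale times
  D/(D+1). Existence of toric pairs is separate: one takes the inner normal fan of mP with its
  support function, and the delicate point is the semigroup at lattice points that are not
  vertices.\<close>

definition monomial_span :: "'m set \<Rightarrow> ('m \<Rightarrow>\<^sub>0 'k::zero) set" where
  "monomial_span E = {f. Poly_Mapping.keys f \<subseteq> E}"

lemma monomial_span_mono: "E \<subseteq> E' \<Longrightarrow> monomial_span E \<subseteq> monomial_span E'"
  by (auto simp: monomial_span_def)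

lemma single_mem_monomial_span: "s \<in> E \<Longrightarrow> Poly_Mapping.single s c \<in> monomial_span E"
  by (auto simp: monomial_span_def)

lemma sum_mem_monomial_span:
  fixes f :: "'i \<Rightarrow> ('m \<Rightarrow>\<^sub>0 'k::comm_monoid_add)"
  assumes "\<And>i. i \<in> I \<Longrightarrow> f i \<in> monomial_span E"
  shows "sum f I \<in> monomial_span E"
  using assms keys_sum[of f I] unfolding monomial_span_def by blast

lemma sum_single_lookup:
  fixes f :: "'m \<Rightarrow>\<^sub>0 'k::comm_monoid_add"
  shows "(\<Sum>s\<in>Poly_Mapping.keys f. Poly_Mapping.single s (Poly_Mapping.lookup f s)) = f"
proof (rule poly_mapping_eqI)
  fix k
  have "Poly_Mapping.lookup (\<Sum>s\<in>Poly_Mapping.keys f. Poly_Mapping.single s (Poly_Mapping.lookup f s)) k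
      = (\<Sum>s\<in>Poly_Mapping.keys f. if s = k then Poly_Mapping.lookup f s else 0)"
    by (simp add: lookup_sum lookup_single when_def)
  also have "\<dots> = Poly_Mapping.lookup f k"
    by (simp add: in_keys_iff)
  finally show "Poly_Mapping.lookup (\<Sum>s\<in>Poly_Mapping.keys f. Poly_Mapping.single s (Poly_Mapping.lookup f s)) k
     = Poly_Mapping.lookup f k" .
qed

locale add_submonoid =
  fixes S :: "'m::comm_monoid_add set"
  assumes zero_mem: "0 \<in> S"
    and add_mem: "\<lbrakk>s \<in> S; t \<in> S\<rbrakk> \<Longrightarrow> s + t \<in> S"
begin

lemma carrier_semigroup_ring: "carrier (semigroup_ring S) = monomial_span S"
  by (simp add: semigroup_ring_def monomial_span_def)

lemma add_semigroup_ring: "x \<oplus>\<^bsub>semigroup_ring S\<^esub> y = x + y"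
  and zero_semigroup_ring: "\<zero>\<^bsub>semigroup_ring S\<^esub> = 0"
  and mult_semigroup_ring: "x \<otimes>\<^bsub>semigroup_ring S\<^esub> y = x * y"
  and one_semigroup_ring: "\<one>\<^bsub>semigroup_ring S\<^esub> = 1"
  by (simp_all add: semigroup_ring_def)

lemmas ring_simps = carrier_semigroup_ring add_semigroup_ring zero_semigroup_ring
  mult_semigroup_ring one_semigroup_ring

lemma monomial_span_add:
  "\<lbrakk>x \<in> monomial_span E; y \<in> monomial_span E\<rbrakk> \<Longrightarrow> (x :: 'm \<Rightarrow>\<^sub>0 'k::field) + y \<in> monomial_span E"
  using keys_add[of x y] by (auto simp: monomial_span_def)

lemma monomial_span_mult:
  assumes "x \<in> monomial_span A" "(y :: 'm \<Rightarrow>\<^sub>0 'k::field) \<in> monomial_span B"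
    and "\<And>a b. a \<in> A \<Longrightarrow> b \<in> B \<Longrightarrow> a + b \<in> E"
  shows "x * y \<in> monomial_span E"
  using keys_mult[of x y] assms unfolding monomial_span_def by blast

lemma cring_semigroup_ring: "cring (semigroup_ring S :: ('m \<Rightarrow>\<^sub>0 'k::field) ring)"
proof (rule cringI)
  show "abelian_group (semigroup_ring S :: ('m \<Rightarrow>\<^sub>0 'k) ring)"
  proof (rule abelian_groupI, unfold ring_simps)
    fix x :: "'m \<Rightarrow>\<^sub>0 'k" assume "x \<in> monomial_span S"
    then show "\<exists>y\<in>monomial_span S. y + x = 0"
      by (intro bexI[of _ "-x"]) (auto simp: monomial_span_def)
  qed (auto simp: monomial_span_add add_ac, auto simp: monomial_span_def)
  show "Group.comm_monoid (semigroup_ring S :: ('m \<Rightarrow>\<^sub>0 'k) ring)"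
  proof (rule comm_monoidI, unfold ring_simps)
    show "(1 :: 'm \<Rightarrow>\<^sub>0 'k) \<in> monomial_span S"
      using zero_mem by (auto simp: monomial_span_def)
  qed (auto intro: monomial_span_mult add_mem simp: mult_ac)
qed (simp add: ring_simps algebra_simps)

lemma ring_semigroup_ring: "ring (semigroup_ring S :: ('m \<Rightarrow>\<^sub>0 'k::field) ring)"
  using cring_semigroup_ring cring.axioms(1) by blast

lemma ideal_monomial_span:
  assumes "E \<subseteq> S" "\<And>s e. s \<in> S \<Longrightarrow> e \<in> E \<Longrightarrow> s + e \<in> E"
  shows "ideal (monomial_span E) (semigroup_ring S :: ('m \<Rightarrow>\<^sub>0 'k::field) ring)"
proof -
  interpret R: ring "semigroup_ring S :: ('m \<Rightarrow>\<^sub>0 'k) ring" by (rule ring_semigroup_ring)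
  have sub: "(monomial_span E :: ('m \<Rightarrow>\<^sub>0 'k) set) \<subseteq> monomial_span S"
    using assms(1) by (rule monomial_span_mono)
  have "subgroup (monomial_span E) (add_monoid (semigroup_ring S :: ('m \<Rightarrow>\<^sub>0 'k) ring))"
  proof (rule R.add.subgroupI)
    fix x :: "'m \<Rightarrow>\<^sub>0 'k" assume x: "x \<in> monomial_span E"
    have "-x \<in> monomial_span E" using x by (auto simp: monomial_span_def)
    moreover have "\<ominus>\<^bsub>semigroup_ring S\<^esub> x = -x"
      by (rule R.minus_equality) (use x \<open>-x \<in> _\<close> sub in \<open>auto simp: ring_simps\<close>)
    ultimately show "\<ominus>\<^bsub>semigroup_ring S\<^esub> x \<in> monomial_span E" by simp
  next
    show "(monomial_span E :: ('m \<Rightarrow>\<^sub>0 'k) set) \<noteq> {}"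
      by (auto simp: monomial_span_def intro: exI[of _ 0])
  qed (use sub in \<open>auto simp: ring_simps monomial_span_add\<close>)
  moreover have "x * a \<in> monomial_span E"
    if "a \<in> monomial_span E" "x \<in> monomial_span S" for a x :: "'m \<Rightarrow>\<^sub>0 'k"
    using that assms(2) by (intro monomial_span_mult[of x S a E]) auto
  ultimately show ?thesis
    by (intro idealI[OF ring_semigroup_ring]) (simp_all add: ring_simps mult.commute)
qed

lemma
  assumes J: "ideal J (semigroup_ring S :: ('m \<Rightarrow>\<^sub>0 'k::field) ring)"
  shows ideal_zero_mem: "0 \<in> J"
    and ideal_add_mem: "\<lbrakk>x \<in> J; y \<in> J\<rbrakk> \<Longrightarrow> x + y \<in> J"
    and ideal_mult_mem: "\<lbrakk>x \<in> monomial_span S; y \<in> J\<rbrakk> \<Longrightarrow> x * y \<in> J"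
    and ideal_subset: "J \<subseteq> monomial_span S"
  using additive_subgroup.zero_closed[OF ideal.axioms(1)[OF J]]
    additive_subgroup.a_closed[OF ideal.axioms(1)[OF J], of x y]
    additive_subgroup.a_subset[OF ideal.axioms(1)[OF J]]
    ideal.I_l_closed[OF J, of y x]
  by (auto simp: ring_simps)

lemma monomial_span_subset_ideal:
  assumes J: "ideal J (semigroup_ring S :: ('m \<Rightarrow>\<^sub>0 'k::field) ring)"
    and E: "\<And>s. s \<in> E \<Longrightarrow> Poly_Mapping.single s 1 \<in> J"
  shows "monomial_span E \<subseteq> J"
proof
  fix f :: "'m \<Rightarrow>\<^sub>0 'k" assume f: "f \<in> monomial_span E"
  have "(\<Sum>s\<in>A. Poly_Mapping.single s (Poly_Mapping.lookup f s)) \<in> J"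
    if "finite A" "A \<subseteq> E" for A
    using that
  proof induction
    case empty
    then show ?case using ideal_zero_mem[OF J] by simp
  next
    case (insert s A)
    have "Poly_Mapping.single 0 (Poly_Mapping.lookup f s) * Poly_Mapping.single s 1 \<in> J"
      using insert.prems E by (intro ideal_mult_mem[OF J] single_mem_monomial_span zero_mem) auto
    then have "Poly_Mapping.single s (Poly_Mapping.lookup f s) \<in> J" by (simp add: mult_single)
    with insert ideal_add_mem[OF J] show ?case by simp
  qed
  from this[of "Poly_Mapping.keys f"] f show "f \<in> J"
    by (simp add: monomial_span_def sum_single_lookup)
qed

text \<open>Each strict step contributes a new vector supported on \<open>S - E\<close>. These
  vectors are linearly independent, so there are at most as many as monomials outside E.\<close>

lemma ideal_chain_length_le:
  fixes J :: "nat \<Rightarrow> ('m \<Rightarrow>\<^sub>0 'k::field) set"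
  assumes fin: "finite (S - E)"
    and J: "\<And>i. i \<le> n \<Longrightarrow> ideal (J i) (semigroup_ring S)" "\<And>i. i \<le> n \<Longrightarrow> monomial_span E \<subseteq> J i"
    and strict: "\<And>i. i < n \<Longrightarrow> J i \<subset> J (Suc i)"
  shows "n \<le> card (S - E)"
proof -
  \<comment> \<open>K acts through the constants \<open>single 0 c\<close>, so ideals are subspaces
    and chain steps can be counted by linear independence.\<close>
  interpret V: vector_space "\<lambda>c f. Poly_Mapping.single 0 c * f :: 'm \<Rightarrow>\<^sub>0 'k"
    by standard (simp_all add: algebra_simps mult_single single_add flip: mult.assoc)
  define sg where "sg s = (Poly_Mapping.single s 1 :: 'm \<Rightarrow>\<^sub>0 'k)" for s
  have subsp: "V.subspace (J i)" if "i \<le> n" for i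
    unfolding V.subspace_def
    using ideal_zero_mem[OF J(1)[OF that]] ideal_add_mem[OF J(1)[OF that]]
      ideal_mult_mem[OF J(1)[OF that]] single_mem_monomial_span[OF zero_mem]
    by blast
  have "\<exists>g. g \<in> J (Suc i) - J i \<and> g \<in> V.span (sg ` (S - E))" if i: "i < n" for i
  proof -
    obtain f where f: "f \<in> J (Suc i)" "f \<notin> J i" using strict[OF i] by blast
    \<comment> \<open>Every ideal of the chain contains all monomials of E, so f can be replaced by
      its terms outside E without affecting membership in \<open>J i\<close> or
      \<open>J (Suc i)\<close>.\<close>
    define part where "part A = (\<Sum>s\<in>Poly_Mapping.keys f \<inter> A. Poly_Mapping.single s (Poly_Mapping.lookup f s))" for A
    have fS: "Poly_Mapping.keys f \<subseteq> S"
      using ideal_subset[OF J(1)[of "Suc i"]] i f(1) by (auto simp: monomial_span_def)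
    have "f = (\<Sum>s\<in>Poly_Mapping.keys f. Poly_Mapping.single s (Poly_Mapping.lookup f s))"
      by (simp add: sum_single_lookup)
    also have "Poly_Mapping.keys f = (Poly_Mapping.keys f \<inter> (S - E)) \<union> (Poly_Mapping.keys f \<inter> E)"
      using fS by auto
    also have "(\<Sum>s\<in>\<dots>. Poly_Mapping.single s (Poly_Mapping.lookup f s)) = part (S - E) + part E"
      unfolding part_def by (rule sum.union_disjoint) auto
    finally have dec: "f = part (S - E) + part E" .
    have E: "part E \<in> monomial_span E"
      unfolding part_def by (intro sum_mem_monomial_span single_mem_monomial_span) auto
    have s1: "V.subspace (J (Suc i))" "V.subspace (J i)" using subsp i by auto
    have "part E \<in> J i" "part E \<in> J (Suc i)" using E J(2)[of i] J(2)[of "Suc i"] i by auto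
    then have "part (S - E) \<in> J (Suc i) - J i"
      using f V.subspace_diff[OF s1(1) f(1), of "part E"] V.subspace_add[OF s1(2), of "part (S - E)" "part E"] dec
      by (auto simp: algebra_simps)
    moreover have "part (S - E) \<in> V.span (sg ` (S - E))"
      unfolding part_def
    proof (rule V.span_sum)
      fix s assume "s \<in> Poly_Mapping.keys f \<inter> (S - E)"
      then have "Poly_Mapping.single 0 (Poly_Mapping.lookup f s) * sg s \<in> V.span (sg ` (S - E))"
        by (intro V.span_scale V.span_base) auto
      then show "Poly_Mapping.single s (Poly_Mapping.lookup f s) \<in> V.span (sg ` (S - E))"
        by (simp add: sg_def mult_single)
    qed
    ultimately show ?thesis by blast
  qed
  then obtain g where g: "\<And>i. i < n \<Longrightarrow> g i \<in> J (Suc i) - J i \<and> g i \<in> V.span (sg ` (S - E))" by metis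
  have "i \<le> n \<Longrightarrow> V.independent (g ` {..<i}) \<and> card (g ` {..<i}) = i \<and> g ` {..<i} \<subseteq> J i" for i
  proof (induction i)
    case 0
    then show ?case by (simp add: V.independent_empty)
  next
    case (Suc i)
    then have IH: "V.independent (g ` {..<i})" "card (g ` {..<i}) = i" "g ` {..<i} \<subseteq> J i" by auto
    have "V.span (g ` {..<i}) \<subseteq> J i"
      using IH(3) subsp[of i] Suc.prems by (intro V.span_minimal) auto
    with g[of i] Suc.prems have ni: "g i \<notin> V.span (g ` {..<i})" by auto
    then have "g i \<notin> g ` {..<i}" using V.span_base[of "g i" "g ` {..<i}"] by blast
    moreover have "g ` {..<Suc i} = insert (g i) (g ` {..<i})" by (simp add: lessThan_Suc)
    moreover have "g ` {..<i} \<subseteq> J (Suc i)" using IH(3) strict[of i] Suc.prems by auto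
    ultimately show ?case
      using IH(1,2) V.independent_insertI[OF ni] g[of i] Suc.prems by simp
  qed
  from this[of n] have "V.independent (g ` {..<n})" "card (g ` {..<n}) = n" by auto
  moreover have "g ` {..<n} \<subseteq> V.span (sg ` (S - E))" using g by auto
  ultimately have "n \<le> card (sg ` (S - E))"
    using V.independent_span_bound[OF finite_imageI[OF fin, of sg], of "g ` {..<n}"] by simp
  also have "\<dots> \<le> card (S - E)" using fin by (rule card_image_le)
  finally show ?thesis .
qed

text \<open>The complement is consumed from the top: for b of maximal degree in
  \<open>S - E\<close>, every s + b with s nonzero has larger degree and already lies in E, so
  \<open>insert b E\<close> is again closed under translation by S.\<close>

lemma ideal_chain_exists:
  fixes deg :: "'m \<Rightarrow> int"
  assumes fin: "finite (S - E)" and "E \<subseteq> S" "\<And>s e. s \<in> S \<Longrightarrow> e \<in> E \<Longrightarrow> s + e \<in> E"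
    and deg: "\<And>s t. s \<in> S \<Longrightarrow> t \<in> S \<Longrightarrow> s \<noteq> 0 \<Longrightarrow> deg (s + t) > deg t"
  shows "\<exists>J :: nat \<Rightarrow> ('m \<Rightarrow>\<^sub>0 'k::field) set.
    (\<forall>i\<le>card (S - E). ideal (J i) (semigroup_ring S) \<and> monomial_span E \<subseteq> J i) \<and>
    (\<forall>i<card (S - E). J i \<subset> J (Suc i))"
  using assms(1,2,3)
proof (induction "card (S - E)" arbitrary: E)
  case 0
  then have "ideal (monomial_span E) (semigroup_ring S :: ('m \<Rightarrow>\<^sub>0 'k) ring)"
    by (intro ideal_monomial_span) auto
  with 0 show ?case by (intro exI[of _ "\<lambda>_. monomial_span E"]) auto
next
  case (Suc n)
  from Suc.hyps(2) have "S - E \<noteq> {}" by (metis Zero_not_Suc card.empty)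
  with Suc.prems(1) have "Max (deg ` (S - E)) \<in> deg ` (S - E)" by (intro Max_in) auto
  then obtain b where b: "b \<in> S - E" and "deg b = Max (deg ` (S - E))" by auto
  with Suc.prems(1) have bmax: "\<And>c. c \<in> S - E \<Longrightarrow> deg c \<le> deg b" by simp
  have eq: "S - insert b E = (S - E) - {b}" by auto
  have c: "card (S - insert b E) = n"
    using b Suc.hyps(2) Suc.prems(1) by (simp add: eq)
  have cl: "s + e \<in> insert b E" if "s \<in> S" "e \<in> insert b E" for s e
  proof (cases "e \<in> E")
    case False
    then have "e = b" using that by auto
    show ?thesis
    proof (cases "s = 0")
      case sn: False
      have "deg (s + b) > deg b" using deg[of s b] that b sn by auto
      then have "s + b \<in> E" using bmax[of "s + b"] add_mem[of s b] that b by fastforce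
      then show ?thesis using \<open>e = b\<close> by simp
    qed (use \<open>e = b\<close> in auto)
  qed (use that Suc.prems in auto)
  obtain J :: "nat \<Rightarrow> ('m \<Rightarrow>\<^sub>0 'k) set" where
    J: "\<And>i. i \<le> n \<Longrightarrow> ideal (J i) (semigroup_ring S) \<and> monomial_span (insert b E) \<subseteq> J i"
       "\<And>i. i < n \<Longrightarrow> J i \<subset> J (Suc i)"
  proof -
    have "finite (S - insert b E)" "insert b E \<subseteq> S" using Suc.prems b by (auto simp: eq)
    from Suc.hyps(1)[OF c[symmetric] this cl] show ?thesis using that unfolding c by blast
  qed
  define J' where "J' i = (case i of 0 \<Rightarrow> monomial_span E | Suc j \<Rightarrow> J j)" for i
  have ss: "monomial_span E \<subset> J 0"
  proof -
    have "Poly_Mapping.single b 1 \<in> J 0"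
      using J(1)[of 0] single_mem_monomial_span[of b "insert b E" "1::'k"] by blast
    moreover have "Poly_Mapping.single b (1::'k) \<notin> monomial_span E"
      using b by (auto simp: monomial_span_def)
    moreover have "monomial_span E \<subseteq> J 0"
      using J(1)[of 0] monomial_span_mono[of E "insert b E"] by blast
    ultimately show ?thesis by blast
  qed
  have "ideal (J' i) (semigroup_ring S) \<and> monomial_span E \<subseteq> J' i" if "i \<le> Suc n" for i
  proof (cases i)
    case 0
    then show ?thesis using Suc.prems by (auto simp: J'_def intro: ideal_monomial_span)
  next
    case (Suc j)
    then show ?thesis
      using J(1)[of j] that monomial_span_mono[of E "insert b E"] by (auto simp: J'_def)
  qed
  moreover have "J' i \<subset> J' (Suc i)" if "i < Suc n" for i
    using that ss J(2) by (cases i) (auto simp: J'_def)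
  ultimately show ?case unfolding Suc.hyps(2)[symmetric] by (intro exI[of _ J']) blast
qed

text \<open>Ideals of the quotient correspond to ideals containing \<open>monomial_span E\<close>.
  Adding one monomial at a time gives a chain that linear algebra shows to be longest, so the length
  is the same for every field.\<close>

lemma quot_length_monomial_span:
  fixes deg :: "'m \<Rightarrow> int"
  assumes fin: "finite (S - E)" and E: "E \<subseteq> S" "\<And>s e. s \<in> S \<Longrightarrow> e \<in> E \<Longrightarrow> s + e \<in> E"
    and deg: "\<And>s t. s \<in> S \<Longrightarrow> t \<in> S \<Longrightarrow> s \<noteq> 0 \<Longrightarrow> deg (s + t) > deg t"
  shows "quot_length (semigroup_ring S :: ('m \<Rightarrow>\<^sub>0 'k::field) ring) (monomial_span E) = card (S - E)"
proof -
  let ?R = "semigroup_ring S :: ('m \<Rightarrow>\<^sub>0 'k::field) ring"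
  let ?I = "monomial_span E :: ('m \<Rightarrow>\<^sub>0 'k) set"
  interpret R: ring ?R by (rule ring_semigroup_ring)
  have I: "ideal ?I ?R" using E by (intro ideal_monomial_span) auto
  have bij: "bij_betw (\<lambda>J. (+>\<^bsub>?R\<^esub>) ?I ` J) {J. ideal J ?R \<and> ?I \<subseteq> J} {J. ideal J (?R Quot ?I)}"
    using R.quot_ideal_correspondence[OF I] .
  have "{enat n | n. \<exists>J. (\<forall>i\<le>n. ideal (J i) (?R Quot ?I)) \<and> (\<forall>i<n. J i \<subset> J (Suc i))}
      = {enat n | n. n \<le> card (S - E)}" (is "{enat n | n. ?P n} = _")
  proof -
    have le: "n \<le> card (S - E)" if P: "?P n" for n
    proof -
      obtain J where J: "\<forall>i\<le>n. ideal (J i) (?R Quot ?I)" "\<forall>i<n. J i \<subset> J (Suc i)" using P by blast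
      have "\<exists>A. ideal A ?R \<and> ?I \<subseteq> A \<and> J i = (+>\<^bsub>?R\<^esub>) ?I ` A" if "i \<le> n" for i
        using bij_betw_imp_surj_on[OF bij] J(1) that by (auto simp: image_def set_eq_iff)
      then obtain A where A: "\<And>i. i \<le> n \<Longrightarrow> ideal (A i) ?R \<and> ?I \<subseteq> A i \<and> J i = (+>\<^bsub>?R\<^esub>) ?I ` A i"
        by metis
      \<comment> \<open>An ideal containing the kernel is the union of the cosets in its image,
        which transfers inclusions back from the quotient.\<close>
      have un: "\<Union>(J i) = A i" if "i \<le> n" for i
        using A[OF that] R.ideal_incl_iff[OF I, of "A i"] by auto
      have "A i \<subset> A (Suc i)" if "i < n" for i
      proof -
        have "A i \<subseteq> A (Suc i)" using un[of i] un[of "Suc i"] J(2) that by fastforce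
        moreover have "A i \<noteq> A (Suc i)" using A[of i] A[of "Suc i"] J(2) that by auto
        ultimately show ?thesis by blast
      qed
      then show ?thesis using ideal_chain_length_le[OF fin, of n A] A by auto
    qed
    have ex: "?P n" if n: "n \<le> card (S - E)" for n
    proof -
      obtain A :: "nat \<Rightarrow> ('m \<Rightarrow>\<^sub>0 'k) set" where
        A: "\<forall>i\<le>card (S - E). ideal (A i) ?R \<and> ?I \<subseteq> A i" "\<forall>i<card (S - E). A i \<subset> A (Suc i)"
        using ideal_chain_exists[OF fin E deg] by blast
      have h1: "ideal ((+>\<^bsub>?R\<^esub>) ?I ` A i) (?R Quot ?I)" if "i \<le> n" for i
        using A(1) that n R.ring_ideal_imp_quot_ideal[OF I] by auto
      have h2: "(+>\<^bsub>?R\<^esub>) ?I ` A i \<subset> (+>\<^bsub>?R\<^esub>) ?I ` A (Suc i)" if "i < n" for i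
      proof -
        have lt: "i < card (S - E)" "i \<le> card (S - E)" "Suc i \<le> card (S - E)" using that n by auto
        have sub: "A i \<subset> A (Suc i)" using A(2) lt(1) by blast
        have "A i \<in> {J. ideal J ?R \<and> ?I \<subseteq> J}" "A (Suc i) \<in> {J. ideal J ?R \<and> ?I \<subseteq> J}"
          using A(1) lt(2,3) by blast+
        from inj_on_eq_iff[OF bij_betw_imp_inj_on[OF bij] this] sub
        have "(+>\<^bsub>?R\<^esub>) ?I ` A i \<noteq> (+>\<^bsub>?R\<^esub>) ?I ` A (Suc i)" by blast
        moreover have "(+>\<^bsub>?R\<^esub>) ?I ` A i \<subseteq> (+>\<^bsub>?R\<^esub>) ?I ` A (Suc i)"
          by (rule image_mono) (rule psubset_imp_subset[OF sub])
        ultimately show ?thesis by (rule psubsetI[rotated])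
      qed
      from h1 h2 show ?thesis by (intro exI[of _ "\<lambda>i. (+>\<^bsub>?R\<^esub>) ?I ` A i"] conjI allI impI)
    qed
    have "?P n \<longleftrightarrow> n \<le> card (S - E)" for n using le ex by (rule iffI)
    then show ?thesis by presburger
  qed
  moreover have "Sup {enat n | n. n \<le> card (S - E)} = enat (card (S - E))"
    by (rule Sup_eqI) auto
  ultimately have "ring_length (?R Quot ?I) = enat (card (S - E))"
    unfolding ring_length_def by simp
  then show ?thesis by (simp add: quot_length_def)
qed

end

section \<open>Powers and Frobenius powers of the graded maximal ideal\<close>

text \<open>The n-th power of the character with exponent x has exponent
  \<open>nmul n x\<close>.\<close>

primrec nmul :: "nat \<Rightarrow> 'm::comm_monoid_add \<Rightarrow> 'm" where
  "nmul 0 x = 0"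
| "nmul (Suc n) x = x + nmul n x"

lemma nmul_add: "nmul (m + n) x = nmul m x + nmul n x"
  by (induction m) (auto simp: add_ac)

lemma nmul_distrib: "nmul n (x + y) = nmul n x + nmul n y"
  by (induction n) (auto simp: algebra_simps)

lemma power_single: "Poly_Mapping.single x c ^ n = Poly_Mapping.single (nmul n x) (c ^ n :: 'k::comm_semiring_1)"
  by (induction n) (auto simp: mult_single)

lemma semigroup_gen_base: "g \<in> G \<Longrightarrow> g \<in> semigroup_gen G"
  using semigroup_gen.add[of g G 0] semigroup_gen.zero[of G] by simp

lemma semigroup_gen_add:
  assumes "x \<in> semigroup_gen G" "y \<in> semigroup_gen G"
  shows "x + y \<in> semigroup_gen G"
  using assms(1) by induction (auto simp: assms(2) add.assoc intro: semigroup_gen.intros)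

lemma semigroup_gen_nmul: "x \<in> semigroup_gen G \<Longrightarrow> nmul n x \<in> semigroup_gen G"
  by (induction n) (auto intro: semigroup_gen_add semigroup_gen.zero)

lemma semigroup_gen_sum:
  assumes "\<And>i. i \<in> I \<Longrightarrow> f i \<in> semigroup_gen G"
  shows "sum f I \<in> semigroup_gen G"
  using assms by (induction I rule: infinite_finite_induct) (auto intro: semigroup_gen_add semigroup_gen.zero)

lemma semigroup_gen_mono: "G \<subseteq> H \<Longrightarrow> semigroup_gen G \<subseteq> semigroup_gen H"
proof
  fix x assume "x \<in> semigroup_gen G" "G \<subseteq> H"
  then show "x \<in> semigroup_gen H" by induction (auto intro: semigroup_gen.intros)
qed

lemma semigroup_gen_eq_sums:
  assumes "finite G"
  shows "semigroup_gen G = {\<Sum>g\<in>G. nmul (c g) g | c. True}"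
proof (intro equalityI subsetI)
  fix x assume "x \<in> semigroup_gen G"
  then show "x \<in> {\<Sum>g\<in>G. nmul (c g) g | c. True}"
  proof induction
    case zero
    show ?case by (auto intro!: exI[of _ "\<lambda>_. 0"])
  next
    case (add g x)
    then obtain c where c: "x = (\<Sum>g\<in>G. nmul (c g) g)" by auto
    have "(\<Sum>h\<in>G. nmul ((c(g := Suc (c g))) h) h) = (\<Sum>h\<in>G. (if h = g then g else 0) + nmul (c h) h)"
      by (intro sum.cong) auto
    also have "\<dots> = g + x"
      using add.hyps(1) assms by (simp add: sum.distrib c)
    finally show ?case
      by (intro CollectI exI[of _ "c(g := Suc (c g))"] conjI TrueI) (rule sym)
  qed
next
  fix x assume "x \<in> {\<Sum>g\<in>G. nmul (c g) g | c. True}"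
  then show "x \<in> semigroup_gen G"
    by (auto intro!: semigroup_gen_sum semigroup_gen_nmul intro: semigroup_gen_base)
qed

text \<open>A coefficient of size at least q would split off \<open>nmul q g\<close> and leave an
  element of the semigroup. The coefficient bound gives finiteness of the complement here and
  boundedness of the rescaled complements later.\<close>

lemma not_above_multiples_repr:
  assumes "finite G" and s: "s \<in> semigroup_gen G"
    and n: "\<not> (\<exists>g\<in>G. \<exists>t\<in>semigroup_gen G. s = nmul q g + t)"
  shows "\<exists>c. s = (\<Sum>g\<in>G. nmul (c g) g) \<and> (\<forall>g\<in>G. c g < q)"
proof -
  from s obtain c where c: "s = (\<Sum>g\<in>G. nmul (c g) g)"
    using semigroup_gen_eq_sums[OF assms(1)] by auto
  have "c g < q" if "g \<in> G" for g
  proof (rule ccontr)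
    assume "\<not> c g < q"
    then have "nmul (c g) g = nmul q g + nmul (c g - q) g" by (simp flip: nmul_add)
    then have "s = nmul q g + (nmul (c g - q) g + (\<Sum>g\<in>G - {g}. nmul (c g) g))"
      using assms(1) that by (simp add: c sum.remove add.assoc)
    moreover have "nmul (c g - q) g + (\<Sum>g\<in>G - {g}. nmul (c g) g) \<in> semigroup_gen G"
      using that by (intro semigroup_gen_add semigroup_gen_sum semigroup_gen_nmul) (auto intro: semigroup_gen_base)
    ultimately show False using n that by blast
  qed
  with c show ?thesis by blast
qed

lemma finite_not_above_multiples:
  assumes "finite G"
  shows "finite {s \<in> semigroup_gen G. \<not> (\<exists>g\<in>G. \<exists>t\<in>semigroup_gen G. s = nmul q g + t)}" (is "finite ?B")
proof -
  have "?B \<subseteq> (\<lambda>c. \<Sum>g\<in>G. nmul (c g) g) ` (G \<rightarrow>\<^sub>E {..<q})"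
  proof
    fix s assume "s \<in> ?B"
    then obtain c where c: "s = (\<Sum>g\<in>G. nmul (c g) g)" "\<forall>g\<in>G. c g < q"
      using not_above_multiples_repr[OF assms, of s q] by blast
    then have "restrict c G \<in> G \<rightarrow>\<^sub>E {..<q}" by auto
    moreover have "s = (\<Sum>g\<in>G. nmul (restrict c G g) g)" by (simp add: c)
    ultimately show "s \<in> (\<lambda>c. \<Sum>g\<in>G. nmul (c g) g) ` (G \<rightarrow>\<^sub>E {..<q})" by blast
  qed
  moreover have "finite (G \<rightarrow>\<^sub>E {..<q})" using assms by (intro finite_PiE) auto
  ultimately show ?thesis by (meson finite_imageI finite_subset)
qed

lemma above_multiples_closed:
  assumes s: "s \<in> semigroup_gen G"
    and e: "e \<in> {s \<in> semigroup_gen G. \<exists>g\<in>G. \<exists>t\<in>semigroup_gen G. s = nmul q g + t}"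
  shows "s + e \<in> {s \<in> semigroup_gen G. \<exists>g\<in>G. \<exists>t\<in>semigroup_gen G. s = nmul q g + t}"
proof -
  from e obtain g t where gt: "g \<in> G" "t \<in> semigroup_gen G" "e = nmul q g + t" by blast
  have "s + e = nmul q g + (s + t)" by (simp add: gt add_ac)
  moreover have "s + t \<in> semigroup_gen G" "s + e \<in> semigroup_gen G"
    using s e gt by (auto intro: semigroup_gen_add)
  ultimately show ?thesis using gt(1) by blast
qed

text \<open>Additivity of q-th powers is used inside the monoid algebra, so its characteristic has
  to be that of K, which embeds through the exponent 0.\<close>

lemma CHAR_poly_mapping:
  "CHAR('m::comm_monoid_add \<Rightarrow>\<^sub>0 'k::comm_semiring_1) = CHAR('k)"
proof (rule CHAR_eqI)
  show "of_nat CHAR('k) = (0 :: 'm \<Rightarrow>\<^sub>0 'k)"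
    by (simp flip: single_of_nat)
  show "CHAR('k) dvd n" if "of_nat n = (0 :: 'm \<Rightarrow>\<^sub>0 'k)" for n
  proof -
    have "Poly_Mapping.single (0::'m) (of_nat n :: 'k) = 0"
      using that unfolding single_of_nat .
    then have "(of_nat n :: 'k) = 0" by (metis lookup_single_eq lookup_zero)
    then show ?thesis by (simp add: of_nat_eq_0_iff_char_dvd)
  qed
qed

text \<open>With all generators in degree one, powers of the maximal ideal are truncations by
  degree, and nonzero elements have positive degree, which is the monotonicity that the length
  computation asks for.\<close>

locale standard_graded_semigroup =
  fixes G :: "'m::comm_monoid_add set" and deg :: "'m \<Rightarrow> int"
  assumes finite_gens: "finite G"
    and deg_add: "deg (x + y) = deg x + deg y"
    and deg_gen: "g \<in> G \<Longrightarrow> deg g = 1"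
begin

sublocale add_submonoid "semigroup_gen G"
  by standard (auto intro: semigroup_gen.zero semigroup_gen_add)

lemma deg_zero: "deg 0 = 0"
  using deg_add[of 0 0] by simp

lemma deg_nonneg: "s \<in> semigroup_gen G \<Longrightarrow> deg s \<ge> 0"
  by (induction rule: semigroup_gen.induct) (auto simp: deg_zero deg_add deg_gen)

lemma deg_pos: "s \<in> semigroup_gen G \<Longrightarrow> s \<noteq> 0 \<Longrightarrow> deg s > 0"
  by (cases rule: semigroup_gen.cases) (use deg_nonneg in \<open>fastforce simp: deg_add deg_gen\<close>)+

lemma deg_less: "s \<in> semigroup_gen G \<Longrightarrow> s \<noteq> 0 \<Longrightarrow> deg t < deg (s + t)"
  using deg_pos[of s] by (simp add: deg_add)

definition graded_max_ideal :: "('m \<Rightarrow>\<^sub>0 'k::field) set" where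
  "graded_max_ideal = genideal (semigroup_ring (semigroup_gen G)) ((\<lambda>s. Poly_Mapping.single s 1) ` G)"

lemma nonzero_add_mem:
  "\<lbrakk>s \<in> semigroup_gen G; e \<in> semigroup_gen G - {0}\<rbrakk> \<Longrightarrow> s + e \<in> semigroup_gen G - {0}"
  using deg_pos[of e] deg_nonneg[of s] deg_add[of s e] deg_zero by (auto intro: semigroup_gen_add)

text \<open>A nonzero element of the semigroup has a generator as a summand, so its character is a
  multiple of a generating one.\<close>

lemma graded_max_ideal_eq:
  "(graded_max_ideal :: ('m \<Rightarrow>\<^sub>0 'k::field) set) = monomial_span (semigroup_gen G - {0})"
proof
  let ?R = "semigroup_ring (semigroup_gen G) :: ('m \<Rightarrow>\<^sub>0 'k) ring"
  interpret R: ring ?R by (rule ring_semigroup_ring)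
  have g0: "g \<noteq> 0" if "g \<in> G" for g using deg_gen[OF that] deg_zero by auto
  have sub: "(\<lambda>s. Poly_Mapping.single s (1::'k)) ` G \<subseteq> monomial_span (semigroup_gen G - {0})"
    using g0 by (auto intro!: single_mem_monomial_span semigroup_gen_base)
  show "(graded_max_ideal :: ('m \<Rightarrow>\<^sub>0 'k) set) \<subseteq> monomial_span (semigroup_gen G - {0})"
    unfolding graded_max_ideal_def
    by (rule R.genideal_minimal[OF ideal_monomial_span sub]) (use nonzero_add_mem in auto)
  have gc: "(\<lambda>s. Poly_Mapping.single s (1::'k)) ` G \<subseteq> carrier ?R"
    unfolding carrier_semigroup_ring by (auto intro!: single_mem_monomial_span semigroup_gen_base)
  have id: "ideal (graded_max_ideal :: ('m \<Rightarrow>\<^sub>0 'k) set) ?R"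
    unfolding graded_max_ideal_def by (rule R.genideal_ideal[OF gc])
  show "monomial_span (semigroup_gen G - {0}) \<subseteq> (graded_max_ideal :: ('m \<Rightarrow>\<^sub>0 'k) set)"
  proof (rule monomial_span_subset_ideal[OF id])
    fix s assume "s \<in> semigroup_gen G - {0}"
    then obtain g x where gx: "s = g + x" "g \<in> G" "x \<in> semigroup_gen G"
      using semigroup_gen.cases[of s G] by auto
    have "Poly_Mapping.single g 1 \<in> (graded_max_ideal :: ('m \<Rightarrow>\<^sub>0 'k) set)"
      unfolding graded_max_ideal_def using R.genideal_self[OF gc] gx(2) by blast
    then have "Poly_Mapping.single x 1 * Poly_Mapping.single g 1 \<in> (graded_max_ideal :: ('m \<Rightarrow>\<^sub>0 'k) set)"
      by (intro ideal_mult_mem[OF id] single_mem_monomial_span gx)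
    then show "Poly_Mapping.single s 1 \<in> (graded_max_ideal :: ('m \<Rightarrow>\<^sub>0 'k) set)"
      by (simp add: mult_single gx add.commute)
  qed
qed

lemma ideal_graded_max_ideal:
  "ideal (graded_max_ideal :: ('m \<Rightarrow>\<^sub>0 'k::field) set) (semigroup_ring (semigroup_gen G))"
  unfolding graded_max_ideal_eq by (rule ideal_monomial_span) (use nonzero_add_mem in auto)

lemma ideal_deg_ge:
  "ideal (monomial_span {s \<in> semigroup_gen G. deg s \<ge> n} :: ('m \<Rightarrow>\<^sub>0 'k::field) set)
     (semigroup_ring (semigroup_gen G))"
  by (rule ideal_monomial_span) (use deg_nonneg in \<open>fastforce simp: deg_add intro: semigroup_gen_add\<close>)+

text \<open>As all generators have degree one, splitting one off an element of degree at least n + 1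
  lowers the degree by exactly one.\<close>

lemma ideal_power_graded_max_ideal:
  "ideal_power (semigroup_ring (semigroup_gen G)) (graded_max_ideal :: ('m \<Rightarrow>\<^sub>0 'k::field) set) n =
     monomial_span {s \<in> semigroup_gen G. deg s \<ge> int n}"
proof (induction n)
  case 0
  have "{s \<in> semigroup_gen G. deg s \<ge> int 0} = semigroup_gen G" using deg_nonneg by auto
  then show ?case by (simp add: carrier_semigroup_ring)
next
  case (Suc n)
  let ?R = "semigroup_ring (semigroup_gen G) :: ('m \<Rightarrow>\<^sub>0 'k) ring"
  let ?E = "\<lambda>n. {s \<in> semigroup_gen G. deg s \<ge> int n}"
  let ?M = "graded_max_ideal :: ('m \<Rightarrow>\<^sub>0 'k) set"
  interpret R: ring ?R by (rule ring_semigroup_ring)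
  have id: "ideal (ideal_prod ?R (monomial_span (?E n)) ?M) ?R"
    by (rule R.ideal_prod_is_ideal[OF ideal_deg_ge ideal_graded_max_ideal])
  have "ideal_prod ?R (monomial_span (?E n)) ?M = monomial_span (?E (Suc n))"
  proof
    show "ideal_prod ?R (monomial_span (?E n)) ?M \<subseteq> monomial_span (?E (Suc n))"
    proof
      fix f assume "f \<in> ideal_prod ?R (monomial_span (?E n)) ?M"
      then show "f \<in> monomial_span (?E (Suc n))"
      proof induction
        case (prod i j)
        then show ?case unfolding mult_semigroup_ring graded_max_ideal_eq
        proof (rule monomial_span_mult)
          fix a b assume "a \<in> ?E n" "b \<in> semigroup_gen G - {0}"
          with deg_pos[of b] show "a + b \<in> ?E (Suc n)" by (auto simp: deg_add intro: semigroup_gen_add)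
        qed
      next
        case (sum a b)
        then show ?case unfolding add_semigroup_ring by (intro monomial_span_add)
      qed
    qed
    show "monomial_span (?E (Suc n)) \<subseteq> ideal_prod ?R (monomial_span (?E n)) ?M"
    proof (rule monomial_span_subset_ideal[OF id])
      fix s assume s: "s \<in> ?E (Suc n)"
      then have "s \<noteq> 0" using deg_zero by auto
      with s obtain g x where gx: "s = g + x" "g \<in> G" "x \<in> semigroup_gen G"
        using semigroup_gen.cases[of s G] by auto
      have "g \<noteq> 0" using deg_gen[OF gx(2)] deg_zero by auto
      have "Poly_Mapping.single x 1 \<otimes>\<^bsub>?R\<^esub> Poly_Mapping.single g 1 \<in> ideal_prod ?R (monomial_span (?E n)) ?M"
        unfolding graded_max_ideal_eq
        by (intro ideal_prod.prod single_mem_monomial_span)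
          (use s gx \<open>g \<noteq> 0\<close> in \<open>auto simp: deg_add deg_gen semigroup_gen_base\<close>)
      then show "Poly_Mapping.single s 1 \<in> ideal_prod ?R (monomial_span (?E n)) ?M"
        by (simp add: mult_semigroup_ring mult_single gx add.commute)
    qed
  qed
  with Suc show ?case by simp
qed

text \<open>An element above \<open>nmul n g\<close> has degree at least n, so the elements of low
  degree fall into the finite set of those above no such multiple.\<close>

lemma finite_deg_less: "finite {s \<in> semigroup_gen G. deg s < int n}"
proof -
  have "{s \<in> semigroup_gen G. deg s < int n} \<subseteq>
      {s \<in> semigroup_gen G. \<not> (\<exists>g\<in>G. \<exists>t\<in>semigroup_gen G. s = nmul n g + t)}"
  proof clarify
    fix g t assume "deg (nmul n g + t) < int n" and gt: "g \<in> G" "t \<in> semigroup_gen G"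
    moreover have "deg (nmul n g) = int n"
      by (induction n) (auto simp: deg_zero deg_add deg_gen gt)
    ultimately show False using deg_nonneg[OF gt(2)] by (simp add: deg_add)
  qed
  then show ?thesis using finite_not_above_multiples[OF finite_gens] finite_subset by blast
qed

lemma quot_length_ideal_power:
  "quot_length (semigroup_ring (semigroup_gen G))
     (ideal_power (semigroup_ring (semigroup_gen G)) (graded_max_ideal :: ('m \<Rightarrow>\<^sub>0 'k::field) set) n)
   = card {s \<in> semigroup_gen G. deg s < int n}"
proof -
  have eq: "semigroup_gen G - {s \<in> semigroup_gen G. deg s \<ge> int n} = {s \<in> semigroup_gen G. deg s < int n}"
    by auto
  have "quot_length (semigroup_ring (semigroup_gen G) :: ('m \<Rightarrow>\<^sub>0 'k) ring)
      (monomial_span {s \<in> semigroup_gen G. deg s \<ge> int n})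
      = card (semigroup_gen G - {s \<in> semigroup_gen G. deg s \<ge> int n})"
  proof (rule quot_length_monomial_span[where deg = deg])
    show "finite (semigroup_gen G - {s \<in> semigroup_gen G. deg s \<ge> int n})"
      unfolding eq by (rule finite_deg_less)
    show "s + e \<in> {s \<in> semigroup_gen G. deg s \<ge> int n}"
      if "s \<in> semigroup_gen G" "e \<in> {s \<in> semigroup_gen G. deg s \<ge> int n}" for s e
      using that deg_nonneg[of s] by (auto simp: deg_add intro: semigroup_gen_add)
  qed (auto intro: deg_less)
  then show ?thesis by (simp add: ideal_power_graded_max_ideal eq)
qed

lemma nat_pow_semigroup_ring:
  "x [^]\<^bsub>semigroup_ring (semigroup_gen G)\<^esub> (n::nat) = (x :: 'm \<Rightarrow>\<^sub>0 'k::field) ^ n"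
  by (induction n) (auto simp: nat_pow_def ring_simps mult.commute)

text \<open>In characteristic p the q-th power of a sum is the sum of the q-th powers of its terms,
  and for s nonzero the exponent \<open>nmul q s\<close> lies above \<open>nmul q g\<close> for some
  generator g. The ideal is therefore monomial.\<close>

lemma frobenius_power_graded_max_ideal:
  assumes p: "CHAR('k) > 0" and q_def: "q = CHAR('k) ^ n"
  shows "frobenius_power (semigroup_ring (semigroup_gen G)) (graded_max_ideal :: ('m \<Rightarrow>\<^sub>0 'k::field) set) q =
     monomial_span {s \<in> semigroup_gen G. \<exists>g\<in>G. \<exists>t\<in>semigroup_gen G. s = nmul q g + t}"
    (is "_ = monomial_span ?E")
proof
  let ?R = "semigroup_ring (semigroup_gen G) :: ('m \<Rightarrow>\<^sub>0 'k) ring"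
  let ?M = "graded_max_ideal :: ('m \<Rightarrow>\<^sub>0 'k) set"
  interpret R: ring ?R by (rule ring_semigroup_ring)
  have prime: "prime CHAR('m \<Rightarrow>\<^sub>0 'k)"
    unfolding CHAR_poly_mapping using p by (rule prime_CHAR_semidom)
  have idE: "ideal (monomial_span ?E) ?R"
  proof (rule ideal_monomial_span)
    fix s e assume "s \<in> semigroup_gen G" "e \<in> ?E"
    then show "s + e \<in> ?E" by (rule above_multiples_closed)
  qed auto
  have sub: "(\<lambda>x. x [^]\<^bsub>?R\<^esub> q) ` ?M \<subseteq> monomial_span ?E"
  proof clarify
    fix x assume x: "x \<in> ?M"
    have "x ^ q = (\<Sum>s\<in>Poly_Mapping.keys x. Poly_Mapping.single s (Poly_Mapping.lookup x s)) ^ q"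
      by (simp add: sum_single_lookup)
    also have "\<dots> = (\<Sum>s\<in>Poly_Mapping.keys x. Poly_Mapping.single s (Poly_Mapping.lookup x s) ^ q)"
      by (rule freshmans_dream_sum'[OF prime]) (simp add: q_def CHAR_poly_mapping)
    also have "\<dots> \<in> monomial_span ?E"
    proof (rule sum_mem_monomial_span)
      fix s assume "s \<in> Poly_Mapping.keys x"
      then have "s \<in> semigroup_gen G - {0}" using x by (auto simp: graded_max_ideal_eq monomial_span_def)
      then obtain g t where gt: "s = g + t" "g \<in> G" "t \<in> semigroup_gen G"
        using semigroup_gen.cases[of s G] by auto
      have "nmul q s = nmul q g + nmul q t" "nmul q t \<in> semigroup_gen G" "nmul q g \<in> semigroup_gen G"
        using gt by (auto simp: nmul_distrib intro: semigroup_gen_nmul semigroup_gen_base)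
      with gt(2) have "nmul q s \<in> ?E" by (auto intro: semigroup_gen_add)
      then show "Poly_Mapping.single s (Poly_Mapping.lookup x s) ^ q \<in> monomial_span ?E"
        unfolding power_single by (rule single_mem_monomial_span)
    qed
    finally show "x [^]\<^bsub>?R\<^esub> q \<in> monomial_span ?E" by (simp add: nat_pow_semigroup_ring)
  qed
  show "frobenius_power ?R ?M q \<subseteq> monomial_span ?E"
    unfolding frobenius_power_def by (rule R.genideal_minimal[OF idE sub])
  have gc: "(\<lambda>x. x [^]\<^bsub>?R\<^esub> q) ` ?M \<subseteq> carrier ?R"
    using sub monomial_span_mono[of ?E "semigroup_gen G"] unfolding carrier_semigroup_ring by blast
  have id: "ideal (frobenius_power ?R ?M q) ?R"
    unfolding frobenius_power_def by (rule R.genideal_ideal[OF gc])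
  show "monomial_span ?E \<subseteq> frobenius_power ?R ?M q"
  proof (rule monomial_span_subset_ideal[OF id])
    fix s assume "s \<in> ?E"
    then obtain g t where gt: "s = nmul q g + t" "g \<in> G" "t \<in> semigroup_gen G" by auto
    have "g \<noteq> 0" using deg_gen[OF gt(2)] deg_zero by auto
    then have "Poly_Mapping.single g 1 \<in> ?M"
      unfolding graded_max_ideal_eq using gt by (intro single_mem_monomial_span) (auto intro: semigroup_gen_base)
    then have "Poly_Mapping.single g 1 [^]\<^bsub>?R\<^esub> q \<in> frobenius_power ?R ?M q"
      unfolding frobenius_power_def using R.genideal_self[OF gc] by blast
    then have "Poly_Mapping.single (nmul q g) 1 \<in> frobenius_power ?R ?M q"
      by (simp add: nat_pow_semigroup_ring power_single)
    then have "Poly_Mapping.single t 1 * Poly_Mapping.single (nmul q g) 1 \<in> frobenius_power ?R ?M q"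
      by (intro ideal_mult_mem[OF id] single_mem_monomial_span gt)
    then show "Poly_Mapping.single s 1 \<in> frobenius_power ?R ?M q"
      by (simp add: mult_single gt add.commute)
  qed
qed

lemma quot_length_frobenius_power:
  assumes p: "CHAR('k) > 0" and q_def: "q = CHAR('k) ^ n"
  shows "quot_length (semigroup_ring (semigroup_gen G))
     (frobenius_power (semigroup_ring (semigroup_gen G)) (graded_max_ideal :: ('m \<Rightarrow>\<^sub>0 'k::field) set) q)
   = card {s \<in> semigroup_gen G. \<not> (\<exists>g\<in>G. \<exists>t\<in>semigroup_gen G. s = nmul q g + t)}"
proof -
  let ?E = "{s \<in> semigroup_gen G. \<exists>g\<in>G. \<exists>t\<in>semigroup_gen G. s = nmul q g + t}"
  have eq: "semigroup_gen G - ?E = {s \<in> semigroup_gen G. \<not> (\<exists>g\<in>G. \<exists>t\<in>semigroup_gen G. s = nmul q g + t)}"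
    by auto
  have "quot_length (semigroup_ring (semigroup_gen G) :: ('m \<Rightarrow>\<^sub>0 'k) ring) (monomial_span ?E)
      = card (semigroup_gen G - ?E)"
  proof (rule quot_length_monomial_span[where deg = deg])
    show "finite (semigroup_gen G - ?E)"
      unfolding eq by (rule finite_not_above_multiples[OF finite_gens])
    fix s e assume "s \<in> semigroup_gen G" "e \<in> ?E"
    then show "s + e \<in> ?E" by (rule above_multiples_closed)
  qed (auto intro: deg_less)
  then show ?thesis
    unfolding frobenius_power_graded_max_ideal[OF p q_def] eq by simp
qed

end

section \<open>Lattice sums as integrals\<close>

text \<open>Its level sets are half-open unit cubes. A sum over lattice points thus becomes the
  integral of a step function, open to the convergence theorems for a fixed measure.\<close>

definition floor_vec :: "'a::euclidean_space \<Rightarrow> 'a" where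
  "floor_vec x = (\<Sum>b\<in>Basis. real_of_int \<lfloor>x \<bullet> b\<rfloor> *\<^sub>R b)"

definition int_lattice :: "'a::euclidean_space set" where
  "int_lattice = {z. \<forall>b\<in>Basis. z \<bullet> b \<in> \<int>}"

lemma floor_vec_inner: "b \<in> Basis \<Longrightarrow> floor_vec x \<bullet> b = \<lfloor>x \<bullet> b\<rfloor>"
  by (simp add: floor_vec_def inner_sum_left inner_Basis if_distrib cong: if_cong)

lemma floor_vec_mem: "floor_vec x \<in> int_lattice"
  by (simp add: int_lattice_def floor_vec_inner)

lemma int_lattice_innerE:
  assumes "z \<in> int_lattice" "b \<in> Basis"
  obtains m where "z \<bullet> b = of_int m"
proof -
  from assms have "z \<bullet> b \<in> \<int>" by (simp add: int_lattice_def)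
  then show thesis using that by (rule Ints_cases)
qed

lemma int_lattice_0: "0 \<in> int_lattice"
  and int_lattice_uminus: "x \<in> int_lattice \<Longrightarrow> - x \<in> int_lattice"
  by (auto simp: int_lattice_def)

lemma floor_vec_add: "z \<in> int_lattice \<Longrightarrow> floor_vec (x + z) = floor_vec x + z"
  by (rule euclidean_eqI)
    (auto simp: floor_vec_inner inner_add_left int_lattice_def elim!: Ints_cases)

lemma norm_diff_floor_vec:
  fixes x :: "'a::euclidean_space"
  shows "norm (x - floor_vec x) \<le> DIM('a)"
proof -
  have "norm (x - floor_vec x) \<le> (\<Sum>b\<in>Basis. \<bar>(x - floor_vec x) \<bullet> b\<bar>)" by (rule norm_le_l1)
  also have "\<dots> \<le> (\<Sum>b\<in>(Basis::'a set). 1)"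
  proof (rule sum_mono)
    fix b :: 'a assume "b \<in> Basis"
    then have "(x - floor_vec x) \<bullet> b = x \<bullet> b - \<lfloor>x \<bullet> b\<rfloor>" by (simp add: inner_diff_left floor_vec_inner)
    then show "\<bar>(x - floor_vec x) \<bullet> b\<bar> \<le> 1" by linarith
  qed
  finally show ?thesis by simp
qed

lemma borel_measurable_floor_vec [measurable]: "floor_vec \<in> borel_measurable borel"
  unfolding floor_vec_def[abs_def] by measurable

lemma finite_int_lattice_bounded:
  assumes "bounded X"
  shows "finite (X \<inter> (int_lattice :: 'a::euclidean_space set))"
proof -
  obtain B where B: "\<And>x. x \<in> X \<Longrightarrow> norm x \<le> B" using assms by (auto simp: bounded_iff)
  have "X \<inter> int_lattice \<subseteq> (\<lambda>f. \<Sum>b\<in>Basis. real_of_int (f b) *\<^sub>R b) ` (Basis \<rightarrow>\<^sub>E {-\<lceil>B\<rceil>..\<lceil>B\<rceil>})"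
  proof
    fix x assume x: "x \<in> X \<inter> int_lattice"
    define f where "f = restrict (\<lambda>b. \<lfloor>x \<bullet> b\<rfloor>) Basis"
    have fb: "f b \<in> {-\<lceil>B\<rceil>..\<lceil>B\<rceil>}" if b: "b \<in> Basis" for b
    proof -
      obtain m where m: "x \<bullet> b = of_int m" using x b by (auto elim: int_lattice_innerE)
      have "\<bar>x \<bullet> b\<bar> \<le> B" using Basis_le_norm[OF b, of x] B[of x] x by auto
      then have "real_of_int \<bar>m\<bar> \<le> B" by (simp add: m)
      then have "\<bar>m\<bar> \<le> \<lceil>B\<rceil>" by (metis ceiling_mono ceiling_of_int)
      then have "m \<in> {-\<lceil>B\<rceil>..\<lceil>B\<rceil>}" by auto
      then show ?thesis using b by (simp add: f_def m)
    qed
    have xf: "x = (\<Sum>b\<in>Basis. real_of_int (f b) *\<^sub>R b)"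
    proof (rule euclidean_eqI)
      fix b :: 'a assume b: "b \<in> Basis"
      obtain m where "x \<bullet> b = of_int m" using x b by (auto elim: int_lattice_innerE)
      with b show "x \<bullet> b = (\<Sum>b\<in>Basis. real_of_int (f b) *\<^sub>R b) \<bullet> b"
        by (simp add: f_def inner_sum_left inner_Basis if_distrib cong: if_cong)
    qed
    have "f \<in> Basis \<rightarrow>\<^sub>E {-\<lceil>B\<rceil>..\<lceil>B\<rceil>}"
      using fb by (intro PiE_I) (auto simp: f_def)
    with xf show "x \<in> (\<lambda>f. \<Sum>b\<in>Basis. real_of_int (f b) *\<^sub>R b) ` (Basis \<rightarrow>\<^sub>E {-\<lceil>B\<rceil>..\<lceil>B\<rceil>})"
      by (rule image_eqI)
  qed
  moreover have "finite (Basis \<rightarrow>\<^sub>E {-\<lceil>B\<rceil>..\<lceil>B\<rceil>} :: ('a \<Rightarrow> int) set)"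
    by (intro finite_PiE finite_Basis) simp
  ultimately show ?thesis by (meson finite_imageI finite_subset)
qed

text \<open>The half-open cube lies between the open and the closed box with the same corners, which
  have equal volume.\<close>

lemma emeasure_scaled_cell:
  fixes z :: "'a::euclidean_space"
  assumes z: "z \<in> int_lattice" and q: "q > 0"
  shows "emeasure lborel {x. floor_vec (q *\<^sub>R x) = z} = ennreal (1 / q ^ DIM('a))"
proof (rule antisym)
  define l u where "l = z /\<^sub>R q" and "u = (z + One) /\<^sub>R q"
  have lu: "l \<bullet> b \<le> u \<bullet> b" "(u - l) \<bullet> b = 1 / q" if "b \<in> Basis" for b
    using that q by (simp_all add: l_def u_def inner_add_left inner_diff_left field_simps)
  have prod: "(\<Prod>b\<in>Basis. (u - l) \<bullet> b) = 1 / q ^ DIM('a)"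
    using lu(2) by (simp add: power_one_over)
  have fl: "\<lfloor>q * (x \<bullet> b)\<rfloor> = z \<bullet> b \<longleftrightarrow> l \<bullet> b \<le> x \<bullet> b \<and> x \<bullet> b < u \<bullet> b" if b: "b \<in> Basis" for x b
  proof -
    obtain m where m: "z \<bullet> b = of_int m" by (rule int_lattice_innerE[OF z b])
    have "\<lfloor>q * (x \<bullet> b)\<rfloor> = m \<longleftrightarrow> of_int m \<le> q * (x \<bullet> b) \<and> q * (x \<bullet> b) < of_int m + 1"
      by (simp add: floor_eq_iff)
    also have "\<dots> \<longleftrightarrow> l \<bullet> b \<le> x \<bullet> b \<and> x \<bullet> b < u \<bullet> b"
      using q b by (simp add: l_def u_def inner_add_left m field_simps)
    finally show ?thesis by (simp add: m)
  qed
  have cell: "{x. floor_vec (q *\<^sub>R x) = z} = {x. \<forall>b\<in>Basis. l \<bullet> b \<le> x \<bullet> b \<and> x \<bullet> b < u \<bullet> b}"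
    using fl by (auto simp: euclidean_eq_iff[where 'a = 'a] floor_vec_inner)
  have meas: "{x. floor_vec (q *\<^sub>R x) = z} \<in> sets lborel" by measurable
  have "{x. floor_vec (q *\<^sub>R x) = z} \<subseteq> cbox l u" unfolding cell by (force simp: mem_box intro: less_imp_le)
  then have "emeasure lborel {x. floor_vec (q *\<^sub>R x) = z} \<le> emeasure lborel (cbox l u)"
    by (intro emeasure_mono) auto
  also have "\<dots> = ennreal (1 / q ^ DIM('a))"
    using lu(1) by (simp add: emeasure_lborel_cbox prod)
  finally show "emeasure lborel {x. floor_vec (q *\<^sub>R x) = z} \<le> ennreal (1 / q ^ DIM('a))" .
  have "ennreal (1 / q ^ DIM('a)) = emeasure lborel (box l u)"
    using lu(1) by (simp add: emeasure_lborel_box prod)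
  also have "\<dots> \<le> emeasure lborel {x. floor_vec (q *\<^sub>R x) = z}"
    using meas unfolding cell by (intro emeasure_mono) (auto simp: mem_box less_imp_le)
  finally show "ennreal (1 / q ^ DIM('a)) \<le> emeasure lborel {x. floor_vec (q *\<^sub>R x) = z}" .
qed

lemma has_bochner_integral_lattice_sum:
  fixes g :: "'a::euclidean_space \<Rightarrow> real"
  assumes fin: "finite Z" and Z: "Z \<subseteq> int_lattice" and g: "\<And>z. z \<notin> Z \<Longrightarrow> g z = 0" and q: "q > 0"
  shows "has_bochner_integral lborel (\<lambda>y. g (floor_vec (q *\<^sub>R y))) ((\<Sum>z\<in>Z. g z) / q ^ DIM('a))"
proof -
  have eq: "(\<lambda>y. g (floor_vec (q *\<^sub>R y))) = (\<lambda>y. \<Sum>z\<in>Z. g z * indicator {x. floor_vec (q *\<^sub>R x) = z} y)"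
  proof
    fix y
    have "(\<Sum>z\<in>Z. g z * indicator {x. floor_vec (q *\<^sub>R x) = z} y)
        = (\<Sum>z\<in>Z. if z = floor_vec (q *\<^sub>R y) then g z else 0)"
      by (intro sum.cong) (auto simp: indicator_def)
    also have "\<dots> = g (floor_vec (q *\<^sub>R y))" using fin g by simp
    finally show "g (floor_vec (q *\<^sub>R y)) = (\<Sum>z\<in>Z. g z * indicator {x. floor_vec (q *\<^sub>R x) = z} y)" by simp
  qed
  have "has_bochner_integral lborel (\<lambda>y. \<Sum>z\<in>Z. g z * indicator {x. floor_vec (q *\<^sub>R x) = z} y)
     (\<Sum>z\<in>Z. g z * (1 / q ^ DIM('a)))"
  proof (intro has_bochner_integral_sum has_bochner_integral_mult_right)
    fix z assume "z \<in> Z"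
    then have e: "emeasure lborel {x. floor_vec (q *\<^sub>R x) = z} = ennreal (1 / q ^ DIM('a))"
      using Z q by (intro emeasure_scaled_cell) auto
    then have m: "measure lborel {x. floor_vec (q *\<^sub>R x) = z} = 1 / q ^ DIM('a)"
      using q by (simp add: measure_def)
    have "has_bochner_integral lborel (indicat_real {x. floor_vec (q *\<^sub>R x) = z})
       (measure lborel {x. floor_vec (q *\<^sub>R x) = z})"
      by (rule has_bochner_integral_real_indicator) (measurable, simp add: e)
    then show "has_bochner_integral lborel (indicat_real {x. floor_vec (q *\<^sub>R x) = z}) (1 / q ^ DIM('a))"
      by (simp add: m)
  qed
  then show ?thesis unfolding eq by (simp add: sum_divide_distrib)
qed

text \<open>The normalised sum is the integral of the step function obtained by rounding
  \<open>q k *\<^sub>R y\<close>, so dominated convergence applies and each application has to check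
  convergence almost everywhere.\<close>

lemma lattice_sum_limit:
  fixes g :: "nat \<Rightarrow> 'a::euclidean_space \<Rightarrow> real"
  assumes q: "filterlim q at_top sequentially" "\<And>k. q k \<ge> 1"
    and fin: "\<And>k. finite (Z k)" and Z: "\<And>k. Z k \<subseteq> int_lattice"
    and g0: "\<And>k z. z \<notin> Z k \<Longrightarrow> g k z = 0"
    and gM: "\<And>k z. \<bar>g k z\<bar> \<le> M"
    and bd: "\<And>k z. z \<in> Z k \<Longrightarrow> norm z \<le> B * q k"
    and h: "h \<in> borel_measurable lborel"
    and lim: "AE y in lborel. (\<lambda>k. g k (floor_vec (q k *\<^sub>R y))) \<longlonglongrightarrow> h y"
  shows "(\<lambda>k. (\<Sum>z\<in>Z k. g k z) / q k ^ DIM('a)) \<longlonglongrightarrow> integral\<^sup>L lborel h"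
proof -
  have q0: "q k > 0" for k using q(2)[of k] by simp
  have hb: "has_bochner_integral lborel (\<lambda>y. g k (floor_vec (q k *\<^sub>R y))) ((\<Sum>z\<in>Z k. g k z) / q k ^ DIM('a))" for k
    by (rule has_bochner_integral_lattice_sum[OF fin Z g0 q0])
  have "(\<lambda>k. integral\<^sup>L lborel (\<lambda>y. g k (floor_vec (q k *\<^sub>R y)))) \<longlonglongrightarrow> integral\<^sup>L lborel h"
  \<comment> \<open>Rounding moves a point by at most \<open>DIM('a)\<close>, and
    \<open>q k \<ge> 1\<close> absorbs this error into the factor \<open>q k\<close>; all step
    functions then live in one ball.\<close>
  proof (rule integral_dominated_convergence[where w = "\<lambda>y. M * indicator (cball 0 (B + DIM('a))) y"])
    show "integrable lborel (\<lambda>y. M * indicat_real (cball (0::'a) (B + DIM('a))) y)"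
      using emeasure_bounded_finite[OF bounded_cball, of "0::'a" "B + DIM('a)"]
      by (intro integrable_mult_right integrable_real_indicator) auto
    show "AE y in lborel. norm (g k (floor_vec (q k *\<^sub>R y))) \<le> M * indicat_real (cball 0 (B + DIM('a))) y" for k
    proof (rule AE_I2)
      fix y :: 'a
      show "norm (g k (floor_vec (q k *\<^sub>R y))) \<le> M * indicat_real (cball 0 (B + DIM('a))) y"
      proof (cases "floor_vec (q k *\<^sub>R y) \<in> Z k")
        case True
        have "q k * norm y = norm (q k *\<^sub>R y)" using q0[of k] by simp
        also have "\<dots> \<le> norm (floor_vec (q k *\<^sub>R y)) + norm (q k *\<^sub>R y - floor_vec (q k *\<^sub>R y))"
          using norm_triangle_ineq[of "floor_vec (q k *\<^sub>R y)" "q k *\<^sub>R y - floor_vec (q k *\<^sub>R y)"] by simp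
        also have "\<dots> \<le> B * q k + DIM('a)"
          using bd[OF True] norm_diff_floor_vec[of "q k *\<^sub>R y"] by linarith
        also have "\<dots> \<le> B * q k + DIM('a) * q k"
          using q(2)[of k] by (simp add: mult_le_cancel_left1)
        also have "\<dots> = q k * (B + DIM('a))" by (simp add: algebra_simps)
        finally have "norm y \<le> B + DIM('a)" using q0[of k] by simp
        then show ?thesis using gM[of k] by simp
      next
        case False
        moreover have "0 \<le> M" using gM[of k 0] by linarith
        ultimately show ?thesis using g0 by simp
      qed
    qed
    show "(\<lambda>y. g k (floor_vec (q k *\<^sub>R y))) \<in> borel_measurable lborel" for k
      using hb[of k] by (rule borel_measurable_has_bochner_integral)
  qed (use h lim in auto)
  moreover have "integral\<^sup>L lborel (\<lambda>y. g k (floor_vec (q k *\<^sub>R y))) = (\<Sum>z\<in>Z k. g k z) / q k ^ DIM('a)" for k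
    using hb[of k] by (rule has_bochner_integral_integral_eq)
  ultimately show ?thesis by simp
qed

lemma floor_vec_scaled_tendsto:
  fixes y :: "'a::euclidean_space"
  assumes q: "filterlim q at_top sequentially" "\<And>k. q k \<ge> 1"
  shows "(\<lambda>k. floor_vec (q k *\<^sub>R y) /\<^sub>R q k) \<longlonglongrightarrow> y"
proof -
  have q0: "q k > 0" for k using q(2)[of k] by simp
  have "(\<lambda>k. DIM('a) / q k) \<longlonglongrightarrow> 0"
    by (intro tendsto_divide_0[OF tendsto_const] filterlim_mono[OF q(1)] at_top_le_at_infinity order.refl)
  then have "(\<lambda>k. floor_vec (q k *\<^sub>R y) /\<^sub>R q k - y) \<longlonglongrightarrow> 0"
  proof (rule Lim_null_comparison[rotated], intro always_eventually allI)
    fix k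
    have "floor_vec (q k *\<^sub>R y) /\<^sub>R q k - y = - ((q k *\<^sub>R y - floor_vec (q k *\<^sub>R y)) /\<^sub>R q k)"
      using q0[of k] by (simp add: scaleR_diff_right)
    then have "norm (floor_vec (q k *\<^sub>R y) /\<^sub>R q k - y) = norm (q k *\<^sub>R y - floor_vec (q k *\<^sub>R y)) / q k"
      using q0[of k] by (simp add: divide_inverse_commute)
    also have "\<dots> \<le> DIM('a) / q k" 
      using norm_diff_floor_vec[of "q k *\<^sub>R y"] q0[of k] by (simp add: divide_right_mono)
    finally show "norm (floor_vec (q k *\<^sub>R y) /\<^sub>R q k - y) \<le> DIM('a) / q k" .
  qed
  then show ?thesis by (simp add: LIM_zero_iff)
qed

lemma lattice_count_limit:
  fixes A :: "'a::euclidean_space set"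
  assumes q: "filterlim q at_top sequentially" "\<And>k. q k \<ge> 1"
    and fin: "\<And>k. finite (Z k)" and Z: "\<And>k. Z k \<subseteq> int_lattice"
    and bd: "\<And>k z. z \<in> Z k \<Longrightarrow> norm z \<le> B * q k"
    and A: "A \<in> sets lborel"
    and lim: "AE y in lborel. \<forall>\<^sub>F k in sequentially. floor_vec (q k *\<^sub>R y) \<in> Z k \<longleftrightarrow> y \<in> A"
  shows "(\<lambda>k. card (Z k) / q k ^ DIM('a)) \<longlonglongrightarrow> measure lborel A"
proof -
  have "(\<lambda>k. (\<Sum>z\<in>Z k. indicat_real (Z k) z) / q k ^ DIM('a)) \<longlonglongrightarrow> integral\<^sup>L lborel (indicat_real A)"
  proof (rule lattice_sum_limit[OF q fin Z _ _ bd, where M = 1])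
    show "AE y in lborel. (\<lambda>k. indicat_real (Z k) (floor_vec (q k *\<^sub>R y))) \<longlonglongrightarrow> indicat_real A y"
      using lim
    proof eventually_elim
      fix y assume "\<forall>\<^sub>F k in sequentially. floor_vec (q k *\<^sub>R y) \<in> Z k \<longleftrightarrow> y \<in> A"
      then have "\<forall>\<^sub>F k in sequentially. indicat_real (Z k) (floor_vec (q k *\<^sub>R y)) = indicat_real A y"
        by eventually_elim (simp add: indicator_def)
      then show "(\<lambda>k. indicat_real (Z k) (floor_vec (q k *\<^sub>R y))) \<longlonglongrightarrow> indicat_real A y"
        by (rule tendsto_eventually)
    qed
  qed (use A in \<open>auto simp: indicator_def\<close>)
  then show ?thesis using A by simp
qed

section \<open>The multiplicities as volumes\<close>

text \<open>Rounded points decide membership correctly in the limit except on the boundary. The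
  regions are built from convex sets, whose boundaries are null.\<close>

lemma AE_not_in_frontier_convex:
  fixes C :: "'a::euclidean_space set"
  assumes "convex C"
  shows "AE y in lborel. y \<notin> frontier C"
proof (rule AE_not_in)
  have "frontier C \<in> null_sets (completion lborel)"
    using negligible_convex_frontier[OF assms] by (simp add: negligible_iff_null_sets)
  moreover have "frontier C \<in> sets lborel" by simp
  ultimately show "frontier C \<in> null_sets lborel" by (simp add: null_sets_completion_iff)
qed

lemma mem_translation_iff: "y \<in> (+) v ` C \<longleftrightarrow> y - v \<in> (C :: 'a::ab_group_add set)"
proof
  assume "y - v \<in> C"
  then show "y \<in> (+) v ` C" by (intro image_eqI[of _ _ "y - v"]) auto
qed auto

lemma rvec_add: "rvec (x + y) = rvec x + rvec y"
  and rvec_diff: "rvec (x - y) = rvec x - rvec y"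
  and rvec_zero: "rvec 0 = 0"
  and rvec_scale: "rvec (k *s x) = of_int k *\<^sub>R rvec x"
  and rvec_uminus: "rvec (- x) = - rvec x"
  by (simp_all add: rvec_def vec_eq_iff)

lemma rvec_inj: "rvec x = rvec y \<longleftrightarrow> x = y"
  by (simp add: rvec_def vec_eq_iff)

lemma rvec_sum: "rvec (sum f A) = (\<Sum>i\<in>A. rvec (f i))"
  by (induction A rule: infinite_finite_induct) (auto simp: rvec_add rvec_zero)

lemma nmul_vec: "nmul k (x :: int^'n) = int k *s x"
  by (induction k) (auto simp: vec_eq_iff algebra_simps)

definition pvec :: "(int^'n) \<times> int \<Rightarrow> (real^'n) \<times> real" where
  "pvec z = (rvec (fst z), real_of_int (snd z))"

lemma pvec_add: "pvec (x + y) = pvec x + pvec y"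
  and pvec_diff: "pvec (x - y) = pvec x - pvec y"
  and pvec_zero: "pvec 0 = 0"
  by (simp_all add: pvec_def rvec_add rvec_diff rvec_zero zero_prod_def)

lemma pvec_nmul: "pvec (nmul n x) = real n *\<^sub>R pvec x"
  by (induction n) (auto simp: pvec_add pvec_zero algebra_simps)

lemma pvec_sum: "pvec (sum f A) = (\<Sum>i\<in>A. pvec (f i))"
  by (induction A rule: infinite_finite_induct) (auto simp: pvec_add pvec_zero)

lemma pvec_inj: "pvec x = pvec y \<longleftrightarrow> x = y"
  by (auto simp: pvec_def rvec_inj prod_eq_iff)

lemma inj_pvec: "inj pvec"
  by (simp add: inj_def pvec_inj)

lemma range_rvec: "range rvec = (int_lattice :: (real^'n) set)"
proof (intro equalityI subsetI)
  fix z :: "real^'n" assume z: "z \<in> int_lattice"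
  have "z $ i \<in> \<int>" for i
  proof -
    have "axis i 1 \<in> (Basis :: (real^'n) set)" by (auto simp: Basis_vec_def)
    with z have "z \<bullet> axis i 1 \<in> \<int>" by (simp add: int_lattice_def)
    then show ?thesis by (simp add: inner_axis)
  qed
  then have "z = rvec (\<chi> i. \<lfloor>z $ i\<rfloor>)" by (simp add: rvec_def vec_eq_iff)
  then show "z \<in> range rvec" by blast
qed (auto simp: int_lattice_def Basis_vec_def inner_axis rvec_def)

lemma range_pvec: "range pvec = (int_lattice :: ((real^'n) \<times> real) set)"
proof (intro equalityI subsetI)
  fix z :: "(real^'n) \<times> real" assume z: "z \<in> int_lattice"
  have "fst z \<in> int_lattice"
    unfolding int_lattice_def
  proof clarify
    fix b :: "real^'n" assume "b \<in> Basis"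
    then have "(b, 0) \<in> (Basis :: ((real^'n) \<times> real) set)" by (auto simp: Basis_prod_def)
    with z have "z \<bullet> (b, 0) \<in> \<int>" unfolding int_lattice_def by blast
    then show "fst z \<bullet> b \<in> \<int>" by (cases z) simp
  qed
  then obtain x where x: "fst z = rvec x" using range_rvec by blast
  have "(0, 1) \<in> (Basis :: ((real^'n) \<times> real) set)" by (auto simp: Basis_prod_def)
  with z have "z \<bullet> (0, 1) \<in> \<int>" unfolding int_lattice_def by blast
  then have "snd z \<in> \<int>" by (cases z) simp
  then obtain t where "snd z = of_int t" by (auto elim: Ints_cases)
  with x have "z = pvec (x, t)" by (simp add: pvec_def prod_eq_iff)
  then show "z \<in> range pvec" by blast
next
  fix z :: "(real^'n) \<times> real" assume "z \<in> range pvec"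
  then obtain x t where z: "z = (rvec x, of_int t)" by (auto simp: pvec_def)
  have "rvec x \<in> int_lattice" using range_rvec by blast
  then show "z \<in> int_lattice" by (auto simp: z int_lattice_def Basis_prod_def)
qed

lemma pvec_mem_int_lattice: "pvec z \<in> int_lattice"
  using range_pvec by blast

lemma rvec_mem_int_lattice: "rvec z \<in> int_lattice"
  using range_rvec by blast

section \<open>The cone and the semigroup over a lattice polytope\<close>

definition hom_cone :: "(real^'n) set \<Rightarrow> ((real^'n) \<times> real) set" where
  "hom_cone Q = conic hull (Q \<times> {1})"

lemma mem_hom_cone: "(x, t) \<in> hom_cone Q \<longleftrightarrow> 0 \<le> t \<and> x \<in> dilate t Q"
  by (auto simp: hom_cone_def conic_hull_explicit dilate_def)

lemma hom_cone_scale: "x \<in> hom_cone Q \<Longrightarrow> c \<ge> 0 \<Longrightarrow> c *\<^sub>R x \<in> hom_cone Q"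
  unfolding hom_cone_def by (rule conic_mul[OF conic_conic_hull])

lemma hom_cone_scale_iff: "c > 0 \<Longrightarrow> c *\<^sub>R x \<in> hom_cone Q \<longleftrightarrow> x \<in> hom_cone Q"
  using hom_cone_scale[of x Q c] hom_cone_scale[of "c *\<^sub>R x" Q "inverse c"] by auto

text \<open>The base \<open>Q \<times> {1}\<close> is compact and avoids the origin.\<close>

lemma closed_hom_cone: "compact Q \<Longrightarrow> closed (hom_cone Q)"
  unfolding hom_cone_def by (rule closed_conic_hull) (auto simp: compact_Times zero_prod_def)

lemma convex_hom_cone: "convex Q \<Longrightarrow> convex (hom_cone Q)"
  unfolding hom_cone_def by (rule convex_conic_hull) (simp add: convex_Times)

lemma hom_cone_add:
  assumes "convex Q" "x \<in> hom_cone Q" "y \<in> hom_cone Q"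
  shows "x + y \<in> hom_cone Q"
proof -
  have "(1/2) *\<^sub>R x + (1/2) *\<^sub>R y \<in> hom_cone Q"
    by (rule convexD[OF convex_hom_cone]) (use assms in auto)
  then have "2 *\<^sub>R ((1/2) *\<^sub>R x + (1/2) *\<^sub>R y) \<in> hom_cone Q" by (rule hom_cone_scale) simp
  then show ?thesis by (simp add: scaleR_add_right)
qed

abbreviation polytope_semigroup :: "(real^'n) set \<Rightarrow> ((int^'n) \<times> int) set" where
  "polytope_semigroup Q \<equiv> semigroup_gen ((\<lambda>u. (u, 1)) ` lattice_points Q)"

text \<open>\<open>spanning\<close> says that differences of semigroup elements exhaust the lattice.
  This consequence of very ampleness is what the counting uses, and it is stable under taking
  multiples of Q.\<close>

locale spanning_polytope =
  fixes Q :: "(real^'n) set"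
  assumes lattice: "lattice_polytope Q"
    and interior: "interior Q \<noteq> {}"
    and spanning: "\<exists>s\<in>polytope_semigroup Q. \<exists>s'\<in>polytope_semigroup Q. s = z + s'"
begin

abbreviation "L \<equiv> lattice_points Q"
abbreviation "G \<equiv> (\<lambda>u. (u, 1::int)) ` L"
abbreviation "S \<equiv> semigroup_gen G"
abbreviation "C \<equiv> hom_cone Q"

lemma compact: "compact Q" and convex: "convex Q"
  using lattice by (auto simp: lattice_polytope_def finite_imp_compact_convex_hull convex_convex_hull)

lemma finite_lattice_points: "finite L"
proof -
  have "rvec ` L \<subseteq> Q \<inter> int_lattice" using range_rvec by (auto simp: lattice_points_def)
  then have "finite (rvec ` L)"
    using finite_int_lattice_bounded[of Q] compact compact_imp_bounded finite_subset by blast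
  then show ?thesis by (rule finite_imageD) (auto simp: inj_on_def rvec_inj)
qed

lemma convex_hull_lattice_points: "convex hull (rvec ` L) = Q"
proof
  obtain V where V: "finite V" "Q = convex hull (rvec ` V)" using lattice by (auto simp: lattice_polytope_def)
  then have "V \<subseteq> L" using hull_subset[of "rvec ` V" convex] by (auto simp: lattice_points_def)
  then show "Q \<subseteq> convex hull (rvec ` L)" unfolding V(2) by (intro hull_mono) auto
  show "convex hull (rvec ` L) \<subseteq> Q"
    by (intro hull_minimal convex) (auto simp: lattice_points_def)
qed

sublocale standard_graded_semigroup G snd
  by standard (use finite_lattice_points in auto)

lemma pvec_gen_mem_cone: "u \<in> L \<Longrightarrow> pvec (u, 1) \<in> C"
  by (simp add: pvec_def mem_hom_cone lattice_points_def dilate_def)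

lemma pvec_mem_cone: "s \<in> S \<Longrightarrow> pvec s \<in> C"
proof (induction rule: semigroup_gen.induct)
  case zero
  obtain x where "x \<in> Q" using interior interior_subset by fastforce
  then have "(0, 0) \<in> C" by (auto simp: mem_hom_cone dilate_def)
  then show ?case unfolding pvec_zero unfolding zero_prod_def .
next
  case (add g x)
  then show ?case unfolding pvec_add by (auto intro: hom_cone_add[OF convex] pvec_gen_mem_cone)
qed

lemma cone_coefficients:
  assumes "y \<in> C"
  shows "\<exists>c. (\<forall>u. c u \<ge> 0) \<and> y = (\<Sum>u\<in>L. c u *\<^sub>R pvec (u, 1))"
proof -
  obtain x t where y: "y = (x, t)" by (cases y)
  with assms obtain q where t: "t \<ge> 0" and q: "q \<in> Q" "x = t *\<^sub>R q"
    by (auto simp: mem_hom_cone dilate_def)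
  from q(1) have "q \<in> convex hull (rvec ` L)" by (simp add: convex_hull_lattice_points)
  then obtain w where w: "\<forall>v\<in>rvec ` L. w v \<ge> 0" "sum w (rvec ` L) = 1" "(\<Sum>v\<in>rvec ` L. w v *\<^sub>R v) = q"
    using finite_lattice_points by (auto simp: convex_hull_finite)
  have inj: "inj_on rvec L" by (simp add: inj_on_def rvec_inj)
  define c where "c u = (if u \<in> L then t * w (rvec u) else 0)" for u
  have "(\<Sum>u\<in>L. c u *\<^sub>R rvec u) = t *\<^sub>R q"
    unfolding w(3)[symmetric] sum.reindex[OF inj] by (simp add: c_def scaleR_sum_right)
  moreover have "(\<Sum>u\<in>L. c u) = t"
    using w(2) unfolding sum.reindex[OF inj] by (simp add: c_def flip: sum_distrib_left)
  ultimately have "y = (\<Sum>u\<in>L. c u *\<^sub>R pvec (u, 1))"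
    by (simp add: y q(2) pvec_def prod_eq_iff fst_sum snd_sum)
  moreover have "\<forall>u. c u \<ge> 0" using t w(1) by (simp add: c_def)
  ultimately show ?thesis by blast
qed

text \<open>Taking integral parts of the coefficients, each lattice point of the cone is an element of the
  semigroup plus one of finitely many remainders, and each remainder is a difference of elements of
  the semigroup.\<close>

lemma conductor_exists: "\<exists>c. \<forall>z. pvec z \<in> C \<longrightarrow> c + z \<in> S"
proof -
  define M where "M = (\<Sum>u\<in>L. norm (pvec (u, 1)))"
  define B where "B = {r :: (int^'n) \<times> int. norm (pvec r) \<le> M}"
  have "finite (pvec ` B)"
  proof (rule finite_subset)
    show "pvec ` B \<subseteq> cball 0 M \<inter> int_lattice" using range_pvec by (auto simp: B_def)
    show "finite (cball 0 M \<inter> (int_lattice :: ((real^'n) \<times> real) set))"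
      by (rule finite_int_lattice_bounded) simp
  qed
  then have fin: "finite B" by (rule finite_imageD) (auto simp: inj_on_def pvec_inj)
  obtain a b where ab: "\<And>r. a r \<in> S" "\<And>r. b r \<in> S" "\<And>r. a r = r + b r"
    using spanning by metis
  \<comment> \<open>One shift serves all remainders: among the summands of c is the
    \<open>b r\<close> that turns the actual remainder r into the element \<open>a r\<close> of
    S.\<close>
  define c where "c = (\<Sum>r\<in>B. b r)"
  have "c + z \<in> S" if z: "pvec z \<in> C" for z
  proof -
    obtain e where e: "\<And>u. e u \<ge> 0" "pvec z = (\<Sum>u\<in>L. e u *\<^sub>R pvec (u, 1))"
      using cone_coefficients[OF z] by blast
    define s where "s = (\<Sum>u\<in>L. nmul (nat \<lfloor>e u\<rfloor>) (u, 1::int))"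
    define r where "r = z - s"
    have "pvec s = (\<Sum>u\<in>L. of_int \<lfloor>e u\<rfloor> *\<^sub>R pvec (u, 1))"
      unfolding s_def pvec_sum pvec_nmul using e(1) by simp
    then have "pvec r = (\<Sum>u\<in>L. frac (e u) *\<^sub>R pvec (u, 1))"
      unfolding r_def pvec_diff e(2) by (simp add: frac_def scaleR_diff_left sum_subtractf)
    also have "norm \<dots> \<le> M"
      unfolding M_def
    proof (rule sum_norm_le)
      fix u
      have "\<bar>frac (e u)\<bar> \<le> 1" using frac_ge_0[of "e u"] frac_lt_1[of "e u"] by linarith
      then show "norm (frac (e u) *\<^sub>R pvec (u, 1)) \<le> norm (pvec (u, 1))"
        by (simp add: mult_left_le_one_le)
    qed
    finally have r: "r \<in> B" by (simp add: B_def)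
    have "s \<in> S" unfolding s_def
      by (intro semigroup_gen_sum semigroup_gen_nmul semigroup_gen_base) auto
    moreover have "c + z = (\<Sum>r\<in>B - {r}. b r) + (a r + s)"
      using fin r by (simp add: c_def sum.remove r_def ab(3))
    moreover have "(\<Sum>r\<in>B - {r}. b r) \<in> S" by (intro semigroup_gen_sum ab)
    ultimately show ?thesis using ab(1)[of r] by (metis semigroup_gen_add)
  qed
  then show ?thesis by blast
qed

text \<open>For interior y the fixed shift c becomes negligible after division by
  \<open>q k\<close>, so the rounded point minus c stays in the cone. Off the closed cone the
  rounded points eventually leave it, and with it S.\<close>

lemma floor_vec_mem_semigroup:
  assumes q: "filterlim q at_top sequentially" "\<And>k. q k \<ge> 1" and y: "y \<notin> frontier C"
  shows "\<forall>\<^sub>F k in sequentially. floor_vec (q k *\<^sub>R y) \<in> pvec ` S \<longleftrightarrow> y \<in> C"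
proof -
  have q0: "q k > 0" for k using q(2)[of k] by simp
  have lim: "(\<lambda>k. floor_vec (q k *\<^sub>R y) /\<^sub>R q k) \<longlonglongrightarrow> y" by (rule floor_vec_scaled_tendsto[OF q])
  show ?thesis
  proof (cases "y \<in> C")
    case True
    with y have int: "y \<in> interior C" by (auto simp: frontier_def intro: subsetD[OF closure_subset])
    obtain c where c: "\<And>z. pvec z \<in> C \<Longrightarrow> c + z \<in> S" using conductor_exists by blast
    have "(\<lambda>k. inverse (q k)) \<longlonglongrightarrow> 0" by (rule tendsto_inverse_0_at_top[OF q(1)])
    from tendsto_diff[OF lim tendsto_scaleR[OF this tendsto_const[of "pvec c"]]]
    have "(\<lambda>k. (floor_vec (q k *\<^sub>R y) - pvec c) /\<^sub>R q k) \<longlonglongrightarrow> y"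
      by (simp add: scaleR_diff_right)
    from topological_tendstoD[OF this open_interior int]
    have "\<forall>\<^sub>F k in sequentially. floor_vec (q k *\<^sub>R y) \<in> pvec ` S"
    proof eventually_elim
      case (elim k)
      obtain z where z: "floor_vec (q k *\<^sub>R y) = pvec z" using floor_vec_mem range_pvec by blast
      have "(floor_vec (q k *\<^sub>R y) - pvec c) /\<^sub>R q k \<in> C" using elim interior_subset by blast
      then have "pvec (z - c) \<in> C" using q0[of k] by (simp add: hom_cone_scale_iff z pvec_diff)
      from c[OF this] show ?case by (simp add: z)
    qed
    then show ?thesis using True by simp
  next
    case False
    have "\<forall>\<^sub>F k in sequentially. floor_vec (q k *\<^sub>R y) /\<^sub>R q k \<in> - C"
      using False closed_hom_cone[OF compact] by (intro topological_tendstoD[OF lim]) auto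
    then have "\<forall>\<^sub>F k in sequentially. floor_vec (q k *\<^sub>R y) \<notin> pvec ` S"
    proof eventually_elim
      case (elim k)
      then have "floor_vec (q k *\<^sub>R y) \<notin> C" using q0[of k] by (simp add: hom_cone_scale_iff)
      then show ?case using pvec_mem_cone by auto
    qed
    then show ?thesis using False by simp
  qed
qed

lemma hilbert_samuel_count_limit:
  "(\<lambda>n. card {s \<in> S. snd s < int n} / real n ^ (CARD('n) + 1)) \<longlonglongrightarrow> measure lborel (C \<inter> {y. snd y \<le> 1})"
proof -
  \<comment> \<open>\<open>Suc k\<close> keeps the scale at least 1, as
    \<open>lattice_count_limit\<close> demands; \<open>LIMSEQ_imp_Suc\<close> undoes the shift of
    the index.\<close>
  define q where "q k = real (Suc k)" for k
  have q: "filterlim q at_top sequentially" "\<And>k. q k \<ge> 1"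
    unfolding q_def using filterlim_compose[OF filterlim_real_sequentially filterlim_Suc] by auto
  define Z where "Z k = pvec ` {s \<in> S. snd s < int (Suc k)}" for k
  define B where "B = (\<Sum>g\<in>G. norm (pvec g))"
  have B0: "B \<ge> 0" unfolding B_def by (rule sum_nonneg) simp
  have norm_le: "norm (pvec s) \<le> B * snd s" if "s \<in> S" for s
    using that
  proof induction
    case (add g x)
    have "norm (pvec g) \<le> B" unfolding B_def
      using add.hyps finite_gens by (intro member_le_sum) auto
    moreover have "norm (pvec (g + x)) \<le> norm (pvec g) + norm (pvec x)"
      unfolding pvec_add by (rule norm_triangle_ineq)
    moreover have "snd (g + x) = 1 + snd x" using add.hyps by auto
    ultimately show ?case using add.IH by (simp add: algebra_simps)
  qed (simp add: pvec_zero)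
  have half: "convex {y :: (real^'n) \<times> real. snd y \<le> 1}"
    using convex_halfspace_le[of "(0 :: real^'n, 1::real)" 1] by (simp add: inner_prod_def)
  have frhalf: "frontier {y :: (real^'n) \<times> real. snd y \<le> 1} = {y. snd y = 1}"
    using frontier_halfspace_le[of "(0 :: real^'n, 1::real)" 1] by (simp add: inner_prod_def)
  have "(\<lambda>k. card (Z k) / q k ^ DIM((real^'n) \<times> real)) \<longlonglongrightarrow> measure lborel (C \<inter> {y. snd y \<le> 1})"
  proof (rule lattice_count_limit[OF q])
    show "finite (Z k)" for k unfolding Z_def by (intro finite_imageI finite_deg_less)
    show "Z k \<subseteq> int_lattice" for k unfolding Z_def using range_pvec by auto
    show "norm z \<le> B * q k" if z: "z \<in> Z k" for k z
    proof -
      obtain s where s: "s \<in> S" "snd s < int (Suc k)" "z = pvec s" using z by (auto simp: Z_def)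
      have "norm z \<le> B * snd s" using norm_le[OF s(1)] s by simp
      also have "\<dots> \<le> B * q k" using B0 s(2) by (intro mult_left_mono) (auto simp: q_def)
      finally show ?thesis .
    qed
    have "closed (C \<inter> {y. snd y \<le> 1})"
      by (intro closed_Int closed_hom_cone compact closed_Collect_le continuous_intros)
    then show "C \<inter> {y. snd y \<le> 1} \<in> sets lborel" by simp
    show "AE y in lborel. \<forall>\<^sub>F k in sequentially. floor_vec (q k *\<^sub>R y) \<in> Z k \<longleftrightarrow> y \<in> C \<inter> {y. snd y \<le> 1}"
      using AE_not_in_frontier_convex[OF convex_hom_cone[OF convex]] AE_not_in_frontier_convex[OF half]
      unfolding frhalf
    proof eventually_elim
      case (elim y)
      from floor_vec_mem_semigroup[OF q elim(1)] show ?case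
      proof eventually_elim
        case (elim k)
        have b: "(0, 1) \<in> (Basis :: ((real^'n) \<times> real) set)" by (auto simp: Basis_prod_def)
        have "snd (floor_vec (q k *\<^sub>R y)) = floor_vec (q k *\<^sub>R y) \<bullet> (0, 1)"
          by (simp add: inner_prod_def)
        also have "\<dots> = \<lfloor>q k * snd y\<rfloor>"
          unfolding floor_vec_inner[OF b] by (simp add: inner_prod_def)
        \<comment> \<open>The strict bound on the integral height amounts to
          \<open>snd y < 1\<close>, which agrees with \<open>snd y \<le> 1\<close> off the null
          hyperplane at height 1.\<close>
        finally have "snd (floor_vec (q k *\<^sub>R y)) < real (Suc k) \<longleftrightarrow> \<lfloor>q k * snd y\<rfloor> < int (Suc k)"
          by linarith
        also have "\<dots> \<longleftrightarrow> q k * snd y < q k" by (simp add: q_def floor_less_iff)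
        also have "\<dots> \<longleftrightarrow> snd y < 1" by (simp add: q_def)
        also have "\<dots> \<longleftrightarrow> snd y \<le> 1" using \<open>y \<notin> {y. snd y = 1}\<close> by auto
        finally have *: "snd (floor_vec (q k *\<^sub>R y)) < real (Suc k) \<longleftrightarrow> snd y \<le> 1" .
        have "floor_vec (q k *\<^sub>R y) \<in> Z k \<longleftrightarrow>
            floor_vec (q k *\<^sub>R y) \<in> pvec ` S \<and> snd (floor_vec (q k *\<^sub>R y)) < real (Suc k)"
          unfolding Z_def by (force simp: pvec_def)
        then show ?case using * elim by auto
      qed
    qed
  qed
  moreover have "card (Z k) = card {s \<in> S. snd s < int (Suc k)}" for k
    unfolding Z_def by (rule card_image) (use inj_pvec in \<open>auto intro: inj_on_subset\<close>)
  ultimately have "(\<lambda>k. card {s \<in> S. snd s < int (Suc k)} / real (Suc k) ^ (CARD('n) + 1)) \<longlonglongrightarrow>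
      measure lborel (C \<inter> {y. snd y \<le> 1})"
    by (simp add: q_def)
  then show ?thesis by (rule LIMSEQ_imp_Suc)
qed

text \<open>Limit shape, after division by q, of the exponents outside the Frobenius power.\<close>

definition hk_region :: "((real^'n) \<times> real) set" where
  "hk_region = {y \<in> C. \<forall>u\<in>L. y - pvec (u, 1) \<notin> C}"

lemma hk_region_borel: "hk_region \<in> sets lborel"
proof -
  have eq: "hk_region = C - (\<Union>u\<in>L. (+) (pvec (u, 1)) ` C)"
    by (auto simp: hk_region_def mem_translation_iff)
  have "closed (\<Union>u\<in>L. (+) (pvec (u, 1)) ` C)"
    by (intro closed_UN finite_lattice_points ballI closed_translation closed_hom_cone compact)
  then show ?thesis unfolding eq using closed_hom_cone[OF compact] by (intro sets.Diff) simp_all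
qed

lemma hilbert_kunz_count_limit:
  assumes p: "p > 1"
  shows "(\<lambda>n. card {s \<in> S. \<not> (\<exists>g\<in>G. \<exists>t\<in>S. s = nmul (p ^ n) g + t)} / real (p ^ n) ^ (CARD('n) + 1))
    \<longlonglongrightarrow> measure lborel hk_region"
proof -
  define q where "q k = real (p ^ k)" for k
  have q: "filterlim q at_top sequentially" "\<And>k. q k \<ge> 1"
  proof -
    have "real k \<le> q k" for k unfolding q_def using power_gt_expt[of p k] p by (intro of_nat_mono) auto
    then show "filterlim q at_top sequentially"
      by (intro filterlim_at_top_mono[OF filterlim_real_sequentially] always_eventually) auto
    show "q k \<ge> 1" for k using p by (simp add: q_def)
  qed
  define Z0 where "Z0 k = {s \<in> S. \<not> (\<exists>g\<in>G. \<exists>t\<in>S. s = nmul (p ^ k) g + t)}" for k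
  define Z where "Z k = pvec ` Z0 k" for k
  define B where "B = (\<Sum>g\<in>G. norm (pvec g))"
  have "(\<lambda>k. card (Z k) / q k ^ DIM((real^'n) \<times> real)) \<longlonglongrightarrow> measure lborel hk_region"
  proof (rule lattice_count_limit[OF q])
    show "finite (Z k)" for k unfolding Z_def Z0_def
      by (intro finite_imageI finite_not_above_multiples finite_gens)
    show "Z k \<subseteq> int_lattice" for k unfolding Z_def using range_pvec by auto
    show "norm z \<le> B * q k" if z: "z \<in> Z k" for k z
    proof -
      obtain s where s: "s \<in> S" "\<not> (\<exists>g\<in>G. \<exists>t\<in>S. s = nmul (p ^ k) g + t)" "z = pvec s"
        using z by (auto simp: Z_def Z0_def)
      obtain c where c: "s = (\<Sum>g\<in>G. nmul (c g) g)" "\<forall>g\<in>G. c g < p ^ k"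
        using not_above_multiples_repr[OF finite_gens s(1,2)] by blast
      have "norm z \<le> (\<Sum>g\<in>G. norm (real (c g) *\<^sub>R pvec g))"
        unfolding s(3) c(1) pvec_sum pvec_nmul by (rule norm_sum)
      also have "\<dots> \<le> (\<Sum>g\<in>G. norm (pvec g) * q k)"
      proof (rule sum_mono)
        fix g assume "g \<in> G"
        with c(2) have "real (c g) \<le> q k" unfolding q_def by (intro of_nat_mono less_imp_le) auto
        then show "norm (real (c g) *\<^sub>R pvec g) \<le> norm (pvec g) * q k"
          by (simp add: mult.commute mult_right_mono)
      qed
      also have "\<dots> = B * q k" by (simp add: B_def sum_distrib_right)
      finally show ?thesis .
    qed
    show "hk_region \<in> sets lborel" by (rule hk_region_borel)
    have "AE y in lborel. \<forall>u\<in>L. y \<notin> frontier ((+) (pvec (u, 1)) ` C)"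
      by (intro AE_finite_allI finite_lattice_points AE_not_in_frontier_convex convex_translation
          convex_hom_cone convex)
    with AE_not_in_frontier_convex[OF convex_hom_cone[OF convex]]
    show "AE y in lborel. \<forall>\<^sub>F k in sequentially. floor_vec (q k *\<^sub>R y) \<in> Z k \<longleftrightarrow> y \<in> hk_region"
    proof eventually_elim
      case (elim y)
      have "\<forall>\<^sub>F k in sequentially. \<forall>u\<in>L. floor_vec (q k *\<^sub>R (y - pvec (u, 1))) \<in> pvec ` S \<longleftrightarrow> y - pvec (u, 1) \<in> C"
      proof (intro eventually_ball_finite finite_lattice_points ballI floor_vec_mem_semigroup[OF q])
        fix u assume "u \<in> L"
        with elim(2) have "y \<notin> (+) (pvec (u, 1)) ` frontier C" by (simp add: frontier_translation)
        then show "y - pvec (u, 1) \<notin> frontier C"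
          by (simp add: mem_translation_iff)
      qed
      with floor_vec_mem_semigroup[OF q elim(1)] show ?case
      proof eventually_elim
        case (elim k)
        \<comment> \<open>\<open>q k\<close> is an integer, so its multiples of
          \<open>pvec (u, 1)\<close> are lattice points and rounding commutes with subtracting them;
          a single rounded point decides membership in all the translates.\<close>
        have sh: "floor_vec (q k *\<^sub>R (y - pvec (u, 1))) = floor_vec (q k *\<^sub>R y) - q k *\<^sub>R pvec (u, 1)" for u
        proof -
          have "q k *\<^sub>R pvec (u, 1) = pvec (nmul (p ^ k) (u, 1))" by (simp add: pvec_nmul q_def)
          then have "- (q k *\<^sub>R pvec (u, 1)) \<in> int_lattice"
            by (simp only: int_lattice_uminus pvec_mem_int_lattice)
          from floor_vec_add[OF this, of "q k *\<^sub>R y"] show ?thesis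
            by (simp add: scaleR_diff_right)
        qed
        obtain s where s: "floor_vec (q k *\<^sub>R y) = pvec s" using floor_vec_mem range_pvec by blast
        have m1: "floor_vec (q k *\<^sub>R y) \<in> pvec ` S \<longleftrightarrow> s \<in> S" by (auto simp: s pvec_inj)
        have m2: "floor_vec (q k *\<^sub>R (y - pvec (u, 1))) \<in> pvec ` S \<longleftrightarrow> (\<exists>t\<in>S. s = nmul (p ^ k) (u, 1) + t)" for u
        proof -
          have "floor_vec (q k *\<^sub>R (y - pvec (u, 1))) = pvec (s - nmul (p ^ k) (u, 1))"
            unfolding sh s pvec_diff pvec_nmul by (simp add: q_def)
          then have "floor_vec (q k *\<^sub>R (y - pvec (u, 1))) \<in> pvec ` S \<longleftrightarrow> s - nmul (p ^ k) (u, 1) \<in> S"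
            by (auto simp: pvec_inj)
          also have "\<dots> \<longleftrightarrow> (\<exists>t\<in>S. s = nmul (p ^ k) (u, 1) + t)"
            by (metis add_diff_cancel_left' diff_add_cancel add.commute)
          finally show ?thesis .
        qed
        have "floor_vec (q k *\<^sub>R y) \<in> Z k \<longleftrightarrow> s \<in> Z0 k" by (auto simp: Z_def s pvec_inj)
        then show ?case using elim m1 m2 unfolding Z0_def hk_region_def by auto
      qed
    qed
  qed
  moreover have "card (Z k) = card (Z0 k)" for k
    unfolding Z_def by (rule card_image) (use inj_pvec in \<open>auto intro: inj_on_subset\<close>)
  ultimately show ?thesis by (simp add: q_def Z0_def)
qed

text \<open>The coordinate ring sees the pair only through the lattice points of its polytope, so
  the answer is expressed by Q alone.\<close>

lemma
  fixes K :: "'k::field itself" and F :: "(real^'n) set set"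
  assumes FQ: "div_polytope F a = Q" and p: "CHAR('k) > 0"
  shows e0_seq_tendsto: "e0_seq K F a \<longlonglongrightarrow> fact (CARD('n) + 1) * measure lborel (C \<inter> {y. snd y \<le> 1})"
    and eHK_seq_tendsto: "eHK_seq K F a \<longlonglongrightarrow> measure lborel hk_region"
proof -
  have G: "degree_one_points F a = G" by (simp add: degree_one_points_def FQ)
  have R: "coord_ring F a = (semigroup_ring S :: (((int^'n) \<times> int) \<Rightarrow>\<^sub>0 'k) ring)"
    by (simp add: coord_ring_def G)
  have M: "max_ideal F a = (graded_max_ideal :: (((int^'n) \<times> int) \<Rightarrow>\<^sub>0 'k) set)"
    by (simp add: max_ideal_def R G graded_max_ideal_def)
  have e: "e0_seq K F a = (\<lambda>n. fact (CARD('n) + 1) * (card {s \<in> S. snd s < int n} / real n ^ (CARD('n) + 1)))"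
    unfolding e0_seq_def hilbert_samuel_seq_def R M quot_length_ideal_power by (simp add: fun_eq_iff)
  show "e0_seq K F a \<longlonglongrightarrow> fact (CARD('n) + 1) * measure lborel (C \<inter> {y. snd y \<le> 1})"
    unfolding e by (intro tendsto_mult tendsto_const hilbert_samuel_count_limit)
  have h: "eHK_seq K F a = (\<lambda>n. card {s \<in> S. \<not> (\<exists>g\<in>G. \<exists>t\<in>S. s = nmul (CHAR('k) ^ n) g + t)}
      / real (CHAR('k) ^ n) ^ (CARD('n) + 1))"
    unfolding eHK_seq_def hilbert_kunz_seq_def R M quot_length_frobenius_power[OF p refl]
    by (simp add: fun_eq_iff)
  have "CHAR('k) > 1" using prime_CHAR_semidom[OF p] prime_gt_1_nat by blast
  then show "eHK_seq K F a \<longlonglongrightarrow> measure lborel hk_region"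
    unfolding h by (rule hilbert_kunz_count_limit)
qed

end

section \<open>Passage from Q and D to the multiples kQ and kD\<close>

lemma lattice_polytope_dilate:
  assumes "lattice_polytope Q"
  shows "lattice_polytope (dilate (real k) Q)"
proof -
  obtain V where V: "finite V" "Q = convex hull (rvec ` V)" using assms by (auto simp: lattice_polytope_def)
  have "dilate (real k) Q = convex hull ((*\<^sub>R) (real k) ` rvec ` V)"
    unfolding V(2) dilate_def by (simp add: convex_hull_scaling)
  also have "(*\<^sub>R) (real k) ` rvec ` V = rvec ` ((\<lambda>v. int k *s v) ` V)"
    by (simp add: image_image rvec_scale)
  finally show ?thesis unfolding lattice_polytope_def using V(1) by blast
qed

text \<open>\<open>u \<mapsto> u + (k - 1) w\<close> embeds the lattice points of \<open>Q\<close> into those of \<open>kQ\<close>.\<close>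

lemma spanning_polytope_dilate:
  fixes Q :: "(real^'n) set"
  assumes "spanning_polytope Q" and k: "k \<ge> 1"
  shows "spanning_polytope (dilate (real k) Q)"
proof -
  interpret spanning_polytope Q by fact
  show ?thesis
  proof
    show "lattice_polytope (dilate (real k) Q)" by (rule lattice_polytope_dilate[OF lattice])
    have "interior (dilate (real k) Q) = (*\<^sub>R) (real k) ` interior Q"
      unfolding dilate_def using k by (intro interior_injective_linear_image) (auto simp: inj_def)
    then show "interior (dilate (real k) Q) \<noteq> {}" using interior by simp
    fix z :: "(int^'n) \<times> int"
    have "L \<noteq> {}" using convex_hull_lattice_points interior by (metis convex_hull_empty image_empty interior_empty)
    then obtain w where w: "w \<in> L" by blast
    \<comment> \<open>An invertible additive shear, adding (k - 1) w per degree. For u in Q the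
      point u + (k - 1) w is k times a convex combination of u and w, so f maps generators for Q to
      generators for kQ.\<close>
    define f where "f = (\<lambda>(x, t). (x + (t * (int k - 1)) *s w, t))"
    have f_add: "f (a + b) = f a + f b" for a b
      by (cases a; cases b) (simp add: f_def vec_eq_iff algebra_simps)
    have fS: "f s \<in> polytope_semigroup (dilate (real k) Q)" if "s \<in> S" for s
      using that
    proof induction
      case zero
      have "f 0 = 0" by (simp add: f_def zero_prod_def)
      then show ?case by (simp add: semigroup_gen.zero)
    next
      case (add g x)
      then obtain u where u: "u \<in> L" "g = (u, 1)" by auto
      have "(1 / real k) *\<^sub>R rvec u + (real (k - 1) / real k) *\<^sub>R rvec w \<in> Q"
        using u w k by (intro convexD[OF convex]) (auto simp: lattice_points_def field_simps)
      then have "real k *\<^sub>R ((1 / real k) *\<^sub>R rvec u + (real (k - 1) / real k) *\<^sub>R rvec w) \<in> dilate (real k) Q"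
        unfolding dilate_def by blast
      then have "rvec (u + (int k - 1) *s w) \<in> dilate (real k) Q"
        using k by (simp only: rvec_add rvec_scale scaleR_add_right) (simp add: of_nat_diff)
      then have "f g \<in> (\<lambda>u. (u, 1)) ` lattice_points (dilate (real k) Q)"
        by (auto simp: f_def u lattice_points_def)
      with add.IH show ?case unfolding f_add by (intro semigroup_gen.add)
    qed
    obtain x t where z: "z = (x, t)" by (cases z)
    \<comment> \<open>The spanning property of Q is applied to the preimage of z under the
      shear.\<close>
    obtain s s' where s: "s \<in> S" "s' \<in> S" "s = (x - (t * (int k - 1)) *s w, t) + s'" using spanning by blast
    have "f s = z + f s'" unfolding s(3) f_add by (simp add: f_def z)
    with fS s show "\<exists>s\<in>polytope_semigroup (dilate (real k) Q).
        \<exists>s'\<in>polytope_semigroup (dilate (real k) Q). s = z + s'" by blast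
  qed
qed

lemma div_polytope_mult:
  fixes F :: "(real^'n) set set"
  assumes "k \<ge> 1"
  shows "div_polytope F (div_mult k a) = dilate (real k) (div_polytope F a)"
proof (intro equalityI subsetI)
  have k: "real k > 0" using assms by simp
  fix x assume x: "x \<in> div_polytope F (div_mult k a)"
  have "(1 / real k) *\<^sub>R x \<in> div_polytope F a"
    unfolding div_polytope_def
  proof clarify
    fix v assume "v \<in> ray_gens F"
    with x have "- (real k * of_int (a v)) \<le> x \<bullet> rvec v" by (auto simp: div_polytope_def div_mult_def)
    with k show "- of_int (a v) \<le> ((1 / real k) *\<^sub>R x) \<bullet> rvec v" by (simp add: field_simps)
  qed
  moreover have "x = real k *\<^sub>R ((1 / real k) *\<^sub>R x)" using k by simp
  ultimately show "x \<in> dilate (real k) (div_polytope F a)" unfolding dilate_def by blast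
next
  fix x assume "x \<in> dilate (real k) (div_polytope F a)"
  then obtain y where y: "y \<in> div_polytope F a" "x = real k *\<^sub>R y" by (auto simp: dilate_def)
  have "- (real k * of_int (a v)) \<le> real k * (y \<bullet> rvec v)" if "v \<in> ray_gens F" for v
  proof -
    have "- of_int (a v) \<le> y \<bullet> rvec v" using y(1) that by (auto simp: div_polytope_def)
    from mult_left_mono[OF this, of "real k"] show ?thesis by simp
  qed
  then show "x \<in> div_polytope F (div_mult k a)" by (auto simp: div_polytope_def div_mult_def y(2))
qed

section \<open>Translates of a convex body by lattice vectors\<close>

lemma measure_lborel_translation:
  fixes A :: "'a::euclidean_space set"
  assumes "A \<in> sets borel"
  shows "measure lborel {x. x + a \<in> A} = measure lborel A"
proof -
  have "measure lborel A = measure (distr lborel borel ((+) a)) A" by (simp add: lborel_distr_plus)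
  also have "\<dots> = measure lborel ((+) a -` A \<inter> space lborel)" using assms by (intro measure_distr) auto
  also have "(+) a -` A \<inter> space lborel = {x. x + a \<in> A}" by (auto simp: add.commute)
  finally show ?thesis by simp
qed

lemma AE_lborel_translation:
  fixes a :: "'a::euclidean_space"
  assumes "AE x in lborel. P x"
  shows "AE x in lborel. P (x + a)"
proof -
  have "AE x in distr lborel borel ((+) a). P x" unfolding lborel_distr_plus by (rule assms)
  then have "AE x in lborel. P (a + x)" by (rule AE_distrD[rotated]) simp
  then show ?thesis by (simp add: add.commute)
qed

lemma emeasure_lborel_bounded_finite: "bounded A \<Longrightarrow> emeasure lborel A < \<infinity>"
  using emeasure_bounded_finite by auto

definition cell :: "'a::euclidean_space \<Rightarrow> 'a set" where
  "cell z = {x. floor_vec x = z}"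

lemma cell_borel [measurable]: "cell z \<in> sets borel"
  unfolding cell_def by measurable

lemma measure_cell: "z \<in> int_lattice \<Longrightarrow> measure lborel (cell z) = 1"
  and emeasure_cell: "z \<in> int_lattice \<Longrightarrow> emeasure lborel (cell z) = 1"
  using emeasure_scaled_cell[of z 1] by (simp_all add: cell_def measure_def)

lemma norm_cell_diff: "x \<in> cell z \<Longrightarrow> norm (x - z) \<le> DIM('a)"
  for x z :: "'a::euclidean_space"
  using norm_diff_floor_vec[of x] by (simp add: cell_def)

lemma cell_translation: "a \<in> int_lattice \<Longrightarrow> x + a \<in> cell z \<longleftrightarrow> x \<in> cell (z - a)"
  by (simp add: cell_def floor_vec_add eq_diff_eq)

text \<open>Countably many integer translates of the cell at 0 cover space, so exceptional null sets
  of the translates add up to a null set.\<close>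

lemma AE_periodic:
  fixes P :: "'a::euclidean_space \<Rightarrow> bool"
  assumes cell: "AE x in lborel. x \<in> cell 0 \<longrightarrow> P x"
    and per: "\<And>x z. z \<in> int_lattice \<Longrightarrow> P (x + z) = P x"
  shows "AE x in lborel. P x"
proof -
  have "countable (int_lattice :: 'a set)"
  proof -
    have "x \<in> (\<Union>n. cball 0 (real n))" for x :: 'a
      using real_arch_simple[of "norm x"] by auto
    then have "(int_lattice :: 'a set) = (\<Union>n. cball 0 (real n) \<inter> int_lattice)" by blast
    moreover have "countable (\<Union>n. cball (0::'a) (real n) \<inter> int_lattice)"
      by (intro countable_UN[OF countableI_type] countable_finite finite_int_lattice_bounded) auto
    ultimately show ?thesis by simp
  qed
  moreover have "AE x in lborel. x + - z \<in> cell 0 \<longrightarrow> P (x + - z)" for z :: 'a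
    using AE_lborel_translation[OF cell] .
  ultimately have "AE x in lborel. \<forall>z\<in>int_lattice. x + - z \<in> cell 0 \<longrightarrow> P (x + - z)"
    by (simp add: AE_ball_countable)
  then show ?thesis
  proof eventually_elim
    case (elim x)
    have "x + - floor_vec x \<in> cell 0"
      unfolding cell_translation[OF int_lattice_uminus[OF floor_vec_mem]] by (simp add: cell_def)
    with elim floor_vec_mem have "P (x + - floor_vec x)" by blast
    then show ?case using per[OF int_lattice_uminus[OF floor_vec_mem]] by blast
  qed
qed

lemma sum_measure_cells:
  fixes X :: "'a::euclidean_space set"
  assumes X: "X \<in> sets borel" "emeasure lborel X < \<infinity>"
    and Z: "finite Z" "\<And>x. x \<in> X \<Longrightarrow> floor_vec x \<in> Z"
  shows "(\<Sum>z\<in>Z. measure lborel (X \<inter> cell z)) = measure lborel X"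
proof -
  have "X = (\<Union>z\<in>Z. X \<inter> cell z)" using Z(2) by (auto simp: cell_def)
  moreover have "measure lborel (\<Union>z\<in>Z. X \<inter> cell z) = (\<Sum>z\<in>Z. measure lborel (X \<inter> cell z))"
  proof (rule measure_finite_Union[OF Z(1)])
    show "(\<lambda>z. X \<inter> cell z) ` Z \<subseteq> sets lborel" using X by auto
    show "disjoint_family_on (\<lambda>z. X \<inter> cell z) Z" by (auto simp: disjoint_family_on_def cell_def)
    show "emeasure lborel (X \<inter> cell z) \<noteq> \<infinity>" for z
    proof -
      have "emeasure lborel (X \<inter> cell z) \<le> emeasure lborel X" using X by (intro emeasure_mono) auto
      with X(2) show ?thesis by (auto simp: top_unique)
    qed
  qed
  ultimately show ?thesis by simp
qed

lemma finite_rvec_bounded: "finite {v :: int^'n. norm (rvec v - y) \<le> M}"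
proof -
  have "finite (cball y M \<inter> int_lattice)" by (intro finite_int_lattice_bounded) simp
  moreover have "rvec ` {v :: int^'n. norm (rvec v - y) \<le> M} \<subseteq> cball y M \<inter> int_lattice"
    using rvec_mem_int_lattice by (auto simp: dist_norm norm_minus_commute)
  ultimately have "finite (rvec ` {v :: int^'n. norm (rvec v - y) \<le> M})" by (rule finite_subset[rotated])
  then show ?thesis by (rule finite_imageD) (auto simp: inj_on_def rvec_inj)
qed

section \<open>Covering multiplicity, gap and overlap of the lattice translates of sQ\<close>

locale convex_body =
  fixes Q :: "(real^'n) set"
  assumes compact: "compact Q" and convex: "convex Q" and interior: "interior Q \<noteq> {}"
begin

definition V :: real where "V = measure lborel Q"

text \<open>Phrased through \<open>hom_cone\<close> so that closedness of the cone makes the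
  relation closed in position and scale jointly, as \<open>covered_limit\<close> needs.\<close>

definition translate :: "real \<Rightarrow> (int^'n) \<Rightarrow> (real^'n) set" where
  "translate s v = {x. (x - rvec v, s) \<in> hom_cone Q}"

lemma mem_translate: "x \<in> translate s v \<longleftrightarrow> 0 \<le> s \<and> x - rvec v \<in> dilate s Q"
  by (simp add: translate_def mem_hom_cone)

lemma translate_eq: "s \<ge> 0 \<Longrightarrow> translate s v = (+) (rvec v) ` dilate s Q"
  by (auto simp: mem_translate mem_translation_iff)

lemma closed_translate: "closed (translate s v)"
proof -
  have "closed ((\<lambda>x. (x - rvec v, s)) -` hom_cone Q)"
    by (intro continuous_closed_vimage closed_hom_cone compact) (auto intro!: continuous_intros)
  then show ?thesis by (simp add: translate_def vimage_def)
qed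

lemma translate_borel [measurable]: "translate s v \<in> sets borel"
  using closed_translate by simp

lemma convex_dilate: "convex (dilate s Q)"
  unfolding dilate_def by (rule convex_scaling[OF convex])

lemma compact_dilate: "compact (dilate s Q)"
  unfolding dilate_def by (rule compact_scaling[OF compact])

lemma convex_translate: "convex (translate s v)"
proof (cases "s \<ge> 0")
  case True
  then show ?thesis by (simp add: translate_eq convex_translation convex_dilate)
next
  case False
  then have "translate s v = {}" by (auto simp: mem_translate)
  then show ?thesis by simp
qed

lemma translate_add: "x + rvec w \<in> translate s v \<longleftrightarrow> x \<in> translate s (v - w)"
  by (simp add: translate_def rvec_diff algebra_simps)

lemma bound_exists: "\<exists>B\<ge>0. \<forall>x\<in>Q. norm x \<le> B"
proof -
  obtain B where B: "\<And>x. x \<in> Q \<Longrightarrow> norm x \<le> B" using compact compact_imp_bounded bounded_iff by metis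
  moreover obtain x where "x \<in> Q" using interior interior_subset by blast
  then have "0 \<le> B" using B[of x] norm_ge_zero[of x] by linarith
  ultimately show ?thesis by blast
qed

definition B :: real where "B = (SOME B. B \<ge> 0 \<and> (\<forall>x\<in>Q. norm x \<le> B))"

lemma B_nonneg: "B \<ge> 0" and norm_le_B: "x \<in> Q \<Longrightarrow> norm x \<le> B"
  using someI_ex[OF bound_exists[unfolded Bex_def]] unfolding B_def by blast+

lemma norm_dilate: "s \<ge> 0 \<Longrightarrow> x \<in> dilate s Q \<Longrightarrow> norm x \<le> s * B"
  using norm_le_B by (auto simp: dilate_def mult_left_mono)

lemma norm_translate: "x \<in> translate s v \<Longrightarrow> norm (x - rvec v) \<le> s * B"
  using norm_dilate by (auto simp: mem_translate)

text \<open>Finite set of candidates whose translate can meet the cell at 0; the summand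
  \<open>CARD('n)\<close> bounds the norm on that cell.\<close>

definition near :: "real \<Rightarrow> (int^'n) set" where
  "near s = {v. norm (rvec v) \<le> s * B + CARD('n)}"

lemma finite_near: "finite (near s)"
  using finite_rvec_bounded[of 0] by (simp add: near_def)

lemma translate_cell_near: "x \<in> translate s v \<Longrightarrow> x \<in> cell 0 \<Longrightarrow> v \<in> near s"
proof -
  assume "x \<in> translate s v" "x \<in> cell 0"
  then have "norm (x - rvec v) \<le> s * B" "norm x \<le> CARD('n)"
    using norm_translate norm_cell_diff[of x 0] by auto
  moreover have "norm (rvec v) \<le> norm x + norm (x - rvec v)"
    using norm_triangle_ineq4[of x "x - rvec v"] by simp
  ultimately show "v \<in> near s" by (simp add: near_def)
qed

lemma finite_covering: "finite {v. x \<in> translate s v}"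
proof (rule finite_subset)
  show "{v. x \<in> translate s v} \<subseteq> {v. norm (rvec v - x) \<le> s * B}"
    using norm_translate by (auto simp: norm_minus_commute)
qed (rule finite_rvec_bounded)

definition mult :: "real \<Rightarrow> real^'n \<Rightarrow> nat" where
  "mult s x = card {v. x \<in> translate s v}"

lemma mult_eq_0: "mult s x = 0 \<longleftrightarrow> (\<forall>v. x \<notin> translate s v)"
  using finite_covering by (auto simp: mult_def)

lemma mult_le_1: "mult s x \<le> 1 \<longleftrightarrow> (\<forall>v w. x \<in> translate s v \<longrightarrow> x \<in> translate s w \<longrightarrow> v = w)"
  using card_le_Suc0_iff_eq[OF finite_covering, of x s] by (auto simp: mult_def)

lemma mult_periodic: "z \<in> int_lattice \<Longrightarrow> mult s (x + z) = mult s x"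
proof -
  assume "z \<in> int_lattice"
  then obtain w where w: "z = rvec w" using range_rvec by blast
  have "bij_betw (\<lambda>v. v - w) {v. x \<in> translate s (v - w)} {v. x \<in> translate s v}"
    by (rule bij_betw_byWitness[where f' = "\<lambda>v. v + w"]) auto
  then show ?thesis by (simp add: mult_def w translate_add bij_betw_same_card)
qed

definition uncovered :: "real \<Rightarrow> (real^'n) set" where
  "uncovered s = {x. \<forall>v. x \<notin> translate s v}"

lemma uncovered_borel [measurable]: "uncovered s \<in> sets borel"
proof -
  have "uncovered s = - (\<Union>v. translate s v)" by (auto simp: uncovered_def)
  moreover have "(\<Union>v. translate s v) \<in> sets borel" by (intro sets.countable_UN) auto
  ultimately show ?thesis by auto
qed

text \<open>By periodicity, the volume in one unit cell is the proportion of space left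
  uncovered.\<close>

definition gap :: "real \<Rightarrow> real" where
  "gap s = measure lborel (uncovered s \<inter> cell 0)"

text \<open>The subtraction is that of natural numbers: uncovered points contribute 0 and not -1, so
  only excess coverage is measured.\<close>

definition overlap :: "real \<Rightarrow> real" where
  "overlap s = integral\<^sup>L lborel (\<lambda>x. indicat_real (cell 0) x * real (mult s x - 1))"

lemma integrable_cell_indicator:
  fixes A :: "(real^'n) set"
  shows "A \<in> sets borel \<Longrightarrow> integrable lborel (indicat_real (A \<inter> cell 0))"
proof (rule integrable_real_indicator)
  assume A: "A \<in> sets borel"
  have "emeasure lborel (A \<inter> cell 0) \<le> emeasure lborel (cell (0::real^'n))" by (rule emeasure_mono) auto
  then show "emeasure lborel (A \<inter> cell 0) < \<infinity>" by (simp add: emeasure_cell int_lattice_0 le_less_trans)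
qed auto

lemma measure_dilate: "s \<ge> 0 \<Longrightarrow> measure lborel (dilate s Q) = s ^ CARD('n) * V"
proof -
  assume s: "s \<ge> 0"
  have "(\<lambda>x. s *\<^sub>R x + 0) ` Q = dilate s Q" by (simp add: dilate_def)
  then have "measure lebesgue (dilate s Q) = s ^ CARD('n) * measure lebesgue Q"
    using measure_lebesgue_affine[of s 0 Q] s by simp
  moreover have "dilate s Q \<in> sets lborel" "Q \<in> sets lborel"
    using compact_dilate compact by (auto simp: borel_compact)
  ultimately show ?thesis by (simp add: V_def)
qed

lemma V_pos: "V > 0"
proof -
  have "\<not> negligible Q" using interior convex by (simp add: negligible_convex_interior)
  moreover have "Q \<in> lmeasurable" using compact by (rule lmeasurable_compact)
  ultimately have "measure lebesgue Q \<noteq> 0" by (simp add: negligible_iff_measure0)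
  moreover have "Q \<in> sets lborel" using compact by (auto simp: borel_compact)
  ultimately show ?thesis by (simp add: V_def measure_nonneg less_le)
qed

text \<open>Integrating the covering multiplicity over a fundamental cell gives the volume of \<open>sQ\<close>; it
  differs from the constant 1 by the uncovered part and by the excess multiplicity.\<close>

lemma
  assumes s: "s \<ge> 0"
  shows gap_eq: "gap s = 1 - s ^ CARD('n) * V + overlap s"
    and integrable_overlap: "integrable lborel (\<lambda>x. indicat_real (cell 0) x * real (mult s x - 1))"
proof -
  have m: "indicat_real (cell 0) x * real (mult s x) = (\<Sum>v\<in>near s. indicat_real (translate s v \<inter> cell 0) x)" for x
  proof (cases "x \<in> cell 0")
    case True
    then have "{v. x \<in> translate s v} = {v \<in> near s. x \<in> translate s v}" using translate_cell_near by auto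
    then have "real (mult s x) = (\<Sum>v\<in>{v \<in> near s. x \<in> translate s v}. 1)" by (simp add: mult_def)
    also have "\<dots> = (\<Sum>v\<in>near s. if x \<in> translate s v then 1 else 0)"
      by (rule sum.inter_filter[OF finite_near])
    finally show ?thesis using True by (simp add: indicator_def of_bool_def)
  qed (simp add: indicator_def)
  have int: "integrable lborel (indicat_real (translate s v \<inter> cell 0))" for v
    by (rule integrable_cell_indicator) simp
  have "integral\<^sup>L lborel (\<lambda>x. indicat_real (cell 0) x * real (mult s x)) =
      (\<Sum>v\<in>near s. measure lborel (translate s v \<inter> cell 0))"
    unfolding m using int by (subst Bochner_Integration.integral_sum) auto
  \<comment> \<open>Instead of many translates meeting one cell, one copy of sQ is cut by many
    cells, and its pieces add up to the volume of sQ.\<close>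
  also have "\<dots> = (\<Sum>v\<in>near s. measure lborel (dilate s Q \<inter> cell (- rvec v)))"
  proof (rule sum.cong[OF refl])
    fix v
    have "measure lborel {x. x + rvec v \<in> translate s v \<inter> cell 0} = measure lborel (translate s v \<inter> cell 0)"
      by (rule measure_lborel_translation) auto
    also have "{x. x + rvec v \<in> translate s v \<inter> cell 0} = dilate s Q \<inter> cell (- rvec v)"
      using s by (auto simp: mem_translate cell_translation rvec_mem_int_lattice)
    finally show "measure lborel (translate s v \<inter> cell 0) = measure lborel (dilate s Q \<inter> cell (- rvec v))"
      by simp
  qed
  also have "\<dots> = (\<Sum>z\<in>(\<lambda>v. - rvec v) ` near s. measure lborel (dilate s Q \<inter> cell z))"
    by (rule sum.reindex_cong[symmetric]) (auto simp: inj_on_def rvec_inj)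
  also have "\<dots> = measure lborel (dilate s Q)"
  proof (rule sum_measure_cells)
    show "dilate s Q \<in> sets borel" using compact_dilate by (rule borel_compact)
    show "emeasure lborel (dilate s Q) < \<infinity>"
      using compact_dilate compact_imp_bounded emeasure_lborel_bounded_finite by blast
    show "finite ((\<lambda>v. - rvec v) ` near s)" using finite_near by simp
    fix x assume x: "x \<in> dilate s Q"
    obtain v where v: "floor_vec x = rvec v" using floor_vec_mem range_rvec by blast
    have "norm (rvec v) \<le> norm x + norm (x - floor_vec x)"
      unfolding v using norm_triangle_ineq4[of x "x - rvec v"] by simp
    also have "\<dots> \<le> s * B + CARD('n)" using norm_dilate[OF s x] norm_diff_floor_vec[of x] by simp
    finally have "- v \<in> near s" by (simp add: near_def rvec_uminus)
    then show "floor_vec x \<in> (\<lambda>v. - rvec v) ` near s" using v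
      by (intro image_eqI[of _ _ "- v"]) (auto simp: rvec_uminus)
  qed
  also have "\<dots> = s ^ CARD('n) * V" by (rule measure_dilate[OF s])
  finally have total: "integral\<^sup>L lborel (\<lambda>x. indicat_real (cell 0) x * real (mult s x)) = s ^ CARD('n) * V" .
  have imult: "integrable lborel (\<lambda>x. indicat_real (cell 0) x * real (mult s x))"
    unfolding m using int by auto
  have icell: "integrable lborel (indicat_real (cell (0::real^'n)))"
    using integrable_cell_indicator[of UNIV] by simp
  have igap: "integrable lborel (indicat_real (uncovered s \<inter> cell 0))"
    by (rule integrable_cell_indicator) simp
  \<comment> \<open>The indicator of the uncovered set corrects the truncated subtraction at points
    of multiplicity 0.\<close>
  have pw: "indicat_real (cell 0) x * real (mult s x - 1) =
      indicat_real (cell 0) x * real (mult s x) - indicat_real (cell 0) x + indicat_real (uncovered s \<inter> cell 0) x" for x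
  proof (cases "mult s x = 0")
    case True
    then have "x \<in> uncovered s" by (simp add: mult_eq_0 uncovered_def)
    with True show ?thesis by (simp add: indicator_def)
  next
    case False
    then have "x \<notin> uncovered s" by (simp add: mult_eq_0 uncovered_def)
    with False show ?thesis by (simp add: indicator_def of_nat_diff)
  qed
  show "integrable lborel (\<lambda>x. indicat_real (cell 0) x * real (mult s x - 1))"
    unfolding pw using imult icell igap by simp
  have "overlap s = s ^ CARD('n) * V - 1 + gap s"
    unfolding overlap_def pw gap_def using imult icell igap total by (simp add: measure_cell int_lattice_0)
  then show "gap s = 1 - s ^ CARD('n) * V + overlap s" by simp
qed

lemma gap_nonneg: "gap s \<ge> 0"
  by (simp add: gap_def)

lemma overlap_nonneg: "overlap s \<ge> 0"
  unfolding overlap_def by (rule integral_nonneg_AE) auto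

lemma gap_ge: "s \<ge> 0 \<Longrightarrow> gap s \<ge> max 0 (1 - s ^ CARD('n) * V)"
  using gap_eq[of s] overlap_nonneg[of s] gap_nonneg[of s] by simp

text \<open>A nonnegative function with integral 0 vanishes almost everywhere. Periodicity extends
  this from the cell to all of space, and countability of the pairs v, w exchanges the
  quantifiers.\<close>

lemma overlap_eq_0_iff:
  assumes s: "s \<ge> 0"
  shows "overlap s = 0 \<longleftrightarrow> (\<forall>v w. v \<noteq> w \<longrightarrow> negligible (translate s v \<inter> translate s w))"
proof -
  have "overlap s = 0 \<longleftrightarrow> (AE x in lborel. indicat_real (cell 0) x * real (mult s x - 1) = 0)"
    unfolding overlap_def by (rule integral_nonneg_eq_0_iff_AE[OF integrable_overlap[OF s]]) simp
  also have "\<dots> \<longleftrightarrow> (AE x in lborel. x \<in> cell 0 \<longrightarrow> mult s x \<le> 1)"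
    by (intro AE_cong) (auto simp: indicator_def)
  also have "\<dots> \<longleftrightarrow> (AE x in lborel. mult s x \<le> 1)"
  proof
    show "AE x in lborel. mult s x \<le> 1" if "AE x in lborel. x \<in> cell 0 \<longrightarrow> mult s x \<le> 1"
      using that by (rule AE_periodic) (simp add: mult_periodic)
    show "AE x in lborel. x \<in> cell 0 \<longrightarrow> mult s x \<le> 1" if "AE x in lborel. mult s x \<le> 1"
      using that by eventually_elim simp
  qed
  also have "\<dots> \<longleftrightarrow> (AE x in lborel. \<forall>v w. v \<noteq> w \<longrightarrow> x \<notin> translate s v \<inter> translate s w)"
    unfolding mult_le_1 by (intro AE_cong) blast
  also have "\<dots> \<longleftrightarrow> (\<forall>v w. v \<noteq> w \<longrightarrow> (AE x in lborel. x \<notin> translate s v \<inter> translate s w))"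
    unfolding AE_all_countable by auto
  also have "\<dots> \<longleftrightarrow> (\<forall>v w. v \<noteq> w \<longrightarrow> negligible (translate s v \<inter> translate s w))"
  proof -
    have "(AE x in lborel. x \<notin> translate s v \<inter> translate s w) \<longleftrightarrow> negligible (translate s v \<inter> translate s w)" for v w
    proof -
      have A: "translate s v \<inter> translate s w \<in> sets lborel" by auto
      show ?thesis
        unfolding negligible_iff_null_sets null_sets_completion_iff[OF A] AE_iff_null_sets[OF A] ..
    qed
    then show ?thesis by simp
  qed
  finally show ?thesis .
qed

lemma gap_eq_0_imp_AE_covered:
  assumes "gap s = 0"
  shows "AE x in lborel. \<exists>v. x \<in> translate s v"
proof -
  have "emeasure lborel (uncovered s \<inter> cell 0) = 0"
  proof -
    have "emeasure lborel (uncovered s \<inter> cell 0) \<le> emeasure lborel (cell (0::real^'n))" by (rule emeasure_mono) auto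
    then have "emeasure lborel (uncovered s \<inter> cell 0) \<noteq> \<infinity>"
      by (auto simp: emeasure_cell int_lattice_0 top_unique)
    then show ?thesis using assms by (simp add: gap_def emeasure_eq_ennreal_measure)
  qed
  then have "uncovered s \<inter> cell 0 \<in> null_sets lborel" by auto
  then have "AE x in lborel. x \<notin> uncovered s \<inter> cell 0" by (rule AE_not_in)
  then have "AE x in lborel. x \<in> cell 0 \<longrightarrow> mult s x \<noteq> 0"
    by eventually_elim (auto simp: uncovered_def mult_eq_0)
  then have "AE x in lborel. mult s x \<noteq> 0" by (rule AE_periodic) (simp add: mult_periodic)
  then show ?thesis by eventually_elim (simp add: mult_eq_0)
qed

text \<open>Translates the dimension condition in the definition of tilings into measure: a convex
  set has full dimension exactly when it has interior points.\<close>

lemma negligible_convex_iff_aff_dim: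
  fixes A :: "(real^'n) set"
  assumes "convex A"
  shows "negligible A \<longleftrightarrow> aff_dim A < int CARD('n)"
proof -
  have "aff_dim A \<le> int CARD('n)" using aff_dim_le_DIM[of A] by simp
  moreover have "aff_dim A = int CARD('n) \<Longrightarrow> interior A \<noteq> {}"
    using rel_interior_eq_empty[OF assms] interior_rel_interior[of A] by (auto simp: aff_dim_empty)
  moreover have "interior A \<noteq> {} \<Longrightarrow> aff_dim A = int CARD('n)"
    using aff_dim_nonempty_interior[of A] by simp
  ultimately show ?thesis unfolding negligible_convex_interior[OF assms] by linarith
qed

lemma tiles_at_iff:
  "tiles_at Q s \<longleftrightarrow> s > 0 \<and> (\<forall>x. \<exists>v. x \<in> translate s v) \<and> overlap s = 0"
proof (cases "s > 0")
  case True
  then have s: "s \<ge> 0" by simp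
  have "aff_dim (translate s v \<inter> translate s w) < int CARD('n) \<longleftrightarrow> negligible (translate s v \<inter> translate s w)" for v w
    by (rule negligible_convex_iff_aff_dim[symmetric]) (intro convex_Int convex_translate)
  then show ?thesis
    unfolding tiles_at_def translate_eq[OF s, symmetric] overlap_eq_0_iff[OF s] by auto
qed (simp add: tiles_at_def)

text \<open>Coverage persists when the scale grows, and disjointness up to null sets persists when
  it shrinks. A tiling at l thus has no overlap up to l and no gap from l on, and
  \<open>gap_eq\<close> leaves the least possible gap at every scale.\<close>

lemma tiles_at_imp:
  assumes t: "tiles_at Q l" and s: "s > 0"
  shows "gap s = max 0 (1 - s ^ CARD('n) * V)" and "l ^ CARD('n) * V = 1"
proof -
  have l: "l > 0" "\<And>x. \<exists>v. x \<in> translate l v" "overlap l = 0" using t by (auto simp: tiles_at_iff)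
  have "uncovered l = {}" using l(2) by (auto simp: uncovered_def)
  then have "gap l = 0" by (simp add: gap_def)
  then show lV: "l ^ CARD('n) * V = 1" using gap_eq[of l] l by simp
  obtain q where q: "q \<in> Q" using interior interior_subset by blast
  \<comment> \<open>Q need not contain the origin, so growth of the scale from a to b is monotone
    only up to a shift by (b - a) q with q in Q.\<close>
  have sub: "x + (b - a) *\<^sub>R q \<in> translate b v" if "0 \<le> a" "a \<le> b" "x \<in> translate a v" for a b x v
  proof -
    have "((b - a) *\<^sub>R q, b - a) \<in> hom_cone Q" using that q by (auto simp: mem_hom_cone dilate_def)
    from hom_cone_add[OF convex that(3)[unfolded translate_def mem_Collect_eq] this]
    show ?thesis by (simp add: translate_def algebra_simps)
  qed
  show "gap s = max 0 (1 - s ^ CARD('n) * V)"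
  proof (cases "s \<le> l")
    case True
    have "overlap s = 0"
    proof (subst overlap_eq_0_iff)
      show "\<forall>v w. v \<noteq> w \<longrightarrow> negligible (translate s v \<inter> translate s w)"
      proof (intro allI impI)
        fix v w :: "int^'n" assume "v \<noteq> w"
        with l have n: "negligible (translate l v \<inter> translate l w)" using overlap_eq_0_iff[of l] by auto
        have "translate s v \<inter> translate s w \<subseteq> (+) (- ((l - s) *\<^sub>R q)) ` (translate l v \<inter> translate l w)"
        proof
          fix x assume "x \<in> translate s v \<inter> translate s w"
          then show "x \<in> (+) (- ((l - s) *\<^sub>R q)) ` (translate l v \<inter> translate l w)"
            unfolding mem_translation_iff using sub[of s l x] s True by auto
        qed
        then show "negligible (translate s v \<inter> translate s w)"
          using n by (meson negligible_subset negligible_translation)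
      qed
    qed (use s in simp)
    moreover have "s ^ CARD('n) * V \<le> 1"
      using power_mono[OF True, of "CARD('n)"] s V_pos lV by (metis less_imp_le mult_right_mono)
    ultimately show ?thesis using gap_eq[of s] s by simp
  next
    case False
    then have ls: "0 \<le> l" "l \<le> s" using l by auto
    have "uncovered s = {}"
    proof -
      have "\<exists>v. x \<in> translate s v" for x
      proof -
        obtain v where "x - (s - l) *\<^sub>R q \<in> translate l v" using l(2) by blast
        from sub[OF ls this] show ?thesis by auto
      qed
      then show ?thesis by (auto simp: uncovered_def)
    qed
    moreover have "1 \<le> s ^ CARD('n) * V"
      using power_mono[OF ls(2,1), of "CARD('n)"] V_pos lV by (metis less_imp_le mult_right_mono)
    ultimately show ?thesis by (simp add: gap_def)
  qed
qed

text \<open>Arbitrarily close to x there are points covered at the scales \<open>r i\<close>.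
  Finitely many lattice vectors are responsible for them, and closedness of the cone hands one of
  the coverings on to x.\<close>

lemma covered_limit:
  assumes lim: "r \<longlonglongrightarrow> s" and gap: "\<And>i. gap (r i) = 0"
  shows "\<exists>v. x \<in> translate s v"
proof (rule ccontr)
  assume n: "\<not> (\<exists>v. x \<in> translate s v)"
  have "\<exists>y v. y \<in> ball x (1 / Suc i) \<and> y \<in> translate (r i) v" for i
  proof (rule ccontr)
    assume c: "\<not> ?thesis"
    have "AE y in lborel. y \<notin> ball x (1 / Suc i)"
      using gap_eq_0_imp_AE_covered[OF gap[of i]] by eventually_elim (use c in blast)
    then have "ball x (1 / Suc i) \<in> null_sets lborel" by (subst AE_iff_null_sets) auto
    then have "negligible (ball x (1 / Suc i))" by (simp add: negligible_iff_null_sets null_sets_completionI)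
    then show False using open_not_negligible[of "ball x (1 / Suc i)"] by simp
  qed
  then obtain y v where yv: "\<And>i. y i \<in> ball x (1 / Suc i)" "\<And>i. y i \<in> translate (r i) (v i)" by metis
  have "(\<lambda>i. dist x (y i)) \<longlonglongrightarrow> 0"
  proof (rule tendsto_sandwich[of "\<lambda>_. 0" _ _ "\<lambda>i. 1 / real (Suc i)"])
    show "(\<lambda>i. 1 / real (Suc i)) \<longlonglongrightarrow> 0" using LIMSEQ_inverse_real_of_nat by (simp add: inverse_eq_divide)
  qed (use yv(1) in \<open>auto intro!: always_eventually less_imp_le\<close>)
  then have y: "y \<longlonglongrightarrow> x" by (subst tendsto_dist_iff) (simp add: dist_commute)
  obtain M where M: "\<And>i. \<bar>r i\<bar> \<le> M" using convergent_imp_Bseq[of r] lim by (auto simp: Bseq_def convergent_def)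
  \<comment> \<open>Contains all the \<open>v i\<close>, since \<open>y i\<close> is within 1 of x
    and within \<open>M * B\<close> of the lattice vector that covers it.\<close>
  define W where "W = {v :: int^'n. norm (rvec v - x) \<le> M * B + 1}"
  have "finite W" unfolding W_def by (rule finite_rvec_bounded)
  have vW: "v i \<in> W" for i
  proof -
    have "norm (rvec (v i) - x) \<le> norm (y i - rvec (v i)) + norm (y i - x)"
      using norm_triangle_ineq4[of "y i - x" "y i - rvec (v i)"] by (simp add: norm_minus_commute)
    also have "norm (y i - rvec (v i)) \<le> r i * B" using norm_translate[OF yv(2)] .
    also have "r i * B \<le> M * B" using M[of i] B_nonneg by (intro mult_right_mono) auto
    also have "norm (y i - x) \<le> 1"
    proof -
      have "norm (y i - x) < 1 / Suc i" using yv(1)[of i] by (simp add: dist_norm norm_minus_commute)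
      also have "\<dots> \<le> 1" by simp
      finally show ?thesis by simp
    qed
    finally show ?thesis by (simp add: W_def)
  qed
  have "\<forall>\<^sub>F i in sequentially. \<forall>w\<in>W. (y i - rvec w, r i) \<in> - hom_cone Q"
  proof (rule eventually_ball_finite[OF \<open>finite W\<close>], rule ballI)
    fix w
    have "(\<lambda>i. (y i - rvec w, r i)) \<longlonglongrightarrow> (x - rvec w, s)" by (intro tendsto_intros y lim)
    then show "\<forall>\<^sub>F i in sequentially. (y i - rvec w, r i) \<in> - hom_cone Q"
      by (rule topological_tendstoD) (use n closed_hom_cone[OF compact] in \<open>auto simp: translate_def\<close>)
  qed
  then obtain i where "\<forall>w\<in>W. (y i - rvec w, r i) \<in> - hom_cone Q"
    using eventually_happens trivial_limit_sequentially by blast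
  then show False using vW[of i] yv(2)[of i] by (auto simp: translate_def)
qed

end

section \<open>The limit over multiples of a polytope\<close>

lemma measure_eq_integral_slices:
  fixes A :: "((real^'n) \<times> real) set"
  assumes A: "A \<in> sets borel" "emeasure lborel A < \<infinity>"
  shows "measure lborel A = integral\<^sup>L lborel (\<lambda>t. measure lborel {x. (x, t) \<in> A})"
    and "(\<lambda>t. measure lborel {x. (x, t) \<in> A}) \<in> borel_measurable lborel"
proof -
  have slice: "{x. (x, t) \<in> A} \<in> sets lborel" for t
  proof -
    have "(\<lambda>x. (x, t)) -` A \<inter> space borel \<in> sets borel"
      by (rule measurable_sets[OF _ A(1)]) (simp add: borel_prod[symmetric])
    then show ?thesis by (simp add: vimage_def)
  qed
  have s: "(\<lambda>t. \<integral>x. indicat_real A (x, t) \<partial>lborel) = (\<lambda>t. measure lborel {x. (x, t) \<in> A})"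
  proof
    fix t
    have "(\<lambda>x. indicat_real A (x, t)) = indicat_real {x. (x, t) \<in> A}" by (auto simp: indicator_def)
    then show "(\<integral>x. indicat_real A (x, t) \<partial>lborel) = measure lborel {x. (x, t) \<in> A}"
      using slice by simp
  qed
  have int: "integrable (lborel \<Otimes>\<^sub>M lborel) (\<lambda>(x, t). indicat_real A (x, t))"
    unfolding lborel_prod using A by (auto simp: integrable_real_indicator)
  from lborel_pair.integral_snd[OF int]
  have "integral\<^sup>L lborel (\<lambda>t. measure lborel {x. (x, t) \<in> A}) = integral\<^sup>L (lborel \<Otimes>\<^sub>M lborel) (indicat_real A)"
    unfolding s by (simp add: case_prod_beta')
  then show "measure lborel A = integral\<^sup>L lborel (\<lambda>t. measure lborel {x. (x, t) \<in> A})"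
    unfolding lborel_prod using A by simp
  from lborel_pair.integrable_snd[OF int] show "(\<lambda>t. measure lborel {x. (x, t) \<in> A}) \<in> borel_measurable lborel"
    unfolding s by auto
qed

lemma mem_hom_cone_dilate: "k > 0 \<Longrightarrow> (x, t) \<in> hom_cone (dilate k Q) \<longleftrightarrow> (x, k * t) \<in> hom_cone Q"
  by (auto simp: mem_hom_cone dilate_def image_image mult.commute zero_le_mult_iff)

context convex_body
begin

text \<open>The slice of \<open>hk_region\<close> for kQ at height 1 + s/k: there the cone has slice
  (k + s)Q and its translates have slices u + sQ.\<close>

definition shell :: "nat \<Rightarrow> real \<Rightarrow> (real^'n) set" where
  "shell k s = {x \<in> dilate (real k + s) Q. \<forall>u\<in>lattice_points (dilate (real k) Q). x \<notin> translate s u}"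

lemma finite_lattice_points_dilate: "k \<ge> 0 \<Longrightarrow> finite (lattice_points (dilate k Q))"
proof (rule finite_subset)
  assume "k \<ge> 0"
  then show "lattice_points (dilate k Q) \<subseteq> {v. norm (rvec v - 0) \<le> k * B}"
    using norm_dilate by (auto simp: lattice_points_def)
qed (rule finite_rvec_bounded)

lemma shell_borel [measurable]: "shell k s \<in> sets borel"
proof -
  have eq: "shell k s = dilate (real k + s) Q - (\<Union>u\<in>lattice_points (dilate (real k) Q). translate s u)"
    unfolding shell_def by blast
  have "(\<Union>u\<in>lattice_points (dilate (real k) Q). translate s u) \<in> sets borel"
    by (intro sets.finite_UN finite_lattice_points_dilate translate_borel) simp
  from sets.Diff[OF borel_compact[OF compact_dilate[of "real k + s"]] this] show ?thesis
    unfolding eq .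
qed

lemma bounded_shell: "bounded (shell k s)"
  by (rule bounded_subset[OF compact_imp_bounded[OF compact_dilate[of "real k + s"]]]) (auto simp: shell_def)

lemma measure_shell_le: "s \<ge> 0 \<Longrightarrow> measure lborel (shell k s) \<le> (real k + s) ^ CARD('n) * V"
proof -
  assume s: "s \<ge> 0"
  have "measure lborel (shell k s) \<le> measure lborel (dilate (real k + s) Q)"
  proof (rule measure_mono_fmeasurable)
    show "dilate (real k + s) Q \<in> fmeasurable lborel"
      using compact_dilate compact_imp_bounded emeasure_lborel_bounded_finite borel_compact
      by (intro fmeasurableI) auto
    show "shell k s \<subseteq> dilate (real k + s) Q" by (auto simp: shell_def)
  qed (use shell_borel in simp)
  also have "\<dots> = (real k + s) ^ CARD('n) * V" using s by (intro measure_dilate) simp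
  finally show ?thesis .
qed

lemma measure_uncovered_cell: "z \<in> int_lattice \<Longrightarrow> measure lborel (uncovered s \<inter> cell z) = gap s"
proof -
  assume z: "z \<in> int_lattice"
  then obtain w where w: "z = rvec w" using range_rvec by blast
  have u: "x + rvec w \<in> uncovered s \<longleftrightarrow> x \<in> uncovered s" for x
  proof -
    have "x + rvec w \<in> uncovered s \<longleftrightarrow> (\<forall>v. x \<notin> translate s (v - w))" by (simp add: uncovered_def translate_add)
    also have "\<dots> \<longleftrightarrow> (\<forall>v. x \<notin> translate s v)" by (metis add_diff_cancel)
    finally show ?thesis by (simp add: uncovered_def)
  qed
  have "measure lborel {x. x + z \<in> uncovered s \<inter> cell z} = measure lborel (uncovered s \<inter> cell z)"
    by (rule measure_lborel_translation) auto
  also have "{x. x + z \<in> uncovered s \<inter> cell z} = uncovered s \<inter> cell 0"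
    using z u by (auto simp: cell_translation w)
  finally show ?thesis by (simp add: gap_def)
qed

text \<open>Away from the boundary of \<open>kQ\<close> the shell agrees with the set left uncovered by all lattice
  translates of \<open>sQ\<close>, so each cell in the interior contributes the gap.\<close>

lemma shell_limit:
  assumes s: "s > 0"
  shows "(\<lambda>k. measure lborel (shell k s) / real k ^ CARD('n)) \<longlonglongrightarrow> gap s * V"
proof -
  define q where "q k = real (Suc k)" for k
  have q: "filterlim q at_top sequentially" "\<And>k. q k \<ge> 1"
    unfolding q_def using filterlim_compose[OF filterlim_real_sequentially filterlim_Suc] by auto
  have q0: "q k > 0" for k using q(2)[of k] by simp
  define g where "g k z = measure lborel (shell (Suc k) s \<inter> cell z)" for k and z :: "real^'n"
  \<comment> \<open>Indexes every cell that can meet the shell: points of (q + s)Q have norm at most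
    (q + s) B, and rounding adds at most D.\<close>
  define Z where "Z k = cball (0::real^'n) ((q k + s) * B + CARD('n)) \<inter> int_lattice" for k
  let ?D = "real CARD('n)"
  have normx: "norm x \<le> (q k + s) * B" if "x \<in> shell (Suc k) s" for x k
    using that s norm_dilate[of "real (Suc k) + s" x] by (auto simp: shell_def q_def)
  have inZ: "floor_vec x \<in> Z k" if "x \<in> shell (Suc k) s" for x k
  proof -
    have "norm (floor_vec x) \<le> norm x + norm (x - floor_vec x)"
      using norm_triangle_ineq4[of x "x - floor_vec x"] by simp
    also have "\<dots> \<le> (q k + s) * B + ?D" using normx[OF that] norm_diff_floor_vec[of x] by simp
    finally show ?thesis using floor_vec_mem by (simp add: Z_def)
  qed
  have finZ: "finite (Z k)" for k unfolding Z_def by (rule finite_int_lattice_bounded) simp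
  have limB: "\<forall>\<^sub>F k in sequentially. M < q k * e" if "e > 0" for M e
  proof -
    have "\<forall>\<^sub>F k in sequentially. q k > M / e" using q(1) by (simp add: filterlim_at_top_dense)
    then show ?thesis by eventually_elim (use that in \<open>simp add: field_simps\<close>)
  qed
  \<comment> \<open>A point in the cell of q y differs from (q + s) y by a bounded amount, so
    division by q + s brings it close to y.\<close>
  have close: "norm (x /\<^sub>R (q k + s) - y) < e"
    if "x \<in> cell (floor_vec (q k *\<^sub>R y))" "2 * ?D + s * norm y < q k * e" for x y :: "real^'n" and k e
  proof -
    have "norm (x - q k *\<^sub>R y) \<le> norm (x - floor_vec (q k *\<^sub>R y)) + norm (q k *\<^sub>R y - floor_vec (q k *\<^sub>R y))"
      using norm_triangle_ineq4[of "x - floor_vec (q k *\<^sub>R y)" "q k *\<^sub>R y - floor_vec (q k *\<^sub>R y)"] by simp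
    also have "\<dots> \<le> 2 * ?D" using norm_cell_diff[OF that(1)] norm_diff_floor_vec[of "q k *\<^sub>R y"] by simp
    finally have 1: "norm (x - q k *\<^sub>R y) \<le> 2 * ?D" .
    have qs: "q k + s \<noteq> 0" using q0[of k] s by simp
    have dec: "(x - q k *\<^sub>R y) - s *\<^sub>R y = x - (q k + s) *\<^sub>R y" by (simp add: scaleR_add_left)
    have "x /\<^sub>R (q k + s) - y = ((x - q k *\<^sub>R y) - s *\<^sub>R y) /\<^sub>R (q k + s)"
      unfolding dec using qs by (simp add: scaleR_diff_right)
    then have "norm (x /\<^sub>R (q k + s) - y) = norm ((x - q k *\<^sub>R y) - s *\<^sub>R y) / (q k + s)"
      using q0[of k] s by (simp add: divide_inverse_commute)
    also have "\<dots> \<le> (2 * ?D + s * norm y) / (q k + s)"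
      using norm_triangle_ineq4[of "x - q k *\<^sub>R y" "s *\<^sub>R y"] 1 s q0[of k] by (intro divide_right_mono) auto
    also have "\<dots> \<le> (2 * ?D + s * norm y) / q k"
      using s q0[of k] by (intro divide_left_mono) auto
    also have "\<dots> < e" using that(2) q0[of k] by (simp add: field_simps)
    finally show ?thesis .
  qed
  have "(\<lambda>k. (\<Sum>z\<in>Z k. g k z) / q k ^ DIM(real^'n)) \<longlonglongrightarrow> integral\<^sup>L lborel (\<lambda>y. gap s * indicat_real Q y)"
  proof (rule lattice_sum_limit[OF q finZ])
    show "Z k \<subseteq> int_lattice" for k by (simp add: Z_def)
    show "g k z = 0" if "z \<notin> Z k" for k z
    proof -
      have "shell (Suc k) s \<inter> cell z = {}" using inZ that by (auto simp: cell_def)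
      then show ?thesis by (simp add: g_def)
    qed
    show "\<bar>g k z\<bar> \<le> 1" for k z
    proof (cases "z \<in> int_lattice")
      case True
      have "g k z \<le> measure lborel (cell z)" unfolding g_def
        by (rule measure_mono_fmeasurable) (auto simp: fmeasurable_def emeasure_cell True)
      then show ?thesis by (simp add: measure_cell True) (simp add: g_def)
    next
      case False
      then have "cell z = {}" using floor_vec_mem by (auto simp: cell_def)
      then show ?thesis by (simp add: g_def)
    qed
    show "norm z \<le> ((1 + s) * B + ?D) * q k" if "z \<in> Z k" for k z
    proof -
      have "0 \<le> s * B" using s B_nonneg by simp
      then have f: "s * B \<le> s * B * q k" "?D \<le> ?D * q k"
        using q(2)[of k] by (simp_all add: mult_le_cancel_left1)
      have e1: "((1 + s) * B + ?D) * q k = q k * B + s * B * q k + ?D * q k" by (simp add: algebra_simps)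
      have e2: "(q k + s) * B = q k * B + s * B" by (simp add: distrib_right)
      have "(q k + s) * B + ?D \<le> ((1 + s) * B + ?D) * q k"
        unfolding e1 e2 by (intro add_mono order.refl f)
      then show ?thesis using that by (auto simp: Z_def)
    qed
    have Qb: "Q \<in> sets lborel" using borel_compact[OF compact] by simp
    then show "(\<lambda>y. gap s * indicat_real Q y) \<in> borel_measurable lborel" by auto
    show "AE y in lborel. (\<lambda>k. g k (floor_vec (q k *\<^sub>R y))) \<longlonglongrightarrow> gap s * indicat_real Q y"
      using AE_not_in_frontier_convex[OF convex]
    proof eventually_elim
      case (elim y)
      show ?case
      proof (cases "y \<in> Q")
        case True
        with elim have "y \<in> interior Q"
          by (auto simp: frontier_def intro: subsetD[OF closure_subset])
        then obtain e where e: "e > 0" "ball y e \<subseteq> Q" by (meson mem_interior)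
        have "\<forall>\<^sub>F k in sequentially. g k (floor_vec (q k *\<^sub>R y)) = gap s"
          using limB[OF e(1), of "2 * ?D + s * B"]
        proof eventually_elim
          case (elim k)
          let ?z = "floor_vec (q k *\<^sub>R y)"
          have "norm y \<le> B" using True by (rule norm_le_B)
          then have "s * norm y \<le> s * B" using s by (intro mult_left_mono) auto
          with elim have l: "2 * ?D + s * norm y < q k * e" by linarith
          have "x \<in> shell (Suc k) s \<longleftrightarrow> x \<in> uncovered s" if x: "x \<in> cell ?z" for x
          proof -
            have "x /\<^sub>R (q k + s) \<in> Q" using close[OF x l] e(2) by (auto simp: dist_norm norm_minus_commute)
            moreover have "x = (real (Suc k) + s) *\<^sub>R (x /\<^sub>R (q k + s))" using q0[of k] s by (simp add: q_def)
            ultimately have "x \<in> dilate (real (Suc k) + s) Q" unfolding dilate_def by blast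
            \<comment> \<open>A lattice vector whose translate meets the cell is within sB + 2D of q
              y and hence lies in qQ. Above interior points y the shell therefore misses none of the
              lattice translates.\<close>
            moreover have "v \<in> lattice_points (dilate (real (Suc k)) Q)" if v: "x \<in> translate s v" for v
            proof -
              have "norm (rvec v - q k *\<^sub>R y) \<le> norm (x - rvec v) + norm (x - q k *\<^sub>R y)"
                using norm_triangle_ineq4[of "x - q k *\<^sub>R y" "x - rvec v"] by simp
              also have "norm (x - q k *\<^sub>R y) \<le> norm (x - ?z) + norm (q k *\<^sub>R y - ?z)"
                using norm_triangle_ineq4[of "x - ?z" "q k *\<^sub>R y - ?z"] by simp
              also have "norm (x - rvec v) + (norm (x - ?z) + norm (q k *\<^sub>R y - ?z)) \<le> s * B + (?D + ?D)"
                using norm_translate[OF v] norm_cell_diff[OF x] norm_diff_floor_vec[of "q k *\<^sub>R y"] by simp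
              also have "\<dots> < q k * e" using elim by simp
              finally have 1: "norm (rvec v - q k *\<^sub>R y) < q k * e" by simp
              have "rvec v /\<^sub>R q k - y = (rvec v - q k *\<^sub>R y) /\<^sub>R q k"
                using q0[of k] by (simp add: scaleR_diff_right)
              then have "norm (rvec v /\<^sub>R q k - y) = norm (rvec v - q k *\<^sub>R y) / q k"
                using q0[of k] by (simp add: divide_inverse_commute)
              also have "\<dots> < e" using 1 q0[of k] by (simp add: field_simps)
              finally have "rvec v /\<^sub>R q k \<in> Q" using e(2) by (auto simp: dist_norm norm_minus_commute)
              moreover have "rvec v = real (Suc k) *\<^sub>R (rvec v /\<^sub>R q k)" using q0[of k] by (simp add: q_def)
              ultimately show ?thesis unfolding lattice_points_def dilate_def by blast
            qed
            ultimately show ?thesis by (auto simp: shell_def uncovered_def)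
          qed
          then have "shell (Suc k) s \<inter> cell ?z = uncovered s \<inter> cell ?z" by blast
          then show ?case by (simp add: g_def measure_uncovered_cell floor_vec_mem)
        qed
        then show ?thesis using True by (simp add: tendsto_eventually)
      next
        case False
        then obtain e where e: "e > 0" "ball y e \<subseteq> - Q"
          using compact_imp_closed[OF compact] by (metis ComplI open_Compl openE)
        have "\<forall>\<^sub>F k in sequentially. g k (floor_vec (q k *\<^sub>R y)) = 0"
          using limB[OF e(1), of "2 * ?D + s * norm y"]
        proof eventually_elim
          case (elim k)
          have "x \<notin> shell (Suc k) s" if x: "x \<in> cell (floor_vec (q k *\<^sub>R y))" for x
          proof
            assume "x \<in> shell (Suc k) s"
            then obtain a where "a \<in> Q" "x = (q k + s) *\<^sub>R a" by (auto simp: shell_def dilate_def q_def)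
            then have "x /\<^sub>R (q k + s) \<in> Q" using q0[of k] s by simp
            with close[OF x elim] e(2) show False by (auto simp: dist_norm norm_minus_commute)
          qed
          then have "shell (Suc k) s \<inter> cell (floor_vec (q k *\<^sub>R y)) = {}" by blast
          then show ?case by (simp add: g_def)
        qed
        then show ?thesis using False by (simp add: tendsto_eventually)
      qed
    qed
  qed
  moreover have "(\<Sum>z\<in>Z k. g k z) = measure lborel (shell (Suc k) s)" for k
    unfolding g_def
    by (rule sum_measure_cells) (use inZ finZ emeasure_lborel_bounded_finite[OF bounded_shell] in auto)
  moreover have "integral\<^sup>L lborel (\<lambda>y. gap s * indicat_real Q y) = gap s * V"
    using borel_compact[OF compact] by (simp add: V_def)
  ultimately have "(\<lambda>k. measure lborel (shell (Suc k) s) / real (Suc k) ^ CARD('n)) \<longlonglongrightarrow> gap s * V"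
    by (simp add: q_def V_def)
  then show ?thesis by (rule LIMSEQ_imp_Suc)
qed

end

section \<open>The excess of the Hilbert-Kunz multiplicity as an integral over shells\<close>

context spanning_polytope
begin

sublocale body: convex_body Q
  by standard (rule compact convex interior)+

text \<open>In a combination of the \<open>card L\<close> generators of the cone, a height above
  \<open>card L\<close> forces some coefficient to be at least 1, and that generator can be
  subtracted without leaving the cone.\<close>

lemma cone_minus_semigroup:
  assumes "(x, t) \<in> C" "t \<ge> real k + card L"
  shows "\<exists>s\<in>S. snd s = int k \<and> (x, t) - pvec s \<in> C"
  using assms
proof (induction k arbitrary: x t)
  case 0
  then show ?case by (intro bexI[of _ 0]) (auto simp: pvec_zero semigroup_gen.zero)
next
  case (Suc k)
  then have "(x, t) \<in> C" by simp
  from cone_coefficients[OF this] obtain c where c: "\<And>u. c u \<ge> 0" "(x, t) = (\<Sum>u\<in>L. c u *\<^sub>R pvec (u, 1))"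
    by blast
  have t: "t = (\<Sum>u\<in>L. c u)" using arg_cong[OF c(2), of snd] by (simp add: snd_sum pvec_def)
  have "\<exists>u\<in>L. c u \<ge> 1"
  proof (rule ccontr)
    assume n: "\<not> ?thesis"
    have "t \<le> (\<Sum>u\<in>L. 1)" unfolding t by (rule sum_mono) (use n in force)
    then show False using Suc.prems(2) by simp
  qed
  then obtain u where u: "u \<in> L" "c u \<ge> 1" by blast
  have "(x, t) - pvec (u, 1) = (\<Sum>v\<in>L - {u}. c v *\<^sub>R pvec (v, 1)) + (c u - 1) *\<^sub>R pvec (u, 1)"
    unfolding c(2) using finite_lattice_points u(1) by (simp add: sum.remove algebra_simps)
  moreover have "(\<Sum>v\<in>A. c v *\<^sub>R pvec (v, 1)) \<in> C" if "A \<subseteq> L" for A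
    using finite_subset[OF that finite_lattice_points] that
  proof induction
    case empty
    then show ?case using pvec_mem_cone[OF semigroup_gen.zero] by (simp add: pvec_zero)
  next
    case (insert v A)
    then show ?case using c(1) by (auto intro!: hom_cone_add[OF convex] hom_cone_scale pvec_gen_mem_cone)
  qed
  ultimately have "(x, t) - pvec (u, 1) \<in> C"
    using u by (auto intro!: hom_cone_add[OF convex] hom_cone_scale pvec_gen_mem_cone)
  then have "(x - rvec u, t - 1) \<in> C" by (simp add: pvec_def)
  from Suc.IH[OF this] Suc.prems(2) obtain s where s: "s \<in> S" "snd s = int k" "(x - rvec u, t - 1) - pvec s \<in> C" by auto
  have "(u, 1) + s \<in> S" using u s by (auto intro: semigroup_gen.add)
  moreover have "(x, t) - pvec ((u, 1) + s) = (x - rvec u, t - 1) - pvec s"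
    by (simp add: pvec_add) (simp add: pvec_def)
  ultimately show ?case using s by (intro bexI[of _ "(u, 1) + s"]) auto
qed

text \<open>A point this high can lose k generators, whose sum is a lattice point of kQ. The bound
  on s does not involve k, which is what makes dominated convergence in k possible.\<close>

lemma shell_empty:
  assumes "k \<ge> 1" "s \<ge> real (card L)"
  shows "body.shell k s = {}"
proof (rule ccontr)
  assume "body.shell k s \<noteq> {}"
  then obtain x where x: "x \<in> dilate (real k + s) Q" "\<forall>u\<in>lattice_points (dilate (real k) Q). x \<notin> body.translate s u"
    by (auto simp: body.shell_def)
  have "(x, real k + s) \<in> C" using x(1) assms by (simp add: mem_hom_cone)
  from cone_minus_semigroup[OF this, of k] assms obtain g where g: "g \<in> S" "snd g = int k" "(x, real k + s) - pvec g \<in> C"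
    by auto
  have "pvec g \<in> C" using g(1) by (rule pvec_mem_cone)
  then have "fst g \<in> lattice_points (dilate (real k) Q)"
    using g(2) by (simp add: pvec_def mem_hom_cone lattice_points_def)
  moreover have "x \<in> body.translate s (fst g)"
    using g(2,3) by (simp add: pvec_def body.translate_def)
  ultimately show False using x(2) by blast
qed

text \<open>Translates by points of height 1 begin at height 1, so below it the region is the whole
  cone, which cancels. Above it, Fubini and the substitution t = 1 + s/k produce the shells and the
  factor 1/k; the same slicing yields measurability.\<close>

lemma excess_eq_integral_shell:
  assumes k: "k \<ge> 1"
  shows "measure lborel (spanning_polytope.hk_region (dilate (real k) Q)) -
      measure lborel (hom_cone (dilate (real k) Q) \<inter> {y. snd y \<le> 1}) =
    integral\<^sup>L lborel (\<lambda>s. indicat_real {0<..} s * measure lborel (body.shell k s)) / real k"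
    and "(\<lambda>s. indicat_real {0<..} s * measure lborel (body.shell k s)) \<in> borel_measurable lborel"
proof -
  interpret K: spanning_polytope "dilate (real k) Q"
    by (rule spanning_polytope_dilate[OF spanning_polytope_axioms k])
  define E where "E = K.hk_region \<inter> {y. snd y > 1}"
  have k0: "real k > 0" using k by simp
  have slice: "{x. (x, t) \<in> E} = (if t > 1 then body.shell k ((t - 1) * real k) else {})" for t
  proof (cases "t > 1")
    case True
    have "(x, t) \<in> E \<longleftrightarrow> x \<in> body.shell k ((t - 1) * real k)" for x
    proof -
      have "real k + (t - 1) * real k = real k * t" by (simp add: algebra_simps)
      moreover have "((x, t) - pvec (u, 1) \<in> hom_cone (dilate (real k) Q)) = (x \<in> body.translate ((t - 1) * real k) u)" for u
        using k0 by (simp add: pvec_def mem_hom_cone_dilate body.translate_def mult.commute)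
      moreover have "(x, t) \<in> hom_cone (dilate (real k) Q) \<longleftrightarrow> x \<in> dilate (real k * t) Q"
        using k0 True unfolding mem_hom_cone_dilate[OF k0] by (simp add: mem_hom_cone)
      ultimately show ?thesis using True by (simp add: E_def K.hk_region_def body.shell_def)
    qed
    then show ?thesis using True by auto
  qed (auto simp: E_def)
  \<comment> \<open>\<open>shell_empty\<close> bounds the height, so E has finite measure and Fubini
    applies.\<close>
  have Esub: "norm y \<le> (card L * body.B + real k * body.B) + (real (card L) + 1)" if y: "y \<in> E" for y
  proof -
    obtain x t where xt: "y = (x, t)" by (cases y)
    with y slice[of t] have t: "t > 1" "x \<in> body.shell k ((t - 1) * real k)"
      by (auto split: if_splits)
    then have l: "(t - 1) * real k < card L" using shell_empty[OF k] by (metis empty_iff not_le)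
    have "(t - 1) * 1 \<le> (t - 1) * real k" using t k by (intro mult_left_mono) auto
    with l have tb: "t \<le> card L + 1" by simp
    have "norm x \<le> (real k + (t - 1) * real k) * body.B"
      using t by (intro body.norm_dilate) (auto simp: body.shell_def)
    also have "\<dots> \<le> (real k + card L) * body.B" using l body.B_nonneg by (intro mult_right_mono) auto
    finally have "norm x \<le> card L * body.B + real k * body.B" by (simp add: algebra_simps)
    moreover have "norm y \<le> norm x + norm t" unfolding xt by (rule norm_Pair_le)
    ultimately show ?thesis using t(1) tb by simp
  qed
  have bE: "bounded E" using Esub unfolding bounded_iff by blast
  have sE: "E \<in> sets borel"
  proof -
    have "{y :: (real^'n) \<times> real. snd y > 1} \<in> sets borel"
      by (intro borel_open open_Collect_less continuous_intros)
    then show ?thesis using K.hk_region_borel by (auto simp: E_def)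
  qed
  have fE: "emeasure lborel E < \<infinity>" by (rule emeasure_lborel_bounded_finite[OF bE])
  let ?C = "hom_cone (dilate (real k) Q) \<inter> {y. snd y \<le> 1}"
  have half: "closed {y :: (real^'n) \<times> real. snd y \<le> 1}" by (intro closed_Collect_le continuous_intros)
  have CB: "bounded ?C"
  proof -
    have "norm y \<le> real k * body.B + 1" if "y \<in> ?C" for y
    proof -
      obtain x t where xt: "y = (x, t)" by (cases y)
      with that have t: "0 \<le> t" "t \<le> 1" "(x, real k * t) \<in> hom_cone Q"
        using mem_hom_cone_dilate[OF k0, of x t Q] by (auto simp: mem_hom_cone)
      then have "norm x \<le> real k * t * body.B" by (intro body.norm_dilate) (auto simp: mem_hom_cone)
      also have "\<dots> \<le> real k * 1 * body.B" using t body.B_nonneg by (intro mult_right_mono mult_left_mono) auto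
      finally have "norm x \<le> real k * body.B" by simp
      moreover have "norm y \<le> norm x + norm t" unfolding xt by (rule norm_Pair_le)
      ultimately show ?thesis using t by simp
    qed
    then show ?thesis unfolding bounded_iff by blast
  qed
  have sC: "?C \<in> sets borel" using closed_hom_cone[OF K.compact] half by auto
  have fC: "emeasure lborel ?C < \<infinity>" by (rule emeasure_lborel_bounded_finite[OF CB])
  have AEn: "AE y in (lborel :: ((real^'n) \<times> real) measure). snd y \<noteq> 1"
  proof -
    have h: "convex {y :: (real^'n) \<times> real. snd y \<le> 1}"
      using convex_halfspace_le[of "(0 :: real^'n, 1::real)" 1] by (simp add: inner_prod_def)
    have "frontier {y :: (real^'n) \<times> real. snd y \<le> 1} = {y. snd y = 1}"
      using frontier_halfspace_le[of "(0 :: real^'n, 1::real)" 1] by (simp add: inner_prod_def)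
    with AE_not_in_frontier_convex[OF h] show ?thesis by simp
  qed
  have eqAE: "AE y in lborel. y \<in> K.hk_region \<longleftrightarrow> y \<in> ?C \<union> E"
    using AEn
  proof eventually_elim
    case (elim y)
    obtain x t where xt: "y = (x, t)" by (cases y)
    show ?case
    proof (cases "t > 1")
      case False
      with elim have "t < 1" by (simp add: xt)
      then have "y - pvec (u, 1) \<notin> hom_cone (dilate (real k) Q)" for u
        by (simp add: xt pvec_def mem_hom_cone)
      then show ?thesis using \<open>t < 1\<close> by (auto simp: E_def K.hk_region_def xt)
    qed (auto simp: E_def xt)
  qed
  have "measure lborel K.hk_region = measure lborel (?C \<union> E)"
    using K.hk_region_borel sC sE by (intro measure_eq_AE[OF eqAE]) auto
  also have "\<dots> = measure lborel ?C + measure lborel E"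
    using sC sE fC fE by (intro measure_Union) (auto simp: E_def)
  finally have d: "measure lborel K.hk_region - measure lborel ?C = measure lborel E" by simp
  let ?f = "\<lambda>t. measure lborel {x. (x, t) \<in> E}"
  have f: "?f (1 + (1 / real k) * s) = indicat_real {0<..} s * measure lborel (body.shell k s)" for s
  proof -
    have 1: "1 + (1 / real k) * s > 1 \<longleftrightarrow> s > 0" using k0 by (simp add: zero_less_divide_iff)
    have 2: "(1 + (1 / real k) * s - 1) * real k = s" using k0 by simp
    show ?thesis unfolding slice 1 2 by (cases "s > 0") simp_all
  qed
  have "measure lborel E = integral\<^sup>L lborel ?f" by (rule measure_eq_integral_slices(1)[OF sE fE])
  also have "\<dots> = \<bar>1 / real k\<bar> *\<^sub>R integral\<^sup>L lborel (\<lambda>s. ?f (1 + (1 / real k) * s))"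
    by (rule lborel_integral_real_affine) (use k0 in simp)
  finally show "measure lborel K.hk_region - measure lborel ?C =
      integral\<^sup>L lborel (\<lambda>s. indicat_real {0<..} s * measure lborel (body.shell k s)) / real k"
    unfolding f d by simp
  have m: "?f \<in> borel_measurable borel" using measure_eq_integral_slices(2)[OF sE fE] by simp
  have "(\<lambda>s. ?f (1 + (1 / real k) * s)) \<in> borel_measurable borel"
    by (rule measurable_compose[OF _ m]) simp
  then show "(\<lambda>s. indicat_real {0<..} s * measure lborel (body.shell k s)) \<in> borel_measurable lborel"
    unfolding f by simp
qed

lemma
  shows integrable_gap: "integrable lborel (\<lambda>s. indicat_real {0<..} s * body.gap s)"
    and integral_shell_limit: "(\<lambda>k. integral\<^sup>L lborel (\<lambda>s. indicat_real {0<..} s * measure lborel (body.shell k s)) / real k ^ CARD('n))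
      \<longlonglongrightarrow> body.V * integral\<^sup>L lborel (\<lambda>s. indicat_real {0<..} s * body.gap s)"
proof -
  let ?F = "\<lambda>k s. indicat_real {0<..} s * measure lborel (body.shell (Suc k) s) / real (Suc k) ^ CARD('n)"
  let ?h = "\<lambda>s. indicat_real {0<..} s * (body.gap s * body.V)"
  have lim: "(\<lambda>k. ?F k s) \<longlonglongrightarrow> ?h s" for s
  proof (cases "s > 0")
    case True
    then show ?thesis using LIMSEQ_Suc[OF body.shell_limit[OF True]] by simp
  qed simp
  have mF: "?F k \<in> borel_measurable lborel" for k
    using excess_eq_integral_shell(2)[of "Suc k"] by (intro borel_measurable_divide) auto
  \<comment> \<open>Measurability of the gap in s is inherited from the shells through the pointwise
    limit.\<close>
  have mh: "?h \<in> borel_measurable lborel" by (rule borel_measurable_LIMSEQ_metric[OF mF lim])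
  define c where "c = real (card L)"
  \<comment> \<open>For s < c the shell lies in (k + s)Q, and k + s \<le> k (1 + c) when k \<ge> 1;
    from c on it is empty.\<close>
  define w where "w s = (1 + c) ^ CARD('n) * body.V * indicat_real {0..c} s" for s
  have iw: "integrable lborel w" unfolding w_def
    using emeasure_lborel_bounded_finite[of "{0..c}"]
    by (intro integrable_mult_right integrable_real_indicator) auto
  have bound: "norm (?F k s) \<le> w s" for k s
  proof (cases "0 < s \<and> s < c")
    case True
    have "measure lborel (body.shell (Suc k) s) \<le> (real (Suc k) + s) ^ CARD('n) * body.V"
      using True by (intro body.measure_shell_le) simp
    also have "\<dots> \<le> (real (Suc k) * (1 + c)) ^ CARD('n) * body.V"
    proof (intro mult_right_mono power_mono)
      have "0 \<le> c * real k" by (simp add: c_def)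
      moreover have "real (Suc k) * (1 + c) = real (Suc k) + c + c * real k" by (simp add: algebra_simps)
      ultimately show "real (Suc k) + s \<le> real (Suc k) * (1 + c)" using True by linarith
    qed (use True body.V_pos in auto)
    finally have "measure lborel (body.shell (Suc k) s) \<le> (1 + c) ^ CARD('n) * body.V * real (Suc k) ^ CARD('n)"
      by (simp add: power_mult_distrib mult_ac)
    then show ?thesis using True by (simp add: w_def divide_le_eq)
  next
    case False
    have w0: "0 \<le> w s" using body.V_pos by (simp add: w_def c_def)
    have F0: "?F k s = 0"
    proof (cases "s > 0")
      case True
      with False have "body.shell (Suc k) s = {}" by (intro shell_empty) (auto simp: c_def)
      then show ?thesis by simp
    qed simp
    show ?thesis unfolding F0 using w0 by simp
  qed
  have ih: "integrable lborel ?h"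
    by (rule integrable_dominated_convergence[OF mh mF iw]) (rule AE_I2, rule lim, rule AE_I2, rule bound)
  have "(\<lambda>s. indicat_real {0<..} s * body.gap s) = (\<lambda>s. (1 / body.V) * ?h s)"
    using body.V_pos by (simp add: fun_eq_iff)
  then show "integrable lborel (\<lambda>s. indicat_real {0<..} s * body.gap s)"
    using integrable_mult_right[OF ih, of "1 / body.V"] by simp
  have "(\<lambda>k. integral\<^sup>L lborel (?F k)) \<longlonglongrightarrow> integral\<^sup>L lborel ?h"
    by (rule integral_dominated_convergence[OF mh mF iw]) (rule AE_I2, rule lim, rule AE_I2, rule bound)
  moreover have "integral\<^sup>L lborel ?h = body.V * integral\<^sup>L lborel (\<lambda>s. indicat_real {0<..} s * body.gap s)"
    by (subst integral_mult_right_zero[symmetric]) (simp add: mult_ac)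
  ultimately have "(\<lambda>k. integral\<^sup>L lborel (\<lambda>s. indicat_real {0<..} s * measure lborel (body.shell (Suc k) s)) / real (Suc k) ^ CARD('n))
      \<longlonglongrightarrow> body.V * integral\<^sup>L lborel (\<lambda>s. indicat_real {0<..} s * body.gap s)"
    by simp
  then show "(\<lambda>k. integral\<^sup>L lborel (\<lambda>s. indicat_real {0<..} s * measure lborel (body.shell k s)) / real k ^ CARD('n))
      \<longlonglongrightarrow> body.V * integral\<^sup>L lborel (\<lambda>s. indicat_real {0<..} s * body.gap s)"
    by (rule LIMSEQ_imp_Suc)
qed

text \<open>The slice at height t has volume t^D V. Together with the factor d! this gives e_0 = D!
  V.\<close>

lemma measure_truncated_cone: "measure lborel (C \<inter> {y. snd y \<le> 1}) = body.V / (CARD('n) + 1)"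
proof -
  let ?C = "C \<inter> {y. snd y \<le> 1}"
  have half: "closed {y :: (real^'n) \<times> real. snd y \<le> 1}" by (intro closed_Collect_le continuous_intros)
  have s: "?C \<in> sets borel" using closed_hom_cone[OF compact] half by auto
  have "bounded ?C"
  proof -
    have "norm y \<le> body.B + 1" if "y \<in> ?C" for y
    proof -
      obtain x t where xt: "y = (x, t)" by (cases y)
      with that have t: "0 \<le> t" "t \<le> 1" "x \<in> dilate t Q" by (auto simp: mem_hom_cone)
      then have "norm x \<le> t * body.B" by (intro body.norm_dilate)
      also have "\<dots> \<le> 1 * body.B" using t body.B_nonneg by (intro mult_right_mono) auto
      finally have "norm x \<le> body.B" by simp
      moreover have "norm y \<le> norm x + norm t" unfolding xt by (rule norm_Pair_le)
      ultimately show ?thesis using t by simp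
    qed
    then show ?thesis unfolding bounded_iff by blast
  qed
  then have f: "emeasure lborel ?C < \<infinity>" by (rule emeasure_lborel_bounded_finite)
  have "measure lborel {x. (x, t) \<in> ?C} = body.V * (t ^ CARD('n) * indicat_real {0..1} t)" for t
  proof (cases "0 \<le> t \<and> t \<le> 1")
    case True
    then have "{x. (x, t) \<in> ?C} = dilate t Q" by (auto simp: mem_hom_cone)
    then show ?thesis using True body.measure_dilate[of t] by (simp add: mult.commute)
  next
    case False
    then have e: "{x. (x, t) \<in> ?C} = {}" by (auto simp: mem_hom_cone)
    show ?thesis unfolding e using False by (simp add: indicator_def)
  qed
  then have "measure lborel ?C = body.V * integral\<^sup>L lborel (\<lambda>t. t ^ CARD('n) * indicat_real {0..1} t)"
    unfolding measure_eq_integral_slices(1)[OF s f] by simp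
  also have "integral\<^sup>L lborel (\<lambda>t::real. t ^ CARD('n) * indicat_real {0..1} t) = 1 / (CARD('n) + 1)"
    using integral_power[of 0 1 "CARD('n)"] by (simp add: add.commute)
  finally show ?thesis by simp
qed

end

section \<open>The tiling criterion\<close>

context convex_body
begin

definition gap_integral :: real where
  "gap_integral = integral\<^sup>L lborel (\<lambda>s. indicat_real {0<..} s * gap s)"

text \<open>The scale at which sQ has volume 1, hence the only one at which Q can tile.\<close>

definition tile_scale :: real where
  "tile_scale = V powr (- 1 / CARD('n))"

lemma tile_scale_pos: "tile_scale > 0"
  using V_pos by (simp add: tile_scale_def)

lemma tile_scale_power: "tile_scale ^ CARD('n) * V = 1"
proof -
  have "tile_scale ^ CARD('n) = tile_scale powr CARD('n)"
    using tile_scale_pos by (simp add: powr_realpow)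
  also have "\<dots> = V powr (- 1)" by (simp add: tile_scale_def powr_powr)
  finally show ?thesis using V_pos by (simp add: powr_minus)
qed

lemma power_le_iff_tile_scale:
  assumes "s > 0"
  shows "1 \<le> s ^ CARD('n) * V \<longleftrightarrow> tile_scale \<le> s"
proof -
  have "1 \<le> s ^ CARD('n) * V \<longleftrightarrow> tile_scale ^ CARD('n) * V \<le> s ^ CARD('n) * V" by (simp add: tile_scale_power)
  also have "\<dots> \<longleftrightarrow> tile_scale ^ CARD('n) \<le> s ^ CARD('n)" using V_pos by simp
  also have "\<dots> \<longleftrightarrow> tile_scale \<le> s" using assms tile_scale_pos by (simp add: power_mono_iff)
  finally show ?thesis .
qed

text \<open>The integrand vanishes beyond \<tau> = \<open>tile_scale\<close>. On [0, \<tau>] its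
  integral is \<tau> - V \<tau>^(D+1) / (D+1), and V \<tau>^D = 1 turns this into \<tau> D / (D+1),
  the source of the constant (d-1)/d.\<close>

lemma has_bochner_integral_gap_bound:
  "has_bochner_integral lborel (\<lambda>s. indicat_real {0<..} s * max 0 (1 - s ^ CARD('n) * V))
     (tile_scale * (CARD('n) / (CARD('n) + 1)))"
proof -
  let ?D = "CARD('n)"
  \<comment> \<open>The constant 1 is written \<open>s ^ 0\<close> so that one integral formula
    serves both terms.\<close>
  let ?g = "\<lambda>s. s ^ 0 * indicat_real {0..tile_scale} s - V * (s ^ ?D * indicat_real {0..tile_scale} s)"
  have s0: "0 \<le> tile_scale" using tile_scale_pos by simp
  have P: "has_bochner_integral lborel (\<lambda>s. s ^ k * indicat_real {0..tile_scale} s)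
      ((tile_scale ^ Suc k - 0 ^ Suc k) / Suc k)" for k
    unfolding has_bochner_integral_iff using s0
    by (intro conjI integral_power borel_integrable_atLeastAtMost) (auto intro!: continuous_intros)
  have h: "has_bochner_integral lborel ?g
      ((tile_scale ^ Suc 0 - 0 ^ Suc 0) / Suc 0 - V * ((tile_scale ^ Suc ?D - 0 ^ Suc ?D) / Suc ?D))"
    by (intro has_bochner_integral_diff has_bochner_integral_mult_right P)
  have "V * (tile_scale ^ Suc ?D - 0 ^ Suc ?D) = tile_scale"
    using tile_scale_power by (simp add: algebra_simps)
  then have e: "V * ((tile_scale ^ Suc ?D - 0 ^ Suc ?D) / Suc ?D) = tile_scale / (?D + 1)"
    unfolding times_divide_eq_right by (simp only: Suc_eq_plus1)
  from h have "has_bochner_integral lborel ?g (tile_scale - tile_scale / (?D + 1))" unfolding e by simp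
  moreover have "tile_scale - tile_scale / (?D + 1) = tile_scale * (?D / (?D + 1))" by (simp add: field_simps)
  ultimately have g: "has_bochner_integral lborel ?g (tile_scale * (?D / (?D + 1)))" by simp
  have "AE s in lborel. ?g s = indicat_real {0<..} s * max 0 (1 - s ^ ?D * V)"
    using AE_lborel_singleton[of 0]
  proof eventually_elim
    case (elim s)
    show ?case
    proof (cases "s > 0")
      case True
      then show ?thesis
        using power_le_iff_tile_scale[OF True] tile_scale_power
        by (auto simp: indicator_def max_def algebra_simps)
    qed (use elim in \<open>auto simp: indicator_def\<close>)
  qed
  then show ?thesis
    using g by (subst (asm) has_bochner_integral_cong_AE) auto
qed

lemma tiles_imp_tiles_at_scale: "tiles Q \<Longrightarrow> tiles_at Q tile_scale"
proof -
  assume "tiles Q"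
  then obtain l where l: "l > 0" "tiles_at Q l" by (auto simp: tiles_def)
  then have "l ^ CARD('n) * V = 1" using tiles_at_imp(2) by blast
  then have "l ^ CARD('n) = tile_scale ^ CARD('n)" using tile_scale_power V_pos
    by (metis less_irrefl mult_right_cancel)
  then have "l = tile_scale" using l(1) tile_scale_pos
    by (metis less_imp_le power_eq_imp_eq_base zero_less_card_finite)
  with l show ?thesis by simp
qed

text \<open>Translates of \<open>sQ\<close> leave at least the proportion \<open>1 - s\<^sup>D V\<close> of space uncovered, so the integral of
  the gap has a lower bound, attained exactly when at the critical scale nothing is uncovered.\<close>

lemma tiles_iff_gap_integral:
  assumes int: "integrable lborel (\<lambda>s. indicat_real {0<..} s * gap s)"
  shows "tiles Q \<longleftrightarrow> gap_integral = tile_scale * (CARD('n) / (CARD('n) + 1))"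
proof
  let ?m = "\<lambda>s. indicat_real {0<..} s * max 0 (1 - s ^ CARD('n) * V)"
  have m: "integral\<^sup>L lborel ?m = tile_scale * (CARD('n) / (CARD('n) + 1))"
    using has_bochner_integral_gap_bound by (rule has_bochner_integral_integral_eq)
  have im: "integrable lborel ?m"
    using has_bochner_integral_gap_bound unfolding has_bochner_integral_iff by blast
  show "gap_integral = tile_scale * (CARD('n) / (CARD('n) + 1))" if "tiles Q"
  proof -
    have "indicat_real {0<..} s * gap s = ?m s" for s
      using tiles_at_imp(1)[OF tiles_imp_tiles_at_scale[OF that], of s] by (simp add: indicator_def)
    then have eq: "(\<lambda>s. indicat_real {0<..} s * gap s) = ?m" by (rule ext)
    show ?thesis unfolding gap_integral_def eq by (rule m)
  qed
  assume eq: "gap_integral = tile_scale * (CARD('n) / (CARD('n) + 1))"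
  have "integral\<^sup>L lborel (\<lambda>s. indicat_real {0<..} s * gap s - ?m s) = 0"
    using Bochner_Integration.integral_diff[OF int im] eq m by (simp add: gap_integral_def)
  moreover have "AE s in lborel. 0 \<le> indicat_real {0<..} s * gap s - ?m s"
    using gap_ge by (intro AE_I2) (simp add: indicator_def)
  ultimately have ae: "AE s in lborel. indicat_real {0<..} s * gap s - ?m s = 0"
    using integral_nonneg_eq_0_iff_AE[OF Bochner_Integration.integrable_diff[OF int im]] by blast
  \<comment> \<open>Equality of integrands is known only for almost every s, so the critical scale
    is approached from above, where the lower bound for the gap is 0.\<close>
  have "\<exists>r. tile_scale < r \<and> r < tile_scale + 1 / Suc i \<and> gap r = 0" for i
  proof (rule ccontr)
    assume n: "\<not> ?thesis"
    have "AE s in lborel. s \<notin> {tile_scale<..<tile_scale + 1 / Suc i}"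
      using ae
    proof eventually_elim
      case (elim s)
      show ?case
      proof
        assume s: "s \<in> {tile_scale<..<tile_scale + 1 / Suc i}"
        then have "s > 0" "1 \<le> s ^ CARD('n) * V"
          using tile_scale_pos power_le_iff_tile_scale[of s] by auto
        with elim have "gap s = 0" by (simp add: max_def split: if_splits)
        with n s show False by auto
      qed
    qed
    then have "{tile_scale<..<tile_scale + 1 / Suc i} \<in> null_sets lborel"
      by (subst AE_iff_null_sets) auto
    then show False by (simp add: null_sets_def)
  qed
  then obtain r where r: "\<And>i. tile_scale < r i" "\<And>i. r i < tile_scale + 1 / Suc i" "\<And>i. gap (r i) = 0" by metis
  have "r \<longlonglongrightarrow> tile_scale"
  proof (rule tendsto_sandwich[of "\<lambda>_. tile_scale" _ _ "\<lambda>i. tile_scale + 1 / real (Suc i)"])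
    show "(\<lambda>i. tile_scale + 1 / real (Suc i)) \<longlonglongrightarrow> tile_scale"
      using tendsto_add[OF tendsto_const LIMSEQ_inverse_real_of_nat, of tile_scale]
      by (simp add: inverse_eq_divide)
    show "\<forall>\<^sub>F i in sequentially. tile_scale \<le> r i" "\<forall>\<^sub>F i in sequentially. r i \<le> tile_scale + 1 / real (Suc i)"
      using r(1,2) by (auto intro!: always_eventually less_imp_le)
  qed simp
  then have cov: "\<exists>v. x \<in> translate tile_scale v" for x using covered_limit r(3) by blast
  then have "uncovered tile_scale = {}" by (auto simp: uncovered_def)
  \<comment> \<open>At this scale sQ has volume 1, so \<open>gap_eq\<close> equates gap and
    overlap.\<close>
  then have "overlap tile_scale = 0"
    using gap_eq[of tile_scale] tile_scale_power tile_scale_pos by (simp add: gap_def)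
  then have "tiles_at Q tile_scale" using cov tile_scale_pos by (simp add: tiles_at_iff)
  then show "tiles Q" using tile_scale_pos by (auto simp: tiles_def)
qed

text \<open>The left side of the criterion without its factor ((d-1)!)^((2-d)/(d-1)), which depends
  on the dimension alone.\<close>

definition criterion_value :: real where
  "criterion_value = V powr (1 / CARD('n)) * gap_integral"

lemma tiles_iff_criterion_value:
  assumes "integrable lborel (\<lambda>s. indicat_real {0<..} s * gap s)"
  shows "tiles Q \<longleftrightarrow> criterion_value = CARD('n) / (CARD('n) + 1)"
proof -
  have "V powr (1 / CARD('n)) = 1 / tile_scale"
    using V_pos by (simp add: tile_scale_def powr_minus field_simps)
  then have c: "criterion_value = gap_integral / tile_scale" by (simp add: criterion_value_def)
  have "gap_integral = tile_scale * x \<longleftrightarrow> gap_integral / tile_scale = x" for x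
    using tile_scale_pos by (auto simp: divide_eq_eq mult.commute)
  then show ?thesis unfolding tiles_iff_gap_integral[OF assms] c .
qed

end

section \<open>Invariance under dilation, and the criterion for a single polytope\<close>

lemma dilate_dilate: "dilate a (dilate b Q) = dilate (a * b) Q"
  by (simp add: dilate_def image_image)

lemma tiles_dilate:
  assumes c: "c > 0"
  shows "tiles (dilate c Q) \<longleftrightarrow> tiles Q"
proof -
  have t: "tiles_at (dilate c Q) l \<longleftrightarrow> tiles_at Q (l * c)" if "l > 0" for l
    using that c by (simp add: tiles_at_def dilate_dilate)
  show ?thesis
  proof
    assume "tiles (dilate c Q)"
    then obtain l where "l > 0" "tiles_at (dilate c Q) l" by (auto simp: tiles_def)
    then show "tiles Q" using t c unfolding tiles_def by (metis mult_pos_pos)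
  next
    assume "tiles Q"
    then obtain l where l: "l > 0" "tiles_at Q l" by (auto simp: tiles_def)
    then have "tiles_at (dilate c Q) (l / c)" using t[of "l / c"] c by simp
    moreover have "l / c > 0" using l c by simp
    ultimately show "tiles (dilate c Q)" unfolding tiles_def by blast
  qed
qed

lemma convex_body_dilate:
  fixes Q :: "(real^'n) set"
  assumes "convex_body Q" and c: "c > 0"
  shows "convex_body (dilate c Q)"
proof -
  interpret convex_body Q by fact
  show ?thesis
  proof
    show "compact (dilate c Q)" "convex (dilate c Q)" by (rule compact_dilate convex_dilate)+
    have "interior (dilate c Q) = (*\<^sub>R) c ` interior Q"
      unfolding dilate_def using c by (intro interior_injective_linear_image) (auto simp: inj_def)
    then show "interior (dilate c Q) \<noteq> {}" using interior by simp
  qed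
qed

text \<open>Scaling Q by c rescales the parameter s and so divides \<open>gap_integral\<close> by c,
  while \<open>V powr (1 / CARD('n))\<close> is multiplied by c.\<close>

lemma criterion_value_dilate:
  fixes Q :: "(real^'n) set"
  assumes "convex_body Q" and c: "c > 0"
  shows "convex_body.criterion_value (dilate c Q) = convex_body.criterion_value Q"
proof -
  interpret convex_body Q by fact
  interpret c: convex_body "dilate c Q" by (rule convex_body_dilate[OF assms])
  have V: "c.V = c ^ CARD('n) * V"
    unfolding c.V_def using c by (intro measure_dilate) simp
  have "c.translate s v = translate (c * s) v" for s v
    using c by (simp add: translate_def c.translate_def mem_hom_cone_dilate)
  then have g: "c.gap s = gap (c * s)" for s by (simp add: gap_def c.gap_def uncovered_def c.uncovered_def)
  have "gap_integral = \<bar>c\<bar> *\<^sub>R integral\<^sup>L lborel (\<lambda>s. indicat_real {0<..} (0 + c * s) * gap (0 + c * s))"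
    unfolding gap_integral_def by (rule lborel_integral_real_affine) (use c in simp)
  also have "(\<lambda>s. indicat_real {0<..} (0 + c * s) * gap (0 + c * s)) = (\<lambda>s. indicat_real {0<..} s * c.gap s)"
    using c by (simp add: fun_eq_iff g indicator_def zero_less_mult_iff)
  finally have gi: "gap_integral = c * c.gap_integral" using c by (simp add: c.gap_integral_def)
  have "c.V powr (1 / CARD('n)) = (c powr CARD('n) * V) powr (1 / CARD('n))"
    using c by (simp add: V powr_realpow)
  also have "\<dots> = (c powr CARD('n)) powr (1 / CARD('n)) * V powr (1 / CARD('n))"
    by (rule powr_mult)
  also have "\<dots> = c * V powr (1 / CARD('n))" using c by (simp add: powr_powr)
  finally show ?thesis by (simp add: c.criterion_value_def criterion_value_def gi)
qed

context spanning_polytope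
begin

lemma
  fixes K :: "'k::field itself" and F :: "(real^'n) set set"
  assumes FQ: "div_polytope F a = Q" and p: "CHAR('k) > 0" and d: "d = CARD('n) + 1"
  shows convergent_multiplicities:
      "k \<ge> 1 \<Longrightarrow> convergent (e0_seq K F (div_mult k a)) \<and> convergent (eHK_seq K F (div_mult k a))"
    and convergent_criterion_seq: "convergent (criterion_seq K d F a)"
    and criterion_lhs_eq: "criterion_lhs K d F a =
      fact (d - 1) powr ((2 - real d) / (real d - 1)) * body.criterion_value"
proof -
  let ?D = "CARD('n)"
  have e0: "e0_seq K F (div_mult k a) \<longlonglongrightarrow> fact (?D + 1) * measure lborel (hom_cone (dilate (real k) Q) \<inter> {y. snd y \<le> 1})"
    and eHK: "eHK_seq K F (div_mult k a) \<longlonglongrightarrow> measure lborel (spanning_polytope.hk_region (dilate (real k) Q))"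
    if k: "k \<ge> 1" for k
  proof -
    interpret K: spanning_polytope "dilate (real k) Q"
      by (rule spanning_polytope_dilate[OF spanning_polytope_axioms k])
    have D: "div_polytope F (div_mult k a) = dilate (real k) Q" using div_polytope_mult[OF k] FQ by metis
    show "e0_seq K F (div_mult k a) \<longlonglongrightarrow> fact (?D + 1) * measure lborel (hom_cone (dilate (real k) Q) \<inter> {y. snd y \<le> 1})"
      "eHK_seq K F (div_mult k a) \<longlonglongrightarrow> measure lborel K.hk_region"
      by (rule K.e0_seq_tendsto[OF D p] K.eHK_seq_tendsto[OF D p])+
  qed
  show "convergent (e0_seq K F (div_mult k a)) \<and> convergent (eHK_seq K F (div_mult k a))" if "k \<ge> 1"
    using e0[OF that] eHK[OF that] by (auto simp: convergent_def)
  have cs: "criterion_seq K d F a k =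
      integral\<^sup>L lborel (\<lambda>s. indicat_real {0<..} s * measure lborel (body.shell k s)) / real k ^ ?D"
    if k: "k \<ge> 1" for k
  proof -
    \<comment> \<open>Division by d! turns e_0 into the volume of the truncated cone, the part of
      the region below height 1.\<close>
    have "fact d \<noteq> (0::real)" by simp
    then have "criterion_seq K d F a k = (measure lborel (spanning_polytope.hk_region (dilate (real k) Q)) -
      measure lborel (hom_cone (dilate (real k) Q) \<inter> {y. snd y \<le> 1})) / real k ^ (d - 2)"
      unfolding criterion_seq_def e0_def eHK_def limI[OF e0[OF k]] limI[OF eHK[OF k]] d
      by (simp del: fact_Suc)
    also have "\<dots> = integral\<^sup>L lborel (\<lambda>s. indicat_real {0<..} s * measure lborel (body.shell k s)) / (real k * real k ^ (d - 2))"
      unfolding excess_eq_integral_shell(1)[OF k] by simp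
    \<comment> \<open>The factor 1/k from the substitution raises the normalising exponent d - 2 to
      D, the growth order of the shell volume.\<close>
    also have "real k * real k ^ (d - 2) = real k ^ Suc (d - 2)" by (rule power_Suc[symmetric])
    also have "Suc (d - 2) = ?D" using zero_less_card_finite[where 'a = 'n] by (simp add: d)
    finally show ?thesis .
  qed
  have lim: "criterion_seq K d F a \<longlonglongrightarrow> body.V * body.gap_integral"
    unfolding body.gap_integral_def
  proof (rule Lim_transform_eventually[OF integral_shell_limit])
    show "\<forall>\<^sub>F k in sequentially. integral\<^sup>L lborel (\<lambda>s. indicat_real {0<..} s * measure lborel (body.shell k s)) / real k ^ ?D
        = criterion_seq K d F a k"
      using eventually_ge_at_top[of 1] by eventually_elim (simp add: cs)
  qed
  then show "convergent (criterion_seq K d F a)" by (auto simp: convergent_def)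
  have "e0_seq K F a \<longlonglongrightarrow> fact (?D + 1) * (body.V / (?D + 1))"
    using e0_seq_tendsto[OF FQ p, of K] unfolding measure_truncated_cone .
  then have e0a: "e0 K F a = fact (?D + 1) * (body.V / (?D + 1))" unfolding e0_def by (rule limI)
  also have "\<dots> = fact ?D * body.V" by (simp add: field_simps)
  finally have e0a: "e0 K F a = fact ?D * body.V" .
  define e where "e = (2 - real d) / (real d - 1)"
  \<comment> \<open>With e_0 = D! V and limit V times \<open>gap_integral\<close>, the powers of V
    combine to the exponent 1/D, the scale-invariant one.\<close>
  have ee: "e + 1 = 1 / ?D" by (simp add: e_def d field_simps)
  have "criterion_lhs K d F a = (fact ?D * body.V) powr e * (body.V * body.gap_integral)"
    unfolding criterion_lhs_def e0a limI[OF lim] e_def ..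
  also have "\<dots> = fact ?D powr e * (body.V powr e * body.V powr 1 * body.gap_integral)"
    using body.V_pos by (simp add: powr_mult)
  also have "body.V powr e * body.V powr 1 = body.V powr (1 / ?D)"
    unfolding ee[symmetric] by (rule powr_add[symmetric])
  finally show "criterion_lhs K d F a = fact (d - 1) powr ((2 - real d) / (real d - 1)) * body.criterion_value"
    by (simp add: body.criterion_value_def e_def d)
qed

lemma tiles_iff_criterion_lhs:
  fixes K :: "'k::field itself" and F :: "(real^'n) set set"
  assumes FQ: "div_polytope F a = Q" and p: "CHAR('k) > 0" and d: "d = CARD('n) + 1"
  shows "tiles Q \<longleftrightarrow> criterion_lhs K d F a =
    ((real d - 1) / real d) * fact (d - 1) powr ((2 - real d) / (real d - 1))"
proof -
  define f :: real where "f = fact (d - 1) powr ((2 - real d) / (real d - 1))"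
  have "f \<noteq> 0" by (simp add: f_def)
  then have "x = y \<longleftrightarrow> f * x = y * f" for x y by (simp add: mult.commute)
  moreover have "(real d - 1) / real d = CARD('n) / (CARD('n) + 1)" by (simp add: d add.commute)
  ultimately show ?thesis
    unfolding criterion_lhs_eq[OF assms] body.tiles_iff_criterion_value[OF integrable_gap] f_def[symmetric]
    by (simp only:)
qed

end

section \<open>Very ample polytopes\<close>

lemma zero_mem_cone_over: "0 \<in> cone_over V"
  unfolding cone_over_def by (intro CollectI exI[of _ "\<lambda>_. 0"]) simp

lemma cone_over_add:
  assumes "x \<in> cone_over V" "y \<in> cone_over V"
  shows "x + y \<in> cone_over V"
proof -
  obtain a b where "\<forall>v. a v \<ge> 0" "x = (\<Sum>v\<in>V. a v *\<^sub>R rvec v)" "\<forall>v. b v \<ge> 0" "y = (\<Sum>v\<in>V. b v *\<^sub>R rvec v)"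
    using assms unfolding cone_over_def by blast
  then show ?thesis unfolding cone_over_def
    by (intro CollectI exI[of _ "\<lambda>v. a v + b v"]) (simp add: scaleR_add_left sum.distrib)
qed

lemma cone_over_scale:
  assumes "x \<in> cone_over V" "c \<ge> 0"
  shows "c *\<^sub>R x \<in> cone_over V"
proof -
  obtain a where "\<forall>v. a v \<ge> 0" "x = (\<Sum>v\<in>V. a v *\<^sub>R rvec v)"
    using assms unfolding cone_over_def by blast
  with assms(2) show ?thesis unfolding cone_over_def
    by (intro CollectI exI[of _ "\<lambda>v. c * a v"]) (simp add: scaleR_sum_right)
qed

lemma cone_over_sum: "(\<And>i. i \<in> I \<Longrightarrow> f i \<in> cone_over V) \<Longrightarrow> sum f I \<in> cone_over V"
  by (induction I rule: infinite_finite_induct) (auto intro: cone_over_add zero_mem_cone_over)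

lemma cone_over_base:
  assumes "finite V" "v \<in> V"
  shows "rvec v \<in> cone_over V"
proof -
  have "(\<Sum>u\<in>V. (if u = v then 1 else 0) *\<^sub>R rvec u) = (\<Sum>u\<in>V. if u = v then rvec u else 0)"
    by (rule sum.cong) auto
  also have "\<dots> = rvec v" using assms by simp
  finally show ?thesis unfolding cone_over_def
    by (intro CollectI exI[of _ "\<lambda>u. if u = v then 1 else 0"]) auto
qed

lemma cone_over_minimal:
  assumes "\<And>v. v \<in> V \<Longrightarrow> rvec v \<in> cone_over W"
  shows "cone_over V \<subseteq> cone_over W"
  using assms unfolding cone_over_def[of V] by (auto intro!: cone_over_sum cone_over_scale)

lemma convex_cone_over: "convex (cone_over V)"
  by (rule convexI) (auto intro: cone_over_add cone_over_scale)

text \<open>The remainders \<open>n x - \<Sum> \<lfloor>n c\<^sub>g\<rfloor> g\<close> stay bounded, so two of them agree, and the difference exhibits a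
  multiple of \<open>x\<close> as a nonnegative integer combination.\<close>

lemma cone_over_multiple:
  assumes fin: "finite G" and x: "rvec x \<in> cone_over G"
  shows "\<exists>N\<ge>1. int N *s x \<in> semigroup_gen G"
proof -
  obtain c where c: "\<forall>g. c g \<ge> 0" "rvec x = (\<Sum>g\<in>G. c g *\<^sub>R rvec g)"
    using x unfolding cone_over_def by blast
  define s where "s n = (\<Sum>g\<in>G. nmul (nat \<lfloor>real n * c g\<rfloor>) g)" for n
  define r where "r n = int n *s x - s n" for n
  define M where "M = (\<Sum>g\<in>G. norm (rvec g))"
  have "norm (rvec (r n)) \<le> M" for n
  proof -
    have "rvec (s n) = (\<Sum>g\<in>G. of_int \<lfloor>real n * c g\<rfloor> *\<^sub>R rvec g)"
      using c(1) by (simp add: s_def rvec_sum nmul_vec rvec_scale)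
    moreover have "rvec (int n *s x) = (\<Sum>g\<in>G. (real n * c g) *\<^sub>R rvec g)"
      by (simp add: rvec_scale c(2) scaleR_sum_right)
    ultimately have "rvec (r n) = (\<Sum>g\<in>G. frac (real n * c g) *\<^sub>R rvec g)"
      by (simp add: r_def rvec_diff frac_def scaleR_diff_left sum_subtractf)
    also have "norm \<dots> \<le> M" unfolding M_def
    proof (rule sum_norm_le)
      fix g
      have "\<bar>frac (real n * c g)\<bar> \<le> 1"
        using frac_ge_0[of "real n * c g"] frac_lt_1[of "real n * c g"] by linarith
      then show "norm (frac (real n * c g) *\<^sub>R rvec g) \<le> norm (rvec g)"
        by (simp add: mult_left_le_one_le)
    qed
    finally show ?thesis .
  qed
  then have "range r \<subseteq> {v. norm (rvec v - 0) \<le> M}" by auto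
  then have "finite (range r)" using finite_rvec_bounded finite_subset by blast
  then have "\<not> inj r" using finite_imageD infinite_UNIV_nat by blast
  then obtain a b where ab: "a < b" "r a = r b" by (metis injI nat_neq_iff)
  have "int (b - a) *s x = s b - s a"
    using ab by (simp add: r_def vec_eq_iff of_nat_diff algebra_simps)
  also have "\<dots> = (\<Sum>g\<in>G. nmul (nat \<lfloor>real b * c g\<rfloor> - nat \<lfloor>real a * c g\<rfloor>) g)"
  proof -
    have "nmul (nat \<lfloor>real b * c g\<rfloor>) g - nmul (nat \<lfloor>real a * c g\<rfloor>) g
        = nmul (nat \<lfloor>real b * c g\<rfloor> - nat \<lfloor>real a * c g\<rfloor>) g" for g
    proof -
      have "real a * c g \<le> real b * c g" using ab(1) c(1) by (intro mult_right_mono) auto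
      then have "nat \<lfloor>real a * c g\<rfloor> \<le> nat \<lfloor>real b * c g\<rfloor>" by (intro nat_mono floor_mono)
      then show ?thesis by (simp add: nmul_vec of_nat_diff vec_eq_iff algebra_simps)
    qed
    then show ?thesis by (simp add: s_def flip: sum_subtractf)
  qed
  also have "\<dots> \<in> semigroup_gen G" by (intro semigroup_gen_sum semigroup_gen_nmul semigroup_gen_base)
  finally show ?thesis using ab(1) by (intro exI[of _ "b - a"]) auto
qed

lemma saturated_cone_over:
  assumes "finite G" "saturated (semigroup_gen G)" "rvec x \<in> cone_over G"
  shows "x \<in> semigroup_gen G"
  using cone_over_multiple[OF assms(1,3)] assms(2) unfolding saturated_def by blast

text \<open>As 0 lies in Q, the weight missing to M can be put on the origin.\<close>

lemma sum_mem_dilate: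
  assumes Q: "convex Q" "0 \<in> Q" and T: "finite T" "\<And>v. v \<in> T \<Longrightarrow> f v \<in> Q" "\<And>v. v \<in> T \<Longrightarrow> t v \<ge> 0"
    and M: "sum t T \<le> M" "M \<ge> 0"
  shows "(\<Sum>v\<in>T. t v *\<^sub>R f v) \<in> dilate M Q"
proof (cases "sum t T = 0")
  case True
  then have "t v = 0" if "v \<in> T" for v using T(1,3) that by (simp add: sum_nonneg_eq_0_iff)
  then have "(\<Sum>v\<in>T. t v *\<^sub>R f v) = M *\<^sub>R 0" by simp
  then show ?thesis unfolding dilate_def using Q(2) by blast
next
  case False
  then have pos: "sum t T > 0" using T(3) by (simp add: sum_nonneg less_le)
  have "(\<Sum>v\<in>T. (t v / sum t T) *\<^sub>R f v) \<in> Q"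
    using T pos by (intro convex_sum Q) (auto simp flip: sum_divide_distrib)
  then have "(sum t T / M) *\<^sub>R (\<Sum>v\<in>T. (t v / sum t T) *\<^sub>R f v) + (1 - sum t T / M) *\<^sub>R 0 \<in> Q"
    using pos M Q(2) by (intro convexD[OF Q(1)]) (auto simp: divide_le_eq)
  moreover have "(\<Sum>v\<in>T. t v *\<^sub>R f v) = M *\<^sub>R ((sum t T / M) *\<^sub>R (\<Sum>v\<in>T. (t v / sum t T) *\<^sub>R f v) + (1 - sum t T / M) *\<^sub>R 0)"
    using pos M by (simp add: scaleR_sum_right)
  ultimately show ?thesis unfolding dilate_def by blast
qed

text \<open>Choose a representation of \<open>x\<close> with the largest coefficient sum: it lies on a face of the convex
  hull of the nonzero lattice points, hence involves at most \<open>D\<close> points by Caratheodory.  If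
  the fractional parts sum to more than \<open>D - 1\<close>, reflecting them yields a further lattice point which
  would increase the coefficient sum.\<close>

lemma cone_lattice_point_decomposition:
  fixes V :: "(int^'n) set"
  defines "Q \<equiv> convex hull (rvec ` V)"
  assumes fin: "finite V" and ext: "0 extreme_point_of Q" and x: "rvec x \<in> cone_over V"
  shows "x \<in> semigroup_gen (lattice_points Q \<union> lattice_points (dilate (real CARD('n) - 1) Q))"
proof (cases "x = 0")
  case True
  then show ?thesis by (simp add: semigroup_gen.zero)
next
  case False
  let ?D = "CARD('n)"
  have convQ: "convex Q" and compQ: "compact Q" and Q0: "0 \<in> Q"
    using fin ext by (auto simp: Q_def convex_convex_hull finite_imp_compact_convex_hull extreme_point_of_def)
  have VQ: "rvec v \<in> Q" if "v \<in> V" for v using that unfolding Q_def by (simp add: hull_inc)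
  define G where "G = lattice_points Q - {0}"
  obtain B where B: "\<And>y. y \<in> Q \<Longrightarrow> norm y \<le> B" using compQ compact_imp_bounded bounded_iff by metis
  have finG: "finite G"
    by (rule finite_subset[OF _ finite_rvec_bounded[of 0 B]]) (use B in \<open>auto simp: G_def lattice_points_def\<close>)
  define K where "K = convex hull (rvec ` G)"
  have compK: "compact K" and convK: "convex K"
    using finG by (auto simp: K_def convex_convex_hull finite_imp_compact_convex_hull)
  have GK: "rvec g \<in> K" if "g \<in> G" for g using that unfolding K_def by (simp add: hull_inc)
  \<comment> \<open>0 is an extreme point of Q, so Q without 0 is still convex and contains the hull
    of the nonzero lattice points.\<close>
  have K0: "0 \<notin> K"
  proof -
    have "K \<subseteq> Q - {0}" unfolding K_def
    proof (rule hull_minimal)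
      show "rvec ` G \<subseteq> Q - {0}" by (auto simp: G_def lattice_points_def) (metis rvec_inj rvec_zero)
      show "convex (Q - {0})" using ext convQ extreme_point_of_stillconvex by blast
    qed
    then show ?thesis by blast
  qed
  \<comment> \<open>r x lies in K when x has a representation with coefficient sum 1/r. The least
    such r, attained as R is closed and positive as K misses 0, belongs to the largest coefficient
    sum.\<close>
  define R where "R = {r. 0 \<le> r \<and> r *\<^sub>R rvec x \<in> K}"
  have R_sum: "inverse s \<in> R" if "finite T" "\<And>g. g \<in> T \<Longrightarrow> g \<in> G" "\<And>g. g \<in> T \<Longrightarrow> c g \<ge> 0"
    "s = sum c T" "s > 0" "rvec x = (\<Sum>g\<in>T. c g *\<^sub>R rvec g)" for c s T
  proof -
    have "(\<Sum>g\<in>T. (c g / s) *\<^sub>R rvec g) \<in> K"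
      using that GK by (intro convex_sum convK) (auto simp flip: sum_divide_distrib)
    moreover have "(\<Sum>g\<in>T. (c g / s) *\<^sub>R rvec g) = inverse s *\<^sub>R rvec x"
      unfolding that(6) by (simp add: scaleR_sum_right divide_inverse mult.commute)
    ultimately show ?thesis using that(5) by (simp add: R_def)
  qed
  have "R \<noteq> {}"
  proof -
    obtain c where c: "\<forall>v. c v \<ge> 0" "rvec x = (\<Sum>v\<in>V. c v *\<^sub>R rvec v)"
      using x unfolding cone_over_def by blast
    have e: "rvec x = (\<Sum>v\<in>V - {0}. c v *\<^sub>R rvec v)"
      unfolding c(2) using fin by (intro sum.mono_neutral_right) (auto simp: rvec_zero)
    have "sum c (V - {0}) \<noteq> 0"
    proof
      assume "sum c (V - {0}) = 0"
      then have "c v = 0" if "v \<in> V - {0}" for v using c(1) fin that by (simp add: sum_nonneg_eq_0_iff)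
      then have "rvec x = 0" unfolding e by simp
      then show False using False by (metis rvec_inj rvec_zero)
    qed
    then have pos: "sum c (V - {0}) > 0" using c(1) by (simp add: sum_nonneg less_le)
    have "inverse (sum c (V - {0})) \<in> R"
      by (rule R_sum[OF _ _ _ refl pos e]) (use fin c(1) VQ in \<open>auto simp: G_def lattice_points_def\<close>)
    then show ?thesis by blast
  qed
  moreover have "closed R"
  proof -
    have "closed ((\<lambda>r. r *\<^sub>R rvec x) -` K)"
      using compact_imp_closed[OF compK] by (intro continuous_closed_vimage) (auto intro!: continuous_intros)
    moreover have "R = {0..} \<inter> (\<lambda>r. r *\<^sub>R rvec x) -` K" by (auto simp: R_def)
    ultimately show ?thesis by (simp add: closed_Int)
  qed
  moreover have bddR: "bdd_below R" by (rule bdd_belowI[of _ 0]) (simp add: R_def)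
  ultimately have r0R: "Inf R \<in> R" by (intro closed_contains_Inf)
  define r0 where "r0 = Inf R"
  have r0: "0 < r0" "r0 *\<^sub>R rvec x \<in> K" using r0R K0 by (auto simp: r0_def R_def less_le)
  have r0_min: "r0 \<le> r" if "r \<in> R" for r unfolding r0_def using that bddR by (rule cInf_lower)
  \<comment> \<open>By minimality the half-open segment from 0 to r0 x avoids K. A hyperplane
    separating the two passes through r0 x and supports K there, which cuts out the face F.\<close>
  let ?seg = "(\<lambda>r. r *\<^sub>R rvec x) ` {0..<r0}"
  have "\<exists>a b. a \<noteq> 0 \<and> (\<forall>y\<in>?seg. inner a y \<le> b) \<and> (\<forall>y\<in>K. inner a y \<ge> b)"
  proof (rule separating_hyperplane_sets)
    show "convex ?seg" by (intro convex_linear_image linearI) (auto simp: algebra_simps)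
    show "?seg \<inter> K = {}" using r0_min by (force simp: R_def)
  qed (use r0 convK in auto)
  then obtain a b where ab0: "a \<noteq> 0" "\<forall>y\<in>?seg. a \<bullet> y \<le> b" "\<forall>y\<in>K. a \<bullet> y \<ge> b"
    by blast
  have ab: "a \<noteq> 0" "\<And>r. 0 \<le> r \<Longrightarrow> r < r0 \<Longrightarrow> a \<bullet> (r *\<^sub>R rvec x) \<le> b" "\<And>y. y \<in> K \<Longrightarrow> a \<bullet> y \<ge> b"
    using ab0 by auto
  have "a \<bullet> (r0 *\<^sub>R rvec x) \<le> b"
  proof (rule field_le_mult_one_interval)
    fix z :: real assume z: "0 < z" "z < 1"
    with r0 ab(2)[of "z * r0"] show "z * (a \<bullet> (r0 *\<^sub>R rvec x)) \<le> b" by (simp add: mult.assoc)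
  qed
  with ab(3)[OF r0(2)] have ay: "a \<bullet> (r0 *\<^sub>R rvec x) = b" by simp
  define F where "F = {g \<in> G. a \<bullet> rvec g = b}"
  have "r0 *\<^sub>R rvec x \<in> convex hull (rvec ` F)"
  proof -
    obtain u where u: "\<forall>v\<in>rvec ` G. 0 \<le> u v" "sum u (rvec ` G) = 1" "(\<Sum>v\<in>rvec ` G. u v *\<^sub>R v) = r0 *\<^sub>R rvec x"
      using r0(2) finG unfolding K_def by (auto simp: convex_hull_finite)
    have "(\<Sum>v\<in>rvec ` G. u v * (a \<bullet> v - b)) = 0"
      using ay u(2) unfolding u(3)[symmetric]
      by (simp add: inner_sum_right right_diff_distrib sum_subtractf flip: sum_distrib_right)
    moreover have "u v * (a \<bullet> v - b) \<ge> 0" if "v \<in> rvec ` G" for v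
      using that u(1) ab(3) GK by auto
    ultimately have "\<forall>v\<in>rvec ` G. u v * (a \<bullet> v - b) = 0"
      using finG by (subst (asm) sum_nonneg_eq_0_iff) auto
    then have z: "u v = 0" if "v \<in> rvec ` G - rvec ` F" for v
      using that by (auto simp: F_def)
    have FG: "rvec ` F \<subseteq> rvec ` G" by (auto simp: F_def)
    have s: "sum u (rvec ` F) = 1" "(\<Sum>v\<in>rvec ` F. u v *\<^sub>R v) = r0 *\<^sub>R rvec x"
      using sum.mono_neutral_left[OF finite_imageI[OF finG] FG, of u]
        sum.mono_neutral_left[OF finite_imageI[OF finG] FG, of "\<lambda>v. u v *\<^sub>R v"] z u by auto
    have finF: "finite (rvec ` F)" using finG by (simp add: F_def)
    have "\<forall>v\<in>rvec ` F. 0 \<le> u v" using u(1) FG by blast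
    then show ?thesis
      unfolding convex_hull_finite[OF finF] using s by (intro CollectI exI[of _ u] conjI)
  qed
  then obtain S u where S: "finite S" "S \<subseteq> rvec ` F" "card S \<le> aff_dim (rvec ` F) + 1"
    "\<forall>v\<in>S. 0 \<le> u v" "sum u S = 1" "(\<Sum>v\<in>S. u v *\<^sub>R v) = r0 *\<^sub>R rvec x"
    by (auto simp: convex_hull_caratheodory_aff_dim)
  have "aff_dim (rvec ` F) \<le> aff_dim {y. a \<bullet> y = b}" by (rule aff_dim_subset) (auto simp: F_def)
  also have "\<dots> = int ?D - 1" using ab(1) by (simp add: aff_dim_hyperplane)
  finally have cS: "card S \<le> ?D" using S(3) by simp
  define T where "T = {g \<in> F. rvec g \<in> S}"
  have ST: "S = rvec ` T" using S(2) by (auto simp: T_def)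
  have injT: "inj_on rvec T" by (simp add: inj_on_def rvec_inj)
  have finT: "finite T" using finG by (simp add: T_def F_def)
  have TG: "g \<in> G" if "g \<in> T" for g using that by (auto simp: T_def F_def)
  have TQ: "rvec g \<in> Q" if "g \<in> T" for g using TG[OF that] by (auto simp: G_def lattice_points_def)
  have cT: "card T \<le> ?D" using cS unfolding ST card_image[OF injT] .
  define c where "c g = u (rvec g) / r0" for g
  have c0: "c g \<ge> 0" if "g \<in> T" for g using that S(4) r0 by (auto simp: c_def T_def)
  have sc: "sum c T = inverse r0"
    using S(5) unfolding ST sum.reindex[OF injT] by (simp add: c_def inverse_eq_divide flip: sum_divide_distrib)
  have xc: "rvec x = (\<Sum>g\<in>T. c g *\<^sub>R rvec g)"
  proof -
    have "rvec x = inverse r0 *\<^sub>R (r0 *\<^sub>R rvec x)" using r0 by simp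
    also have "\<dots> = (\<Sum>g\<in>T. c g *\<^sub>R rvec g)"
      unfolding S(6)[symmetric] ST sum.reindex[OF injT]
      by (simp add: c_def scaleR_sum_right divide_inverse mult.commute)
    finally show ?thesis .
  qed
  define t where "t g = frac (c g)" for g
  have t: "0 \<le> t g" "t g < 1" for g by (simp_all add: t_def frac_lt_1)
  define s where "s = (\<Sum>g\<in>T. nmul (nat \<lfloor>c g\<rfloor>) g)"
  define y where "y = x - s"
  have "rvec s = (\<Sum>g\<in>T. of_int \<lfloor>c g\<rfloor> *\<^sub>R rvec g)"
    using c0 by (simp add: s_def rvec_sum nmul_vec rvec_scale cong: sum.cong)
  then have y: "rvec y = (\<Sum>g\<in>T. t g *\<^sub>R rvec g)"
    by (simp add: y_def rvec_diff xc t_def frac_def scaleR_diff_left sum_subtractf)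
  have "sum t T \<le> real ?D - 1"
  proof (rule ccontr)
    assume n: "\<not> sum t T \<le> real ?D - 1"
    have D1: "real ?D \<ge> 1" using zero_less_card_finite[where 'a = 'n] by linarith
    then have "T \<noteq> {}" using n by auto
    have "sum t T < sum (\<lambda>_. 1) T" using finT \<open>T \<noteq> {}\<close> t by (intro sum_strict_mono) auto
    then have card: "card T = ?D" using n cT by simp
    have tpos: "t g > 0" if "g \<in> T" for g
    proof (rule ccontr)
      assume "\<not> t g > 0"
      with t have "t g = 0" by (simp add: order_antisym_conv not_less)
      then have "sum t T = sum t (T - {g})" using finT that by (simp add: sum.remove)
      also have "\<dots> \<le> sum (\<lambda>_. 1) (T - {g})" using t by (intro sum_mono) (auto intro: less_imp_le)
      also have "\<dots> = real ?D - 1" using card that finT by (simp add: of_nat_diff)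
      finally show False using n by simp
    qed
    \<comment> \<open>The reflected point, with coefficients 1 - t g. Their total \<sigma> is below
      1 because D fractional parts sum to more than D - 1, so w is a lattice point of Q.\<close>
    define w where "w = (\<Sum>g\<in>T. g) - y"
    have w: "rvec w = (\<Sum>g\<in>T. (1 - t g) *\<^sub>R rvec g)"
      by (simp add: w_def rvec_diff rvec_sum y scaleR_diff_left sum_subtractf)
    define \<sigma> where "\<sigma> = (\<Sum>g\<in>T. 1 - t g)"
    have \<sigma>: "\<sigma> < 1" "\<sigma> > 0"
    proof -
      have "\<sigma> = real ?D - sum t T" by (simp add: \<sigma>_def sum_subtractf card)
      then show "\<sigma> < 1" using n by simp
      show "\<sigma> > 0" unfolding \<sigma>_def using finT \<open>T \<noteq> {}\<close> t by (intro sum_pos) auto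
    qed
    have "rvec w \<in> dilate 1 Q" unfolding w
      by (rule sum_mem_dilate[OF convQ Q0 finT TQ]) (use t \<sigma> in \<open>auto simp: \<sigma>_def less_imp_le\<close>)
    then have "w \<in> lattice_points Q" by (simp add: lattice_points_def dilate_def)
    moreover have "w \<noteq> 0"
    proof
      assume "w = 0"
      then have "0 = inverse \<sigma> *\<^sub>R (\<Sum>g\<in>T. (1 - t g) *\<^sub>R rvec g)" using w by (simp add: rvec_zero)
      also have "\<dots> = (\<Sum>g\<in>T. ((1 - t g) / \<sigma>) *\<^sub>R rvec g)"
        by (simp add: scaleR_sum_right divide_inverse mult.commute)
      also have "\<dots> \<in> K"
      proof (rule convex_sum[OF finT convK])
        show "(\<Sum>g\<in>T. (1 - t g) / \<sigma>) = 1"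
          using \<sigma>(2) unfolding sum_divide_distrib[symmetric] \<sigma>_def[symmetric] by simp
      qed (use t TG GK \<sigma> in \<open>auto intro: less_imp_le\<close>)
      finally show False using K0 by simp
    qed
    ultimately have wG: "w \<in> G" by (simp add: G_def)
    \<comment> \<open>Exchanging \<epsilon> times the representation of w for \<epsilon> w itself
      keeps all coefficients nonnegative and raises their sum by \<epsilon> (1 - \<sigma>), against
      maximality.\<close>
    define \<epsilon> where "\<epsilon> = Min (t ` T)"
    have \<epsilon>: "\<epsilon> > 0" "\<And>g. g \<in> T \<Longrightarrow> \<epsilon> \<le> t g"
      using finT \<open>T \<noteq> {}\<close> tpos by (auto simp: \<epsilon>_def)
    define e where "e g = c g - \<epsilon> * (1 - t g)" for g
    have e0: "e g \<ge> 0" if "g \<in> T" for g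
    proof -
      have "\<epsilon> * (1 - t g) \<le> \<epsilon> * 1" using \<epsilon>(1) t[of g] by (intro mult_left_mono) auto
      also have "\<dots> \<le> t g" using \<epsilon>(2)[OF that] by simp
      also have "t g \<le> c g" using c0[OF that] by (simp add: t_def frac_def)
      finally show ?thesis by (simp add: e_def)
    qed
    have xe: "rvec x = \<epsilon> *\<^sub>R rvec w + (\<Sum>g\<in>T. e g *\<^sub>R rvec g)"
      unfolding w xc e_def
      by (simp add: sum_subtractf scaleR_sum_right scaleR_diff_left scaleR_diff_right right_diff_distrib)
    define S' where "S' = \<epsilon> + sum e T"
    have S': "S' = sum c T + \<epsilon> * (1 - \<sigma>)"
      by (simp add: S'_def e_def sum_subtractf sum.distrib \<sigma>_def algebra_simps flip: sum_distrib_left)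
    have S'gt: "S' > sum c T" unfolding S' using \<epsilon>(1) \<sigma>(1) by simp
    moreover have cpos: "sum c T > 0" using sc r0 by simp
    ultimately have S'pos: "S' > 0" by simp
    have "inverse S' *\<^sub>R rvec x \<in> K"
    proof -
      have eq: "inverse S' *\<^sub>R rvec x = (\<epsilon> / S') *\<^sub>R rvec w + (\<Sum>g\<in>T. (e g / S') *\<^sub>R rvec g)"
        unfolding xe by (simp add: scaleR_add_right scaleR_sum_right divide_inverse mult.commute)
      \<comment> \<open>Indexing by \<open>option\<close> gives w a place of its own even if it
        occurs in T.\<close>
      define h where "h g = (if g = None then \<epsilon> / S' else e (the g) / S')" for g
      define f where "f g = (if g = None then rvec w else rvec (the g))" for g
      have "(\<Sum>g\<in>insert None (Some ` T). h g *\<^sub>R f g) \<in> K"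
      proof (rule convex_sum)
        show "sum h (insert None (Some ` T)) = 1"
          using finT S'pos by (simp add: h_def sum.reindex S'_def flip: sum_divide_distrib add_divide_distrib)
      qed (use finT convK \<epsilon> e0 S'pos GK wG TG in \<open>auto simp: h_def f_def\<close>)
      then show ?thesis unfolding eq using finT by (simp add: h_def f_def sum.reindex)
    qed
    then have "inverse S' \<in> R" using S'pos by (simp add: R_def)
    then have "r0 \<le> inverse S'" by (rule r0_min)
    moreover have "inverse S' < inverse (sum c T)" using S'gt cpos by simp
    ultimately show False by (simp add: sc)
  qed
  then have "rvec y \<in> dilate (real ?D - 1) Q" unfolding y
    by (intro sum_mem_dilate[OF convQ Q0 finT TQ])
      (use t zero_less_card_finite[where 'a = 'n] in \<open>auto simp: Suc_le_eq\<close>)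
  then have "y \<in> lattice_points (dilate (real ?D - 1) Q)" by (simp add: lattice_points_def)
  moreover have "s \<in> semigroup_gen (lattice_points Q \<union> lattice_points (dilate (real ?D - 1) Q))"
    unfolding s_def using TG by (intro semigroup_gen_sum semigroup_gen_nmul semigroup_gen_base) (auto simp: G_def)
  moreover have "x = y + s" by (simp add: y_def)
  ultimately show ?thesis by (auto intro: semigroup_gen.add)
qed

text \<open>Moved so that the vertex belonging to w becomes the origin, kP turns into a polytope Q
  spanning the same cone as mP - w. Lattice points of this cone are sums of lattice points of Q and
  (D - 1)Q, and both fit into mP - w because k and (D - 1) k are at most m.\<close>

lemma very_ample_dilate:
  fixes P :: "(real^'n) set"
  assumes conv: "convex P" and m: "m \<ge> 1" and n1: "n1 \<ge> 1"
    and l1: "lattice_polytope (dilate (real n1) P)" and lm: "lattice_polytope (dilate (real m) P)"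
    and ge: "m \<ge> (CARD('n) - 1) * n1"
  shows "very_ample_polytope (dilate (real m) P)"
proof -
  let ?D = "CARD('n)"
  have D: "?D \<ge> 1" using zero_less_card_finite[where 'a = 'n] by linarith
  \<comment> \<open>In dimension 1 the bound on m is void and n1 may exceed m; m itself is then
    taken as the integral multiple.\<close>
  define k where "k = (if ?D = 1 then m else n1)"
  have k: "k \<ge> 1" "k \<le> m" "(?D - 1) * k \<le> m" "lattice_polytope (dilate (real k) P)"
  proof -
    show "k \<ge> 1" "lattice_polytope (dilate (real k) P)" using m n1 l1 lm by (auto simp: k_def)
    show "(?D - 1) * k \<le> m" using ge by (auto simp: k_def)
    show "k \<le> m"
    proof (cases "?D = 1")
      case False
      with D have "1 \<le> ?D - 1" by linarith
      then have "1 * n1 \<le> (?D - 1) * n1" by (intro mult_right_mono) auto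
      from order_trans[OF this ge] show ?thesis using False by (simp add: k_def)
    qed (simp add: k_def)
  qed
  obtain V where V: "finite V" "dilate (real k) P = convex hull (rvec ` V)"
    using k(4) by (auto simp: lattice_polytope_def)
  have "saturated (semigroup_gen ((\<lambda>u. u - w) ` lattice_points (dilate (real m) P)))"
    if w: "rvec w extreme_point_of dilate (real m) P" for w
  proof -
    \<comment> \<open>Dilates share their vertices up to scale, so w comes from a vertex w' of P,
      and k w' is a lattice vertex of kP.\<close>
    define w' where "w' = rvec w /\<^sub>R real m"
    have mw: "rvec w = real m *\<^sub>R w'" using m by (simp add: w'_def)
    have lin: "linear ((*\<^sub>R) c :: real^'n \<Rightarrow> real^'n)" for c by (simp add: linear_iff scaleR_add_right)
    have ext: "real c *\<^sub>R w' extreme_point_of dilate (real c) P \<longleftrightarrow> w' extreme_point_of P" if "c \<ge> 1" for c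
    proof -
      have "inj ((*\<^sub>R) (real c) :: real^'n \<Rightarrow> real^'n)" using that by (auto simp: inj_def)
      from face_of_linear_image[OF lin this, of "{w'}" P] show ?thesis
        by (simp add: dilate_def face_of_singleton)
    qed
    have w'P: "w' extreme_point_of P" using w ext[OF m] by (simp add: mw)
    then have "w' \<in> P" by (simp add: extreme_point_of_def)
    have kw: "real k *\<^sub>R w' extreme_point_of dilate (real k) P" using w'P ext[OF k(1)] by simp
    then have "real k *\<^sub>R w' \<in> rvec ` V" unfolding V(2) by (rule extreme_point_of_convex_hull)
    then obtain w1 where w1: "w1 \<in> V" "rvec w1 = real k *\<^sub>R w'" by auto
    define V' where "V' = (\<lambda>v. v - w1) ` V"
    define Q where "Q = convex hull (rvec ` V')"
    have "rvec ` V' = (+) (- rvec w1) ` (rvec ` V)" by (simp add: V'_def image_image rvec_diff)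
    then have Q: "Q = (+) (- rvec w1) ` dilate (real k) P"
      unfolding Q_def V(2) by (simp only: convex_hull_translation)
    have finV': "finite V'" using V(1) by (simp add: V'_def)
    have memQ: "y \<in> Q \<longleftrightarrow> (\<exists>p\<in>P. y = real k *\<^sub>R (p - w'))" for y
      unfolding Q dilate_def image_image w1(2) by (auto simp: algebra_simps)
    have "(+) (- rvec w1) (rvec w1) extreme_point_of Q"
      unfolding Q extreme_point_of_translation_eq using kw by (simp add: w1(2))
    then have Q0: "0 extreme_point_of Q" by simp
    let ?S = "semigroup_gen ((\<lambda>u. u - w) ` lattice_points (dilate (real m) P))"
    have sub: "g \<in> (\<lambda>u. u - w) ` lattice_points (dilate (real m) P)"
      if g: "rvec g \<in> dilate c Q" and c: "0 \<le> c" "c * real k \<le> real m" for g c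
    proof -
      obtain p where p: "p \<in> P" "rvec g = c *\<^sub>R real k *\<^sub>R (p - w')" using g by (auto simp: dilate_def memQ)
      \<comment> \<open>c k (p - w') + m w' is m times the convex combination of p and w' with
        weight c k / m on p.\<close>
      define a where "a = c * real k / real m"
      have a: "0 \<le> a" "a \<le> 1" "real m * a = c * real k" using c m by (auto simp: a_def divide_le_eq)
      have "a *\<^sub>R p + (1 - a) *\<^sub>R w' \<in> P" using a p \<open>w' \<in> P\<close> by (intro convexD[OF conv]) auto
      moreover have "rvec (g + w) = real m *\<^sub>R (a *\<^sub>R p + (1 - a) *\<^sub>R w')"
      proof -
        have "real m *\<^sub>R (a *\<^sub>R p + (1 - a) *\<^sub>R w') = (real m * a) *\<^sub>R (p - w') + real m *\<^sub>R w'"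
          by (simp add: algebra_simps)
        then show ?thesis by (simp add: rvec_add p(2) mw a(3))
      qed
      ultimately have "g + w \<in> lattice_points (dilate (real m) P)"
        unfolding lattice_points_def dilate_def by blast
      then show ?thesis by (intro image_eqI[of _ _ "g + w"]) auto
    qed
    have gens: "lattice_points Q \<union> lattice_points (dilate (real ?D - 1) Q) \<subseteq> (\<lambda>u. u - w) ` lattice_points (dilate (real m) P)"
    proof -
      have "(real ?D - 1) * real k = real ((?D - 1) * k)" using D by (simp add: of_nat_diff)
      also have "\<dots> \<le> real m" using k(3) by linarith
      finally have "lattice_points (dilate (real ?D - 1) Q) \<subseteq> (\<lambda>u. u - w) ` lattice_points (dilate (real m) P)"
        using sub[of _ "real ?D - 1"] D by (auto simp: lattice_points_def)
      moreover have "lattice_points Q \<subseteq> (\<lambda>u. u - w) ` lattice_points (dilate (real m) P)"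
        using sub[of _ 1] k(2) by (auto simp: lattice_points_def dilate_def)
      ultimately show ?thesis by blast
    qed
    have cone: "rvec y \<in> cone_over V'" if "y \<in> ?S" for y
      using that
    proof induction
      case zero
      then show ?case by (simp add: rvec_zero zero_mem_cone_over)
    next
      case (add g y)
      then obtain u where u: "rvec u \<in> dilate (real m) P" "g = u - w" by (auto simp: lattice_points_def)
      then obtain p where p: "p \<in> P" "rvec u = real m *\<^sub>R p" by (auto simp: dilate_def)
      have "Q \<subseteq> cone_over V'"
        unfolding Q_def using cone_over_base[OF finV'] by (intro hull_minimal convex_cone_over) auto
      then have "real k *\<^sub>R (p - w') \<in> cone_over V'" using memQ p(1) by blast
      then have "(real m / real k) *\<^sub>R real k *\<^sub>R (p - w') \<in> cone_over V'" by (rule cone_over_scale) simp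
      moreover have "(real m / real k) *\<^sub>R real k *\<^sub>R (p - w') = rvec g"
        using k(1) by (simp add: u rvec_diff p mw algebra_simps)
      ultimately show ?case using add.IH by (simp add: rvec_add cone_over_add)
    qed
    show ?thesis
      unfolding saturated_def
    proof (intro allI impI, elim conjE)
      fix x and j :: nat
      assume j: "j \<ge> 1" "int j *s x \<in> ?S"
      have "real j *\<^sub>R rvec x \<in> cone_over V'" using cone[OF j(2)] by (simp add: rvec_scale)
      then have "inverse (real j) *\<^sub>R real j *\<^sub>R rvec x \<in> cone_over V'" by (rule cone_over_scale) simp
      then have "rvec x \<in> cone_over V'" using j(1) by simp
      then have "x \<in> semigroup_gen (lattice_points Q \<union> lattice_points (dilate (real ?D - 1) Q))"
        unfolding Q_def using finV' Q0 by (intro cone_lattice_point_decomposition) (auto simp: Q_def)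
      then show "x \<in> ?S" using semigroup_gen_mono[OF gens] by blast
    qed
  qed
  then show ?thesis using lm by (simp add: very_ample_polytope_def)
qed

section \<open>Very ample multiples of rational polytopes\<close>

lemma common_denominator:
  assumes "finite A" "\<And>x. x \<in> A \<Longrightarrow> x \<in> \<rat>"
  shows "\<exists>n\<ge>1. \<forall>x\<in>A. real n * x \<in> \<int>"
  using assms
proof (induction A)
  case empty
  then show ?case by (intro exI[of _ 1]) auto
next
  case (insert a A)
  then obtain n where n: "n \<ge> 1" "\<forall>x\<in>A. real n * x \<in> \<int>" by auto
  from insert.prems obtain p q where pq: "q > 0" "a = of_int p / of_int q"
    by (metis Rats_cases' insertI1)
  have "real (nat q) * a = of_int p" using pq by simp
  then have qa: "real (nat q) * a \<in> \<int>" by simp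
  have "\<forall>x\<in>insert a A. real (n * nat q) * x \<in> \<int>"
  proof
    fix x assume "x \<in> insert a A"
    then consider "x = a" | "x \<in> A" by blast
    then show "real (n * nat q) * x \<in> \<int>"
    proof cases
      case 1
      have "real (n * nat q) * x = real n * (real (nat q) * a)" by (simp add: 1)
      then show ?thesis using qa by (simp only: Ints_mult Ints_of_nat)
    next
      case 2
      have "real (n * nat q) * x = real (nat q) * (real n * x)" by simp
      then show ?thesis using n 2 by (simp only: Ints_mult Ints_of_nat)
    qed
  qed
  moreover have "n * nat q \<ge> 1" using n pq by (simp add: Suc_le_eq)
  ultimately show ?case by blast
qed

lemma rational_polytope_lattice_multiple:
  fixes P :: "(real^'n) set"
  assumes "rational_polytope P"
  shows "\<exists>n\<ge>1. lattice_polytope (dilate (real n) P)"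
proof -
  obtain V where V: "finite V" "\<forall>v\<in>V. \<forall>i. v $ i \<in> \<rat>" "P = convex hull V"
    using assms by (auto simp: rational_polytope_def)
  have "finite (\<Union>v\<in>V. range (\<lambda>i. v $ i))" using V(1) by simp
  then obtain n where n: "n \<ge> 1" "\<forall>x\<in>(\<Union>v\<in>V. range (\<lambda>i. v $ i)). real n * x \<in> \<int>"
    using common_denominator[of "\<Union>v\<in>V. range (\<lambda>i. v $ i)"] V(2) by auto
  define W where "W = (\<lambda>v. \<chi> i. \<lfloor>real n * v $ i\<rfloor>) ` V"
  have "rvec (\<chi> i. \<lfloor>real n * v $ i\<rfloor>) = real n *\<^sub>R v" if "v \<in> V" for v
    using n(2) that by (auto simp: rvec_def vec_eq_iff)
  then have "rvec ` W = (*\<^sub>R) (real n) ` V" by (force simp: W_def image_image)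
  then have "dilate (real n) P = convex hull (rvec ` W)"
    unfolding V(3) dilate_def by (simp add: convex_hull_scaling)
  then show ?thesis using n(1) V(1) unfolding lattice_polytope_def W_def by blast
qed

lemma very_ample_multiples_exist:
  fixes P :: "(real^'n) set"
  assumes "rational_polytope P"
  shows "\<exists>m\<ge>n. m \<ge> 1 \<and> very_ample_polytope (dilate (real m) P)"
proof -
  obtain n1 where n1: "n1 \<ge> 1" "lattice_polytope (dilate (real n1) P)"
    using rational_polytope_lattice_multiple[OF assms] by blast
  have conv: "convex P" using assms by (auto simp: rational_polytope_def convex_convex_hull)
  define j where "j = n + CARD('n)"
  have j: "j \<ge> 1" "j \<ge> n" "j \<ge> CARD('n) - 1"
    using zero_less_card_finite[where 'a = 'n] unfolding j_def by linarith+
  have m: "j * n1 \<ge> j" using n1 by simp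
  have "lattice_polytope (dilate (real j) (dilate (real n1) P))"
    by (rule lattice_polytope_dilate[OF n1(2)])
  then have "lattice_polytope (dilate (real (j * n1)) P)" by (simp add: dilate_dilate)
  then have "very_ample_polytope (dilate (real (j * n1)) P)"
    using conv n1 j m by (intro very_ample_dilate[of P "j * n1" n1]) (auto intro: mult_right_mono)
  then show ?thesis using order_trans[OF j(1) m] order_trans[OF j(2) m] by blast
qed

section \<open>Very ample polytopes generate the lattice\<close>

lemma lattice_vertex_exists:
  fixes Q :: "(real^'n) set"
  assumes "lattice_polytope Q" "Q \<noteq> {}"
  obtains w where "rvec w extreme_point_of Q"
proof -
  obtain V where V: "finite V" "Q = convex hull (rvec ` V)" using assms by (auto simp: lattice_polytope_def)
  have "compact Q" "convex Q" by (auto simp: V finite_imp_compact_convex_hull convex_convex_hull)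
  then obtain x where x: "x extreme_point_of Q" using assms(2) extreme_point_exists_convex by blast
  then have "x \<in> rvec ` V" unfolding V(2) by (rule extreme_point_of_convex_hull)
  then show thesis using that x by blast
qed

text \<open>A sum of j differences u - w becomes, after adding j w, a sum of j lattice points and so
  lives in degree j.\<close>

lemma semigroup_gen_diff_homogenize:
  assumes "y \<in> semigroup_gen ((\<lambda>u. u - w) ` L)"
  shows "\<exists>j. (y + int j *s w, int j) \<in> semigroup_gen ((\<lambda>u. (u, 1)) ` L)"
  using assms
proof induction
  case zero
  show ?case using semigroup_gen.zero[of "(\<lambda>u. (u, 1::int)) ` L"]
    unfolding zero_prod_def by (intro exI[of _ 0]) simp
next
  case (add g y)
  then obtain j u where j: "(y + int j *s w, int j) \<in> semigroup_gen ((\<lambda>u. (u, 1)) ` L)" and u: "u \<in> L" "g = u - w" by auto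
  have "(u, 1) + (y + int j *s w, int j) \<in> semigroup_gen ((\<lambda>u. (u, 1)) ` L)"
    using u j by (intro semigroup_gen.add) auto
  also have "(u, 1) + (y + int j *s w, int j) = (g + y + int (Suc j) *s w, int (Suc j))"
    by (simp add: u vec_eq_iff algebra_simps)
  finally show ?case by blast
qed

lemma nmul_prod: "nmul n (w, 1::int) = (int n *s w, int n)"
  by (induction n) (auto simp: zero_prod_def vec_eq_iff algebra_simps)

text \<open>Saturation at a vertex w puts every lattice point of a full-dimensional cone into the
  semigroup there. Deep inside the cone lie two such points with any prescribed difference;
  homogenising them and adjusting degrees by multiples of \<open>(w, 1)\<close> gives the
  claim.\<close>

lemma very_ample_imp_spanning:
  fixes Q :: "(real^'n) set"
  assumes va: "very_ample_polytope Q" and int: "interior Q \<noteq> {}"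
  shows "spanning_polytope Q"
proof
  let ?L = "lattice_points Q"
  show lat: "lattice_polytope Q" using va by (simp add: very_ample_polytope_def)
  show "interior Q \<noteq> {}" by (rule int)
  obtain V where V: "finite V" "Q = convex hull (rvec ` V)" using lat by (auto simp: lattice_polytope_def)
  have compQ: "compact Q" and convQ: "convex Q" by (auto simp: V finite_imp_compact_convex_hull convex_convex_hull)
  have "Q \<noteq> {}" using int interior_subset by blast
  with lat obtain w where w: "rvec w extreme_point_of Q" by (rule lattice_vertex_exists)
  then have "rvec w \<in> Q" by (simp add: extreme_point_of_def)
  then have wL: "w \<in> ?L" by (simp add: lattice_points_def)
  let ?G = "(\<lambda>u. u - w) ` ?L"
  have finL: "finite ?L"
  proof -
    obtain B where "\<And>y. y \<in> Q \<Longrightarrow> norm y \<le> B" using compQ compact_imp_bounded bounded_iff by metis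
    then show ?thesis
      by (intro finite_subset[OF _ finite_rvec_bounded[of 0 B]]) (auto simp: lattice_points_def)
  qed
  have sat: "saturated (semigroup_gen ?G)" using va w by (simp add: very_ample_polytope_def)
  have Qcone: "c *\<^sub>R (q - rvec w) \<in> cone_over ?G" if "q \<in> Q" "c \<ge> 0" for q c
  proof -
    have "rvec ` V \<subseteq> (+) (rvec w) ` cone_over ?G"
    proof (rule image_subsetI)
      fix v assume "v \<in> V"
      then have "v \<in> ?L" by (simp add: lattice_points_def V(2) hull_inc)
      then have "rvec (v - w) \<in> cone_over ?G" using finL by (intro cone_over_base) auto
      then show "rvec v \<in> (+) (rvec w) ` cone_over ?G" by (simp add: mem_translation_iff rvec_diff)
    qed
    then have "Q \<subseteq> (+) (rvec w) ` cone_over ?G"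
      unfolding V(2) by (intro hull_minimal convex_translation convex_cone_over)
    then have "q - rvec w \<in> cone_over ?G" using that(1) by (auto simp: mem_translation_iff)
    then show ?thesis using that(2) by (rule cone_over_scale)
  qed
  obtain q \<epsilon> where q: "\<epsilon> > 0" "ball q \<epsilon> \<subseteq> Q" using int by (meson ex_in_conv mem_interior)
  have diff: "\<exists>a\<in>semigroup_gen ?G. \<exists>b\<in>semigroup_gen ?G. x = a - b" for x
  proof -
    \<comment> \<open>Scaled by N, the ball of radius \<epsilon> around q has room for the rounding
      error \<open>CARD('n)\<close> and the vector x at once.\<close>
    obtain N :: nat where N: "real N * \<epsilon> > CARD('n) + norm (rvec x)" using q(1) reals_Archimedean3 by blast
    then have N0: "real N > 0" using q(1) by (metis add_nonneg_nonneg le_less_trans norm_ge_zero of_nat_0_le_iff zero_less_mult_pos2)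
    obtain y where y: "floor_vec (real N *\<^sub>R (q - rvec w)) = rvec y" using floor_vec_mem range_rvec by blast
    have near: "rvec z \<in> cone_over ?G" if "norm (rvec z - rvec y) \<le> norm (rvec x)" for z
    proof -
      define p where "p = rvec w + rvec z /\<^sub>R real N"
      have "p - q = (rvec z - real N *\<^sub>R (q - rvec w)) /\<^sub>R real N"
        using N0 by (simp add: p_def scaleR_diff_right)
      then have "norm (p - q) = norm (rvec z - real N *\<^sub>R (q - rvec w)) / real N"
        using N0 by (simp add: divide_inverse_commute)
      moreover have "norm (rvec z - real N *\<^sub>R (q - rvec w)) \<le> norm (rvec x) + CARD('n)"
        using norm_triangle_ineq4[of "rvec z - rvec y" "real N *\<^sub>R (q - rvec w) - rvec y"] that
          norm_diff_floor_vec[of "real N *\<^sub>R (q - rvec w)"] by (simp add: y)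
      ultimately have "norm (p - q) < \<epsilon>" using N N0 by (simp add: divide_less_eq mult.commute)
      then have "p \<in> Q" using q(2) by (auto simp: dist_norm norm_minus_commute)
      then have "real N *\<^sub>R (p - rvec w) \<in> cone_over ?G" by (rule Qcone) simp
      then show ?thesis using N0 by (simp add: p_def)
    qed
    have "y \<in> semigroup_gen ?G" "y + x \<in> semigroup_gen ?G"
      using near[of y] near[of "y + x"] finL sat by (auto intro!: saturated_cone_over simp: rvec_add)
    moreover have "x = (y + x) - y" by simp
    ultimately show ?thesis by blast
  qed
  fix z :: "(int^'n) \<times> int"
  obtain x t where z: "z = (x, t)" by (cases z)
  obtain a b where ab: "a \<in> semigroup_gen ?G" "b \<in> semigroup_gen ?G" "x - t *s w = a - b" using diff by blast
  obtain i where i: "(a + int i *s w, int i) \<in> polytope_semigroup Q" using semigroup_gen_diff_homogenize[OF ab(1)] by blast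
  obtain j where j: "(b + int j *s w, int j) \<in> polytope_semigroup Q" using semigroup_gen_diff_homogenize[OF ab(2)] by blast
  have x: "x = a - b + t *s w" using ab(3) by (simp add: algebra_simps)
  have wS: "nmul n (w, 1) \<in> polytope_semigroup Q" for n
    using wL by (intro semigroup_gen_nmul semigroup_gen_base) auto
  \<comment> \<open>The degree mismatch; its sign decides on which side the multiple of
    \<open>(w, 1)\<close> is added.\<close>
  define e where "e = int j - int i + t"
  show "\<exists>s\<in>polytope_semigroup Q. \<exists>s'\<in>polytope_semigroup Q. s = z + s'"
  proof (cases "e \<ge> 0")
    case True
    have "(a + int i *s w, int i) + nmul (nat e) (w, 1) = z + (b + int j *s w, int j)"
      using True by (simp add: nmul_prod z x e_def vec_eq_iff algebra_simps)
    moreover have "(a + int i *s w, int i) + nmul (nat e) (w, 1) \<in> polytope_semigroup Q"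
      using i wS by (rule semigroup_gen_add)
    ultimately show ?thesis using j by blast
  next
    case False
    have "(a + int i *s w, int i) = z + ((b + int j *s w, int j) + nmul (nat (- e)) (w, 1))"
      using False by (simp add: nmul_prod z x e_def vec_eq_iff algebra_simps)
    moreover have "(b + int j *s w, int j) + nmul (nat (- e)) (w, 1) \<in> polytope_semigroup Q"
      using j wS by (rule semigroup_gen_add)
    ultimately show ?thesis using i by blast
  qed
qed

section \<open>Rational polyhedral cones\<close>

text \<open>The hull of the generators may contain the origin, where the conic hull of a compact
  convex set can fail to be closed; polyhedrality saves it.\<close>

lemma closed_cone_over:
  assumes "finite V"
  shows "closed (cone_over V)"
proof (cases "V = {}")
  case True
  then have "cone_over V = {0}" using zero_mem_cone_over[of V] by (auto simp: cone_over_def)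
  then show ?thesis by simp
next
  case False
  have "cone_over V = conic hull (convex hull (rvec ` V))"
  proof
    show "conic hull (convex hull (rvec ` V)) \<subseteq> cone_over V"
    proof -
      have "convex hull (rvec ` V) \<subseteq> cone_over V"
        using cone_over_base[OF assms] by (intro hull_minimal convex_cone_over) auto
      then show ?thesis by (auto simp: conic_hull_explicit intro: cone_over_scale)
    qed
    show "cone_over V \<subseteq> conic hull (convex hull (rvec ` V))"
    proof
      fix y assume "y \<in> cone_over V"
      then obtain c where c: "\<forall>v. c v \<ge> 0" "y = (\<Sum>v\<in>V. c v *\<^sub>R rvec v)" unfolding cone_over_def by blast
      show "y \<in> conic hull (convex hull (rvec ` V))"
      proof (cases "sum c V = 0")
        case True
        then have "c v = 0" if "v \<in> V" for v using c(1) assms that by (simp add: sum_nonneg_eq_0_iff)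
        then have "y = 0" by (simp add: c(2))
        then show ?thesis using False by simp
      next
        case nz: False
        then have pos: "sum c V > 0" using c(1) by (simp add: sum_nonneg less_le)
        have "(\<Sum>v\<in>V. (c v / sum c V) *\<^sub>R rvec v) \<in> convex hull (rvec ` V)"
          using assms c(1) pos
          by (intro convex_sum convex_convex_hull) (auto simp: hull_inc simp flip: sum_divide_distrib)
        moreover have "y = sum c V *\<^sub>R (\<Sum>v\<in>V. (c v / sum c V) *\<^sub>R rvec v)"
          using pos by (simp add: c(2) scaleR_sum_right)
        ultimately show ?thesis using pos unfolding conic_hull_explicit by (blast intro: less_imp_le)
      qed
    qed
  qed
  moreover have "polytope (convex hull (rvec ` V))" using assms by (auto simp: polytope_def)
  ultimately show ?thesis by (simp add: closed_conic_hull_strong)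
qed

text \<open>One step of the double description method: the generators \<open>g\<close> with \<open>\<langle>a,g\<rangle> > 0\<close> and \<open>h\<close> with
  \<open>\<langle>a,h\<rangle> < 0\<close> are combined to \<open>\<langle>a,g\<rangle> h - \<langle>a,h\<rangle> g\<close> on the hyperplane, which keeps integrality.\<close>

lemma cone_over_halfspace:
  fixes V :: "(int^'n) set" and a :: "int^'n"
  assumes fin: "finite V"
  shows "\<exists>W. finite W \<and> cone_over W = {y \<in> cone_over V. 0 \<le> y \<bullet> rvec a}"
proof -
  define p where "p v = (\<Sum>i\<in>UNIV. v $ i * a $ i)" for v :: "int^'n"
  have p: "rvec v \<bullet> rvec a = of_int (p v)" for v
    by (simp add: p_def inner_vec_def rvec_def)
  define Vp where "Vp = {v \<in> V. p v > 0}"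
  define V0 where "V0 = {v \<in> V. p v \<ge> 0}"
  define Vm where "Vm = {v \<in> V. p v < 0}"
  define comb where "comb = (\<lambda>(g, h). p g *s h - p h *s g)"
  define W where "W = V0 \<union> comb ` (Vp \<times> Vm)"
  have finW: "finite W" using fin by (simp add: W_def V0_def Vp_def Vm_def)
  have rc: "rvec (comb (g, h)) = of_int (p g) *\<^sub>R rvec h - of_int (p h) *\<^sub>R rvec g" for g h
    by (simp add: comb_def rvec_diff rvec_scale)
  have "cone_over W = {y \<in> cone_over V. 0 \<le> y \<bullet> rvec a}"
  proof (intro equalityI subsetI)
    fix y assume y: "y \<in> cone_over W"
    have gV: "rvec w \<in> cone_over V \<and> 0 \<le> rvec w \<bullet> rvec a" if "w \<in> W" for w
      using that unfolding W_def
    proof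
      assume "w \<in> V0"
      then show ?thesis using fin by (auto simp: V0_def p intro: cone_over_base)
    next
      assume "w \<in> comb ` (Vp \<times> Vm)"
      then obtain g h where gh: "g \<in> Vp" "h \<in> Vm" "w = comb (g, h)" by auto
      have "of_int (p g) *\<^sub>R rvec h + (- of_int (p h)) *\<^sub>R rvec g \<in> cone_over V"
        using gh fin by (intro cone_over_add cone_over_scale cone_over_base) (auto simp: Vp_def Vm_def)
      then show ?thesis by (simp add: gh(3) rc inner_diff_left p)
    qed
    obtain c where c: "\<forall>w. c w \<ge> 0" "y = (\<Sum>w\<in>W. c w *\<^sub>R rvec w)" using y unfolding cone_over_def by blast
    have "0 \<le> y \<bullet> rvec a" unfolding c(2) inner_sum_left
      using c(1) gV by (intro sum_nonneg) auto
    moreover have "y \<in> cone_over V" using y cone_over_minimal[of W V] gV by blast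
    ultimately show "y \<in> {y \<in> cone_over V. 0 \<le> y \<bullet> rvec a}" by simp
  next
    fix y assume "y \<in> {y \<in> cone_over V. 0 \<le> y \<bullet> rvec a}"
    then obtain c where c: "\<forall>w. c w \<ge> 0" "y = (\<Sum>w\<in>V. c w *\<^sub>R rvec w)" and ya: "0 \<le> y \<bullet> rvec a"
      unfolding cone_over_def by blast
    have V: "V = V0 \<union> Vm" "V0 \<inter> Vm = {}" "finite V0" "finite Vm" "finite Vp"
      using fin by (auto simp: V0_def Vm_def Vp_def)
    have yd: "y = (\<Sum>w\<in>V0. c w *\<^sub>R rvec w) + (\<Sum>w\<in>Vm. c w *\<^sub>R rvec w)"
      unfolding c(2) V(1) using V by (intro sum.union_disjoint) auto
    \<comment> \<open>P and N are the positive and negative contributions to the inner product with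
      a, so the half-space condition reads N \<le> P.\<close>
    define P where "P = (\<Sum>g\<in>Vp. c g * of_int (p g))"
    define N where "N = (\<Sum>h\<in>Vm. c h * - of_int (p h))"
    have N0: "N \<ge> 0" unfolding N_def using c(1) by (intro sum_nonneg mult_nonneg_nonneg) (auto simp: Vm_def)
    have "(\<Sum>w\<in>V0. c w * of_int (p w)) = P"
      unfolding P_def using V by (intro sum.mono_neutral_right) (auto simp: V0_def Vp_def)
    then have "y \<bullet> rvec a = P - N"
      unfolding yd by (simp add: inner_add_left inner_sum_left p N_def sum_negf)
    with ya have PN: "N \<le> P" by simp
    have baseW: "rvec w \<in> cone_over W" if "w \<in> W" for w using cone_over_base[OF finW that] .
    show "y \<in> cone_over W"
    proof (cases "P = 0")
      case True
      with PN N0 have "N = 0" by simp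
      then have "\<forall>h\<in>Vm. c h * - of_int (p h) = 0"
        unfolding N_def using c(1) V(4) by (subst (asm) sum_nonneg_eq_0_iff) (auto simp: Vm_def mult_le_0_iff)
      then have "c h = 0" if "h \<in> Vm" for h using that by (auto simp: Vm_def)
      then have "y = (\<Sum>w\<in>V0. c w *\<^sub>R rvec w)" unfolding yd by simp
      also have "\<dots> \<in> cone_over W"
        using c(1) baseW by (intro cone_over_sum cone_over_scale) (auto simp: W_def)
      finally show ?thesis .
    next
      case False
      with N0 PN have P: "P > 0" by simp
      \<comment> \<open>With weights c g c h / P the combined generators absorb the whole negative
        part and use up the fraction N / P of every positive generator.\<close>
      let ?S = "\<Sum>g\<in>Vp. \<Sum>h\<in>Vm. (c g * c h / P) *\<^sub>R rvec (comb (g, h))"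
      have S: "?S = (\<Sum>h\<in>Vm. c h *\<^sub>R rvec h) + (\<Sum>g\<in>Vp. (c g * (N / P)) *\<^sub>R rvec g)"
      proof -
        have "?S = (\<Sum>g\<in>Vp. \<Sum>h\<in>Vm. (c g * of_int (p g) * c h / P) *\<^sub>R rvec h) +
            (\<Sum>g\<in>Vp. \<Sum>h\<in>Vm. (c g / P * (c h * - of_int (p h))) *\<^sub>R rvec g)"
          unfolding sum.distrib[symmetric] rc
          by (intro sum.cong refl) (simp add: scaleR_diff_right mult_ac)
        also have "(\<Sum>g\<in>Vp. \<Sum>h\<in>Vm. (c g * of_int (p g) * c h / P) *\<^sub>R rvec h)
            = (\<Sum>h\<in>Vm. \<Sum>g\<in>Vp. (c g * of_int (p g) * c h / P) *\<^sub>R rvec h)" by (rule sum.swap)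
        also have "\<dots> = (\<Sum>h\<in>Vm. c h *\<^sub>R rvec h)"
        proof (rule sum.cong[OF refl])
          fix h
          have "(\<Sum>g\<in>Vp. (c g * of_int (p g) * c h / P) *\<^sub>R rvec h) = (P * c h / P) *\<^sub>R rvec h"
            unfolding scaleR_sum_left[symmetric] P_def by (simp add: sum_distrib_right sum_divide_distrib)
          then show "(\<Sum>g\<in>Vp. (c g * of_int (p g) * c h / P) *\<^sub>R rvec h) = c h *\<^sub>R rvec h" using P by simp
        qed
        also have "(\<Sum>g\<in>Vp. \<Sum>h\<in>Vm. (c g / P * (c h * - of_int (p h))) *\<^sub>R rvec g) = (\<Sum>g\<in>Vp. (c g * (N / P)) *\<^sub>R rvec g)"
        proof (rule sum.cong[OF refl])
          fix g
          have "(\<Sum>h\<in>Vm. (c g / P * (c h * - of_int (p h))) *\<^sub>R rvec g) = (c g / P * N) *\<^sub>R rvec g"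
            unfolding scaleR_sum_left[symmetric] N_def by (simp only: sum_distrib_left)
          then show "(\<Sum>h\<in>Vm. (c g / P * (c h * - of_int (p h))) *\<^sub>R rvec g) = (c g * (N / P)) *\<^sub>R rvec g" by simp
        qed
        finally show ?thesis .
      qed
      have "(\<Sum>w\<in>V0. c w *\<^sub>R rvec w) = (\<Sum>w\<in>V0 - Vp. c w *\<^sub>R rvec w) + (\<Sum>w\<in>Vp. c w *\<^sub>R rvec w)"
        using V(3) by (intro sum.subset_diff) (auto simp: V0_def Vp_def)
      also have "(\<Sum>w\<in>Vp. c w *\<^sub>R rvec w) = (\<Sum>w\<in>Vp. (c w * (1 - N / P)) *\<^sub>R rvec w) + (\<Sum>w\<in>Vp. (c w * (N / P)) *\<^sub>R rvec w)"
        unfolding sum.distrib[symmetric] by (intro sum.cong refl) (simp add: algebra_simps flip: scaleR_add_left)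
      finally have y: "y = (\<Sum>w\<in>V0 - Vp. c w *\<^sub>R rvec w) + (\<Sum>w\<in>Vp. (c w * (1 - N / P)) *\<^sub>R rvec w) + ?S"
        unfolding yd S by simp
      have "N / P \<le> 1" using PN P by simp
      then have "(\<Sum>w\<in>Vp. (c w * (1 - N / P)) *\<^sub>R rvec w) \<in> cone_over W"
        using c(1) baseW by (intro cone_over_sum cone_over_scale) (auto simp: W_def V0_def Vp_def)
      moreover have "(\<Sum>w\<in>V0 - Vp. c w *\<^sub>R rvec w) \<in> cone_over W"
        using c(1) baseW by (intro cone_over_sum cone_over_scale) (auto simp: W_def)
      moreover have "?S \<in> cone_over W"
        using c(1) P baseW by (intro cone_over_sum cone_over_scale) (auto simp: W_def)
      ultimately show ?thesis unfolding y by (intro cone_over_add)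
    qed
  qed
  with finW show ?thesis by blast
qed

lemma cone_over_UNIV: "\<exists>W :: (int^'n) set. finite W \<and> cone_over W = UNIV"
proof -
  define W :: "(int^'n) set" where "W = range (\<lambda>i. axis i 1) \<union> range (\<lambda>i. axis i (- 1))"
  have fin: "finite W" by (simp add: W_def)
  have ax: "rvec (axis i k) = axis i (of_int k)" for i :: 'n and k by (simp add: rvec_def axis_def vec_eq_iff)
  have "y \<in> cone_over W" for y :: "real^'n"
  proof -
    have "(y $ i) *\<^sub>R axis i 1 \<in> cone_over W" for i
    proof (cases "y $ i \<ge> 0")
      case True
      have "rvec (axis i 1) \<in> cone_over W" by (rule cone_over_base[OF fin]) (simp add: W_def)
      with True show ?thesis by (simp add: ax cone_over_scale)
    next
      case False
      have "rvec (axis i (- 1)) \<in> cone_over W" by (rule cone_over_base[OF fin]) (simp add: W_def)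
      with False have "(- (y $ i)) *\<^sub>R rvec (axis i (- 1)) \<in> cone_over W" by (intro cone_over_scale) auto
      moreover have "(- (y $ i)) *\<^sub>R rvec (axis i (- 1)) = (y $ i) *\<^sub>R axis i 1"
        unfolding ax by (simp add: axis_def vec_eq_iff)
      ultimately show ?thesis by simp
    qed
    then have "(\<Sum>i\<in>UNIV. (y $ i) *\<^sub>R axis i 1) \<in> cone_over W" by (intro cone_over_sum)
    also have "(\<Sum>i\<in>UNIV. (y $ i) *\<^sub>R axis i 1) = y"
      using basis_expansion[of y] by (simp add: scalar_mult_eq_scaleR)
    finally show ?thesis .
  qed
  with fin show ?thesis by blast
qed

lemma polyhedral_cone_generated:
  fixes A :: "(int^'n) set"
  assumes "finite A"
  shows "\<exists>W. finite W \<and> cone_over W = {y. \<forall>a\<in>A. 0 \<le> y \<bullet> rvec a}"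
  using assms
proof induction
  case empty
  then show ?case using cone_over_UNIV by simp
next
  case (insert a A)
  then obtain W where W: "finite W" "cone_over W = {y. \<forall>a\<in>A. 0 \<le> y \<bullet> rvec a}" by blast
  obtain W' where "finite W'" "cone_over W' = {y \<in> cone_over W. 0 \<le> y \<bullet> rvec a}"
    using cone_over_halfspace[OF W(1)] by blast
  then show ?case by (intro exI[of _ W']) (auto simp: W(2))
qed

text \<open>A nonzero coordinate bounds the integers dividing g, and division by the largest of them
  leaves a primitive vector.\<close>

lemma primitive_multiple:
  fixes g :: "int^'n"
  assumes "g \<noteq> 0"
  shows "\<exists>v k. primitive v \<and> k \<ge> 1 \<and> g = int k *s v"
proof -
  obtain i where i: "g $ i \<noteq> 0" using assms by (auto simp: vec_eq_iff)
  define M where "M = {k::nat. \<exists>w. g = int k *s w}"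
  have "k \<le> nat \<bar>g $ i\<bar>" if kM: "k \<in> M" for k
  proof -
    obtain w where w: "g = int k *s w" using kM unfolding M_def by blast
    have "int k dvd g $ i" unfolding w by simp
    then have "int k \<le> \<bar>g $ i\<bar>" using dvd_imp_le_int[OF i, of "int k"] by simp
    then show ?thesis by linarith
  qed
  then have finM: "finite M" by (meson finite_nat_set_iff_bounded_le)
  have "1 \<in> M" unfolding M_def by (intro CollectI exI[of _ g]) simp
  define k where "k = Max M"
  have k: "k \<in> M" "\<And>j. j \<in> M \<Longrightarrow> j \<le> k" 
    using Max_in[OF finM] Max_ge[OF finM] \<open>1 \<in> M\<close> unfolding k_def by blast+
  then have k1: "k \<ge> 1" using \<open>1 \<in> M\<close> by blast
  obtain v where v: "g = int k *s v" using k(1) unfolding M_def by blast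
  have v0: "v \<noteq> 0" using assms v by auto
  have "j = 1" if "v = int j *s w" for w and j :: nat
  proof -
    have "j \<noteq> 0" using that v0 by auto
    have "g = int (k * j) *s w" unfolding v that by (simp add: vec_eq_iff mult.assoc)
    then have "k * j \<in> M" by (auto simp: M_def)
    then have "k * j \<le> k * 1" using k(2) by simp
    then show ?thesis using \<open>j \<noteq> 0\<close> k1 by simp
  qed
  then have "primitive v" using v0 by (simp add: primitive_def)
  then show ?thesis using v k1 by blast
qed

lemma cone_over_singleton: "cone_over {v} = {c *\<^sub>R rvec v | c. c \<ge> 0}"
  unfolding cone_over_def
proof (intro equalityI subsetI)
  fix x assume "x \<in> {c *\<^sub>R rvec v | c. c \<ge> 0}"
  then obtain c where "x = c *\<^sub>R rvec v" "c \<ge> 0" by blast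
  then show "x \<in> {\<Sum>v\<in>{v}. c v *\<^sub>R rvec v |c. \<forall>v. 0 \<le> c v}"
    by (intro CollectI exI[of _ "\<lambda>_. c"]) simp
qed auto

lemma cone_over_singleton_scale:
  assumes "k \<ge> 1"
  shows "cone_over {int k *s v} = cone_over {v}"
proof (intro equalityI cone_over_minimal)
  show "rvec w \<in> cone_over {v}" if "w \<in> {int k *s v}" for w
    using that by (simp add: rvec_scale cone_over_scale cone_over_base)
  show "rvec w \<in> cone_over {int k *s v}" if "w \<in> {v}" for w
  proof -
    have "(1 / real k) *\<^sub>R rvec (int k *s v) \<in> cone_over {int k *s v}"
      by (intro cone_over_scale cone_over_base) auto
    then show ?thesis using that assms by (simp add: rvec_scale)
  qed
qed

text \<open>A minimal generating set of a pointed cone spans its extreme rays.\<close>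

lemma pointed_cone_rays:
  fixes V :: "(int^'n) set"
  assumes fin: "finite V" and pointed: "cone_over V \<inter> uminus ` cone_over V = {0}"
  shows "\<exists>W. finite W \<and> cone_over W = cone_over V \<and> (\<forall>w\<in>W. primitive w \<and> cone_over {w} face_of cone_over V)"
proof -
  define s where "s = cone_over V"
  have "\<exists>W\<subseteq>V. cone_over W = s \<and> (\<forall>U\<subseteq>V. cone_over U = s \<longrightarrow> card W \<le> card U)"
    using ex_has_least_nat[of "\<lambda>W. W \<subseteq> V \<and> cone_over W = s" V card] by (auto simp: s_def)
  then obtain W where W: "W \<subseteq> V" "cone_over W = s" "\<And>U. U \<subseteq> V \<Longrightarrow> cone_over U = s \<Longrightarrow> card W \<le> card U"
    by blast
  have finW: "finite W" using W(1) fin finite_subset by blast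
  have irred: "rvec g \<notin> cone_over (W - {g})" if "g \<in> W" for g
  proof
    assume g: "rvec g \<in> cone_over (W - {g})"
    have "cone_over W \<subseteq> cone_over (W - {g})"
    proof (rule cone_over_minimal)
      fix v assume "v \<in> W"
      then show "rvec v \<in> cone_over (W - {g})"
        using g finW by (cases "v = g") (auto intro: cone_over_base)
    qed
    moreover have "cone_over (W - {g}) \<subseteq> cone_over W"
      using finW by (intro cone_over_minimal cone_over_base) auto
    ultimately have "card W \<le> card (W - {g})" using W by (intro W(3)) auto
    then show False using that finW by (metis card_Diff1_less not_le)
  qed
  have zero: "y = 0" if "y \<in> s" "- y \<in> s" for y
    using pointed that unfolding s_def[symmetric] by (metis IntI image_eqI minus_minus singletonD)
  have nz: "g \<noteq> 0" if "g \<in> W" for g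
    using irred[OF that] zero_mem_cone_over by (metis rvec_zero)
  have face: "cone_over {g} face_of s" if g: "g \<in> W" for g
    unfolding face_of_def
  proof (intro conjI ballI impI)
    show "cone_over {g} \<subseteq> s"
      unfolding W(2)[symmetric] using finW g by (intro cone_over_minimal cone_over_base) auto
    show "convex (cone_over {g})" by (rule convex_cone_over)
    \<comment> \<open>Coefficients of x + y = c g are compared. Irredundancy keeps positive
      multiples of g out of the cone over the other generators, so d \<ge> 0; the part of x away
      from g then has its negative in s and vanishes by pointedness.\<close>
    have main: "x \<in> cone_over {g}" if x: "x \<in> s" and y: "y \<in> s" and xy: "x + y = c *\<^sub>R rvec g" "c \<ge> 0" for x y c
    proof -
      obtain a where a: "\<forall>v. a v \<ge> 0" "x = (\<Sum>v\<in>W. a v *\<^sub>R rvec v)" using x unfolding W(2)[symmetric] cone_over_def by blast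
      obtain b where b: "\<forall>v. b v \<ge> 0" "y = (\<Sum>v\<in>W. b v *\<^sub>R rvec v)" using y unfolding W(2)[symmetric] cone_over_def by blast
      have sub: "(\<Sum>v\<in>W - {g}. f v *\<^sub>R rvec v) \<in> cone_over (W - {g})" if "\<forall>v. f v \<ge> 0" for f
        unfolding cone_over_def using that by blast
      have WmS: "cone_over (W - {g}) \<subseteq> s"
        unfolding W(2)[symmetric] using finW by (intro cone_over_minimal cone_over_base) auto
      define d where "d = a g + b g - c"
      have "x + y = (a g + b g) *\<^sub>R rvec g + ((\<Sum>v\<in>W - {g}. a v *\<^sub>R rvec v) + (\<Sum>v\<in>W - {g}. b v *\<^sub>R rvec v))"
        using g finW by (simp add: a(2) b(2) sum.remove algebra_simps)
      with xy have eq: "(- d) *\<^sub>R rvec g = (\<Sum>v\<in>W - {g}. a v *\<^sub>R rvec v) + (\<Sum>v\<in>W - {g}. b v *\<^sub>R rvec v)"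
        by (simp add: d_def algebra_simps)
      have "(- d) *\<^sub>R rvec g \<in> cone_over (W - {g})" unfolding eq using a b by (intro cone_over_add sub)
      then have "\<not> - d > 0"
      proof (intro notI)
        assume h: "(- d) *\<^sub>R rvec g \<in> cone_over (W - {g})" "- d > 0"
        from h(1) have "(1 / - d) *\<^sub>R (- d) *\<^sub>R rvec g \<in> cone_over (W - {g})"
          by (rule cone_over_scale) (use h(2) in simp)
        moreover have "(1 / - d) *\<^sub>R (- d) *\<^sub>R rvec g = rvec g" using h(2) by simp
        ultimately show False using irred[OF g] by (simp only:)
      qed
      then have d: "d \<ge> 0" by simp
      have "(\<Sum>v\<in>W - {g}. a v *\<^sub>R rvec v) = 0"
      proof (rule zero)
        show "(\<Sum>v\<in>W - {g}. a v *\<^sub>R rvec v) \<in> s" using sub[OF a(1)] WmS by blast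
        have "- (\<Sum>v\<in>W - {g}. a v *\<^sub>R rvec v) = d *\<^sub>R rvec g + (\<Sum>v\<in>W - {g}. b v *\<^sub>R rvec v)"
        proof -
          have "(\<Sum>v\<in>W - {g}. a v *\<^sub>R rvec v) = (- d) *\<^sub>R rvec g - (\<Sum>v\<in>W - {g}. b v *\<^sub>R rvec v)"
            unfolding eq by simp
          then show ?thesis by simp
        qed
        also have "\<dots> \<in> s"
        proof -
          have "rvec g \<in> s" unfolding W(2)[symmetric] using cone_over_base[OF finW g] .
          moreover have "(\<Sum>v\<in>W - {g}. b v *\<^sub>R rvec v) \<in> s" using sub[OF b(1)] WmS by blast
          ultimately show ?thesis using d unfolding W(2)[symmetric] by (intro cone_over_add cone_over_scale)
        qed
        finally show "- (\<Sum>v\<in>W - {g}. a v *\<^sub>R rvec v) \<in> s" .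
      qed
      then have "x = a g *\<^sub>R rvec g" using g finW by (simp add: a(2) sum.remove)
      then show ?thesis using a(1) by (simp add: cone_over_scale cone_over_base)
    qed
    fix a b x assume h: "a \<in> s" "b \<in> s" "x \<in> cone_over {g}" "x \<in> open_segment a b"
    then obtain u where u: "0 < u" "u < 1" "x = (1 - u) *\<^sub>R a + u *\<^sub>R b" by (auto simp: in_segment)
    obtain c where c: "c \<ge> 0" "x = c *\<^sub>R rvec g" using h(3) by (auto simp: cone_over_singleton)
    have as: "(1 - u) *\<^sub>R a \<in> s" "u *\<^sub>R b \<in> s"
      using h u unfolding s_def by (auto intro: cone_over_scale)
    have "(1 - u) *\<^sub>R a \<in> cone_over {g}" "u *\<^sub>R b \<in> cone_over {g}"
      using main[OF as, of c] main[OF as(2,1), of c] u c by (auto simp: add.commute)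
    then have "(1 / (1 - u)) *\<^sub>R (1 - u) *\<^sub>R a \<in> cone_over {g}" "(1 / u) *\<^sub>R u *\<^sub>R b \<in> cone_over {g}"
      using u by (auto intro!: cone_over_scale[of _ "{g}"] simp del: scaleR_scaleR)
    then show "a \<in> cone_over {g}" "b \<in> cone_over {g}" using u by auto
  qed
  obtain pr k where pr: "\<And>g. g \<in> W \<Longrightarrow> primitive (pr g)" "\<And>g. g \<in> W \<Longrightarrow> k g \<ge> 1" "\<And>g. g \<in> W \<Longrightarrow> g = int (k g) *s pr g"
    using primitive_multiple nz by metis
  have ceq: "cone_over {g} = cone_over {pr g}" if "g \<in> W" for g
    using cone_over_singleton_scale[OF pr(2)[OF that], of "pr g"] pr(3)[OF that] by simp
  have "cone_over (pr ` W) = s"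
  proof
    show "cone_over (pr ` W) \<subseteq> s"
    proof -
      have "rvec (pr g) \<in> s" if "g \<in> W" for g
        using face_of_imp_subset[OF face[OF that]] cone_over_base[of "{pr g}" "pr g"] ceq[OF that] by auto
      then show ?thesis unfolding s_def by (intro cone_over_minimal) auto
    qed
    show "s \<subseteq> cone_over (pr ` W)"
      unfolding W(2)[symmetric]
    proof (rule cone_over_minimal)
      fix g assume g: "g \<in> W"
      have "rvec (pr g) \<in> cone_over (pr ` W)" using finW g by (intro cone_over_base) auto
      then have "real (k g) *\<^sub>R rvec (pr g) \<in> cone_over (pr ` W)" by (rule cone_over_scale) simp
      moreover have "real (k g) *\<^sub>R rvec (pr g) = rvec g"
        using arg_cong[OF pr(3)[OF g], of rvec] by (simp add: rvec_scale)
      ultimately show "rvec g \<in> cone_over (pr ` W)" by simp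
    qed
  qed
  moreover have "primitive w \<and> cone_over {w} face_of s" if "w \<in> pr ` W" for w
    using that pr(1) face by (auto simp flip: ceq)
  moreover have "finite (pr ` W)" using finW by simp
  ultimately show ?thesis unfolding s_def[symmetric] by blast
qed

section \<open>The normal fan of a very ample polytope\<close>

text \<open>At a lattice point \<open>u\<close> which is not a vertex, \<open>u - w\<close> lies in the semigroup at \<open>u\<close> for a vertex \<open>w\<close>
  of the smallest face containing \<open>u\<close>, which reduces the claim to the vertex \<open>w\<close>.\<close>

lemma (in spanning_polytope) semigroup_at_lattice_point:
  assumes va: "very_ample_polytope Q" and u: "u \<in> L" and x: "rvec x \<in> cone_over ((\<lambda>v. v - u) ` L)"
  shows "x \<in> semigroup_gen ((\<lambda>v. v - u) ` L)"
proof -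
  let ?G = "\<lambda>w. (\<lambda>v. v - w) ` L"
  have finG: "finite (?G w)" for w using finite_lattice_points by simp
  define E where "E = {e \<in> L. rvec e extreme_point_of Q}"
  have finE: "finite E" using finite_lattice_points by (simp add: E_def)
  have "{y. y extreme_point_of Q} \<subseteq> rvec ` E"
  proof
    fix y assume y: "y \<in> {y. y extreme_point_of Q}"
    then have "y extreme_point_of convex hull (rvec ` L)" by (simp add: convex_hull_lattice_points)
    then have "y \<in> rvec ` L" by (rule extreme_point_of_convex_hull)
    then show "y \<in> rvec ` E" using y by (auto simp: E_def)
  qed
  then have "Q \<subseteq> convex hull (rvec ` E)"
    using Krein_Milman_Minkowski[OF compact convex] hull_mono by metis
  then have "rvec u \<in> convex hull (rvec ` E)" using u by (auto simp: lattice_points_def)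
  then obtain a where a: "\<forall>y\<in>rvec ` E. 0 \<le> a y" "sum a (rvec ` E) = 1" "(\<Sum>y\<in>rvec ` E. a y *\<^sub>R y) = rvec u"
    using finE by (auto simp: convex_hull_finite)
  have inj: "inj_on rvec E" by (simp add: inj_on_def rvec_inj)
  define b where "b e = a (rvec e)" for e
  have b: "\<And>e. e \<in> E \<Longrightarrow> b e \<ge> 0" "sum b E = 1" "(\<Sum>e\<in>E. b e *\<^sub>R rvec e) = rvec u"
    using a unfolding sum.reindex[OF inj] by (auto simp: b_def)
  \<comment> \<open>A vertex with positive weight in a convex representation of u has u - w in the
    cone at u, which will make w - u invertible in the semigroup.\<close>
  obtain w where w: "w \<in> E" "b w > 0"
  proof (rule ccontr)
    assume "\<not> thesis"
    then have "b e \<le> 0" if "e \<in> E" for e using that \<open>\<And>w. w \<in> E \<Longrightarrow> 0 < b w \<Longrightarrow> thesis\<close> by force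
    then have "sum b E \<le> 0" by (rule sum_nonpos)
    then show False using b(2) by simp
  qed
  have wL: "w \<in> L" using w(1) by (simp add: E_def)
  define y where "y = w - u"
  have yS: "y \<in> semigroup_gen (?G u)" unfolding y_def using wL by (intro semigroup_gen_base) auto
  have "rvec (- y) \<in> cone_over (?G u)"
  proof -
    have "(\<Sum>e\<in>E. b e *\<^sub>R rvec (e - u)) = 0"
      using b(2,3) by (simp add: rvec_diff scaleR_diff_right sum_subtractf flip: scaleR_sum_left)
    then have "b w *\<^sub>R rvec (- y) = (\<Sum>e\<in>E - {w}. b e *\<^sub>R rvec (e - u))"
      using finE w(1) by (simp add: sum.remove y_def rvec_diff rvec_uminus algebra_simps)
    also have "\<dots> \<in> cone_over (?G u)"
      using b(1) finG by (intro cone_over_sum cone_over_scale cone_over_base) (auto simp: E_def)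
    finally have "(1 / b w) *\<^sub>R b w *\<^sub>R rvec (- y) \<in> cone_over (?G u)"
      by (rule cone_over_scale) (use w(2) in simp)
    moreover have "(1 / b w) *\<^sub>R b w *\<^sub>R rvec (- y) = rvec (- y)" using w(2) by simp
    ultimately show ?thesis by (simp only:)
  qed
  from cone_over_multiple[OF finG this] obtain N where N: "N \<ge> 1" "int N *s (- y) \<in> semigroup_gen (?G u)" by blast
  have myS: "- y \<in> semigroup_gen (?G u)"
  proof -
    \<comment> \<open>Some multiple of -y is in the semigroup, and copies of y itself reduce it to
      -y.\<close>
    have e: "- y = int N *s (- y) + nmul (N - 1) y"
      using N(1) by (simp add: nmul_vec vec_eq_iff of_nat_diff algebra_simps)
    show ?thesis by (subst e) (rule semigroup_gen_add[OF N(2) semigroup_gen_nmul[OF yS]])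
  qed
  have mult: "k *s y \<in> semigroup_gen (?G u)" for k :: int
  proof (cases "k \<ge> 0")
    case True
    then have "k *s y = nmul (nat k) y" by (simp add: nmul_vec)
    then show ?thesis using semigroup_gen_nmul[OF yS] by simp
  next
    case False
    then have "k *s y = nmul (nat (- k)) (- y)" by (simp add: nmul_vec vec_eq_iff)
    then show ?thesis using semigroup_gen_nmul[OF myS] by simp
  qed
  obtain c where c: "\<forall>g. c g \<ge> 0" "rvec x = (\<Sum>g\<in>?G u. c g *\<^sub>R rvec g)" using x unfolding cone_over_def by blast
  \<comment> \<open>Subtracting y turns a generator v - u at u into the generator v - w at w;
    subtracting as many copies of y as the coefficient sum requires moves x into the cone at
    w.\<close>
  define j where "j = nat \<lceil>sum c (?G u)\<rceil>"
  have j: "real j \<ge> sum c (?G u)" unfolding j_def by linarith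
  have "rvec (x + int j *s (- y)) = (\<Sum>g\<in>?G u. c g *\<^sub>R rvec (g - y)) + (real j - sum c (?G u)) *\<^sub>R rvec (- y)"
    by (simp add: rvec_add rvec_scale c(2) rvec_diff rvec_uminus scaleR_diff_right sum_subtractf scaleR_diff_left
        flip: scaleR_sum_left)
  also have "\<dots> \<in> cone_over (?G w)"
  proof (intro cone_over_add cone_over_sum cone_over_scale)
    fix g assume "g \<in> ?G u"
    then have "g - y \<in> ?G w" by (auto simp: y_def)
    then show "rvec (g - y) \<in> cone_over (?G w)" by (rule cone_over_base[OF finG])
  next
    have "- y \<in> ?G w" using u by (auto simp: y_def)
    then show "rvec (- y) \<in> cone_over (?G w)" by (rule cone_over_base[OF finG])
  qed (use c(1) j in auto)
  finally have "rvec (x + int j *s (- y)) \<in> cone_over (?G w)" .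
  moreover have "saturated (semigroup_gen (?G w))" using va w(1) by (simp add: very_ample_polytope_def E_def)
  ultimately have "x + int j *s (- y) \<in> semigroup_gen (?G w)" by (intro saturated_cone_over finG)
  moreover have "\<exists>l. z + int l *s y \<in> semigroup_gen (?G u)" if "z \<in> semigroup_gen (?G w)" for z
    using that
  proof induction
    case zero
    then show ?case by (intro exI[of _ 0]) (simp add: semigroup_gen.zero)
  next
    case (add g z)
    then obtain l v where l: "z + int l *s y \<in> semigroup_gen (?G u)" and v: "v \<in> L" "g = v - w" by auto
    have "(v - u) + (z + int l *s y) \<in> semigroup_gen (?G u)" 
      by (rule semigroup_gen.add[OF _ l]) (use v(1) in auto)
    also have "(v - u) + (z + int l *s y) = g + z + int (Suc l) *s y"
      by (simp add: v y_def vec_eq_iff algebra_simps)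
    finally show ?case by blast
  qed
  ultimately obtain l where l: "x + int j *s (- y) + int l *s y \<in> semigroup_gen (?G u)" by blast
  have e: "x = (x + int j *s (- y) + int l *s y) + (int j - int l) *s y"
    by (simp add: vec_eq_iff algebra_simps)
  show ?thesis by (subst e) (rule semigroup_gen_add[OF l mult])
qed

context spanning_polytope
begin

text \<open>Inner normals, minimal on T, to match the inequalities \<open>\<ge>\<close> in
  \<open>div_polytope\<close>.\<close>

definition normal_cone :: "(int^'n) set \<Rightarrow> (real^'n) set" where
  "normal_cone T = {y. \<forall>t\<in>T. \<forall>v\<in>L. y \<bullet> rvec t \<le> y \<bullet> rvec v}"

text \<open>The faces of \<open>Q\<close> are indexed redundantly by sets \<open>T\<close> of lattice points; \<open>normal_cone T\<close> belongs to the
  smallest face containing \<open>T\<close>.\<close>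

definition normal_fan :: "(real^'n) set set" where
  "normal_fan = normal_cone ` {T. T \<subseteq> L \<and> T \<noteq> {}}"

lemma normal_cone_Un: "normal_cone T \<inter> normal_cone T' = normal_cone (T \<union> T')"
  by (auto simp: normal_cone_def)

lemma zero_mem_normal_cone: "0 \<in> normal_cone T"
  by (simp add: normal_cone_def)

lemma L_nonempty: "L \<noteq> {}"
proof
  assume "L = {}"
  with convex_hull_lattice_points have "Q = {}" by simp
  then show False using interior by simp
qed

lemma normal_cone_inner_eq:
  assumes "y \<in> normal_cone T" "s \<in> T" "t \<in> T" "T \<subseteq> L"
  shows "y \<bullet> rvec s = y \<bullet> rvec t"
proof (rule antisym)
  show "y \<bullet> rvec s \<le> y \<bullet> rvec t" "y \<bullet> rvec t \<le> y \<bullet> rvec s"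
    using assms unfolding normal_cone_def by blast+
qed

lemma normal_cone_generated:
  assumes "T \<subseteq> L"
  shows "\<exists>W. finite W \<and> cone_over W = normal_cone T"
proof -
  have "finite ((\<lambda>(v, t). v - t) ` (L \<times> T))"
    using finite_lattice_points finite_subset[OF assms] by simp
  from polyhedral_cone_generated[OF this] obtain W where
    "finite W" "cone_over W = {y. \<forall>a\<in>(\<lambda>(v, t). v - t) ` (L \<times> T). 0 \<le> y \<bullet> rvec a}" by blast
  moreover have "{y. \<forall>a\<in>(\<lambda>(v, t). v - t) ` (L \<times> T). 0 \<le> y \<bullet> rvec a} = normal_cone T"
    by (auto simp: normal_cone_def rvec_diff inner_diff_right)
  ultimately have "finite W \<and> cone_over W = normal_cone T" by simp
  then show ?thesis by (rule exI)
qed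

text \<open>A functional constant on a set with interior points is zero. Full dimension of Q enters
  here to make the normal cones strongly convex.\<close>

lemma inner_constant_imp_zero:
  assumes c: "\<And>v. v \<in> L \<Longrightarrow> y \<bullet> rvec v = c"
  shows "y = 0"
proof -
  have "convex hull (rvec ` L) \<subseteq> {x. y \<bullet> x = c}"
    by (rule hull_minimal) (use c convex_hyperplane in auto)
  then have "Q \<subseteq> {x. y \<bullet> x = c}" by (simp only: convex_hull_lattice_points)
  moreover obtain q e where q: "e > 0" "ball q e \<subseteq> Q" using interior by (meson ex_in_conv mem_interior)
  ultimately have h: "y \<bullet> x = c" if "x \<in> ball q e" for x using that by auto
  define d where "d = e / (2 * (norm y + 1))"
  have "norm y + 1 > 0" using norm_ge_zero[of y] by linarith
  then have d: "d > 0" unfolding d_def using q(1) by (intro divide_pos_pos) auto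
  have "norm (d *\<^sub>R y) < e"
  proof -
    have "d * norm y \<le> d * (norm y + 1)" using d by (intro mult_left_mono) auto
    also have "\<dots> = e / 2" using \<open>norm y + 1 > 0\<close> by (simp add: d_def field_simps)
    finally show ?thesis using q(1) d by simp
  qed
  then have "y \<bullet> (q + d *\<^sub>R y) = c" by (intro h) (simp add: dist_norm)
  moreover have "y \<bullet> q = c" using q(1) by (intro h) simp
  ultimately have "d * (y \<bullet> y) = 0" by (simp add: inner_add_right)
  then show ?thesis using d by simp
qed

lemma normal_cone_pointed:
  assumes "T \<subseteq> L" "T \<noteq> {}"
  shows "normal_cone T \<inter> uminus ` normal_cone T = {0}"
proof
  show "normal_cone T \<inter> uminus ` normal_cone T \<subseteq> {0}"
  proof
    fix y assume "y \<in> normal_cone T \<inter> uminus ` normal_cone T"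
    then have y: "y \<in> normal_cone T" "- y \<in> normal_cone T" by auto
    obtain t where t: "t \<in> T" using assms by blast
    have "y \<bullet> rvec v = y \<bullet> rvec t" if v: "v \<in> L" for v
    proof (rule antisym)
      show "y \<bullet> rvec t \<le> y \<bullet> rvec v" using y(1) t v unfolding normal_cone_def by blast
      have "(- y) \<bullet> rvec t \<le> (- y) \<bullet> rvec v" using y(2) t v unfolding normal_cone_def by blast
      then show "y \<bullet> rvec v \<le> y \<bullet> rvec t" by simp
    qed
    then show "y \<in> {0}" using inner_constant_imp_zero by blast
  qed
  show "{0} \<subseteq> normal_cone T \<inter> uminus ` normal_cone T" using zero_mem_normal_cone by force
qed

lemma convex_normal_cone: "convex (normal_cone T)"
proof -
  have "normal_cone T = (\<Inter>t\<in>T. \<Inter>v\<in>L. {y. rvec t \<bullet> y - rvec v \<bullet> y \<le> 0})"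
    by (auto simp: normal_cone_def inner_commute)
  moreover have "convex {y. rvec t \<bullet> y - rvec v \<bullet> y \<le> 0}" for t v :: "int^'n"
    using convex_halfspace_le[of "rvec t - rvec v" 0] by (simp add: inner_diff_left)
  ultimately show ?thesis by (simp add: convex_INT)
qed

lemma normal_cone_face:
  assumes T: "T \<subseteq> L" "T \<noteq> {}" and T': "T' \<subseteq> L"
  shows "normal_cone (T \<union> T') face_of normal_cone T"
  unfolding face_of_def
proof (intro conjI ballI impI)
  show "normal_cone (T \<union> T') \<subseteq> normal_cone T" by (auto simp: normal_cone_def)
  show "convex (normal_cone (T \<union> T'))" by (rule convex_normal_cone)
  fix a b x assume h: "a \<in> normal_cone T" "b \<in> normal_cone T" "x \<in> normal_cone (T \<union> T')" "x \<in> open_segment a b"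
  then obtain u where u: "0 < u" "u < 1" "x = (1 - u) *\<^sub>R a + u *\<^sub>R b" by (auto simp: in_segment)
  obtain t0 where t0: "t0 \<in> T" using T by blast
  have "a \<bullet> rvec t \<le> a \<bullet> rvec v \<and> b \<bullet> rvec t \<le> b \<bullet> rvec v" if t: "t \<in> T \<union> T'" and v: "v \<in> L" for t v
  proof -
    have tL: "t \<in> L" "t0 \<in> L" using t T T' t0 by auto
    define A where "A = a \<bullet> rvec t - a \<bullet> rvec t0"
    define B where "B = b \<bullet> rvec t - b \<bullet> rvec t0"
    have AB: "A \<ge> 0" "B \<ge> 0" using h(1,2) t0 tL by (auto simp: normal_cone_def A_def B_def)
    have "x \<bullet> rvec t \<le> x \<bullet> rvec t0" using h(3) t tL by (auto simp: normal_cone_def)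
    then have s: "(1 - u) * A + u * B \<le> 0"
      by (simp add: u(3) A_def B_def inner_add_left algebra_simps)
    have "(1 - u) * A \<ge> 0" "u * B \<ge> 0" using AB u by auto
    with s have "(1 - u) * A = 0" "u * B = 0" by linarith+
    then have "A = 0" "B = 0" using u by auto
    then show ?thesis using h(1,2) t0 v by (auto simp: normal_cone_def A_def B_def)
  qed
  then show "a \<in> normal_cone (T \<union> T')" "b \<in> normal_cone (T \<union> T')" by (auto simp: normal_cone_def)
qed

text \<open>A relative interior point y0 of E determines T' as its set of minimisers. For y in
  \<open>normal_cone T'\<close>, the segment from y to y0 can be prolonged beyond y0 inside
  \<open>normal_cone T\<close>, so the face property at y0 forces y into E.\<close>

lemma face_of_normal_cone:
  assumes T: "T \<subseteq> L" "T \<noteq> {}" and E: "E face_of normal_cone T" "E \<noteq> {}"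
  shows "\<exists>T'. T \<subseteq> T' \<and> T' \<subseteq> L \<and> E = normal_cone T'"
proof -
  have "convex E" using E(1) by (rule face_of_imp_convex)
  then obtain y0 where y0: "y0 \<in> rel_interior E" using E(2) rel_interior_eq_empty by blast
  then have y0E: "y0 \<in> E" using rel_interior_subset by blast
  then have y0T: "y0 \<in> normal_cone T" using E(1) face_of_imp_subset by blast
  obtain t where t: "t \<in> T" using T by blast
  define T' where "T' = {v \<in> L. y0 \<bullet> rvec v = y0 \<bullet> rvec t}"
  have TT': "T \<subseteq> T'" "T' \<subseteq> L"
    using normal_cone_inner_eq[OF y0T _ t T(1)] T(1) by (auto simp: T'_def)
  have min: "y0 \<bullet> rvec t \<le> y0 \<bullet> rvec v" if "v \<in> L" for v using y0T t that by (simp add: normal_cone_def)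
  have y0T': "y0 \<in> normal_cone T'" using min by (auto simp: normal_cone_def T'_def)
  have face: "normal_cone T' face_of normal_cone T"
    using normal_cone_face[OF T TT'(2)] TT'(1) by (simp add: Un_absorb1)
  have "E \<subseteq> normal_cone T'"
    using subset_of_face_of[OF face face_of_imp_subset[OF E(1)]] y0 y0T' by blast
  moreover have "normal_cone T' \<subseteq> E"
  proof
    fix y assume y: "y \<in> normal_cone T'"
    show "y \<in> E"
    proof (cases "y = y0")
      case False
      \<comment> \<open>Bounds how far the constraint at v allows going beyond y0; the 1 in the
        denominator prevents division by zero.\<close>
      define f where "f v = (y0 \<bullet> rvec v - y0 \<bullet> rvec t) / (\<bar>y \<bullet> rvec v - y \<bullet> rvec t\<bar> + 1)" for v
      define e where "e = Min (insert 1 (f ` (L - T')))"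
      have fpos: "f v > 0" if "v \<in> L - T'" for v
        using min[of v] that by (auto simp: f_def T'_def intro!: divide_pos_pos add_nonneg_pos)
      have e: "e > 0" using finite_lattice_points fpos by (auto simp: e_def)
      have ef: "e \<le> f v" if "v \<in> L - T'" for v
        unfolding e_def using finite_lattice_points that by (intro Min_le) auto
      define z where "z = y0 + e *\<^sub>R (y0 - y)"
      have "z \<bullet> rvec s \<le> z \<bullet> rvec v" if s: "s \<in> T" and v: "v \<in> L" for s v
      proof -
        have st: "y0 \<bullet> rvec s = y0 \<bullet> rvec t" using s TT' by (auto simp: T'_def)
        have yst: "y \<bullet> rvec s = y \<bullet> rvec t" 
          using normal_cone_inner_eq[OF y _ _ TT'(2)] s t TT'(1) by blast
        have "e * (y \<bullet> rvec v - y \<bullet> rvec t) \<le> (1 + e) * (y0 \<bullet> rvec v - y0 \<bullet> rvec t)"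
        proof (cases "v \<in> T'")
          case True
          then have "y \<bullet> rvec v = y \<bullet> rvec t" 
            using normal_cone_inner_eq[OF y _ _ TT'(2)] t TT'(1) by blast
          moreover have "y0 \<bullet> rvec v = y0 \<bullet> rvec t" using True by (simp add: T'_def)
          ultimately show ?thesis by simp
        next
          case False
          have "e * (y \<bullet> rvec v - y \<bullet> rvec t) \<le> e * (\<bar>y \<bullet> rvec v - y \<bullet> rvec t\<bar> + 1)"
            using e by (intro mult_left_mono) auto
          also have "\<dots> \<le> f v * (\<bar>y \<bullet> rvec v - y \<bullet> rvec t\<bar> + 1)"
            using ef[of v] v False by (intro mult_right_mono) auto
          also have "\<dots> = y0 \<bullet> rvec v - y0 \<bullet> rvec t"
          proof -
            have "\<bar>y \<bullet> rvec v - y \<bullet> rvec t\<bar> + 1 \<noteq> 0" by linarith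
            then show ?thesis unfolding f_def by simp
          qed
          also have "\<dots> \<le> (1 + e) * (y0 \<bullet> rvec v - y0 \<bullet> rvec t)"
            using e min[OF v] by (simp add: mult_le_cancel_right1)
          finally show ?thesis .
        qed
        then show ?thesis by (simp add: z_def st yst inner_add_left inner_diff_left algebra_simps)
      qed
      then have zT: "z \<in> normal_cone T" by (simp add: normal_cone_def)
      have yT: "y \<in> normal_cone T" using y TT' by (auto simp: normal_cone_def)
      have "y0 = (1 - e / (1 + e)) *\<^sub>R z + (e / (1 + e)) *\<^sub>R y"
      proof -
        have "1 - e / (1 + e) = 1 / (1 + e)" using e by (simp add: field_simps)
        then have "(1 - e / (1 + e)) *\<^sub>R z + (e / (1 + e)) *\<^sub>R y = (1 / (1 + e)) *\<^sub>R (z + e *\<^sub>R y)"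
          by (simp add: scaleR_add_right)
        also have "z + e *\<^sub>R y = (1 + e) *\<^sub>R y0" by (simp add: z_def algebra_simps)
        finally show ?thesis using e by simp
      qed
      moreover have "z \<noteq> y"
      proof
        assume "z = y"
        then have "(1 + e) *\<^sub>R (y0 - y) = 0" by (simp add: z_def algebra_simps)
        then show False using e False by simp
      qed
      moreover have "0 < e / (1 + e)" "e / (1 + e) < 1" using e by (auto simp: divide_less_eq)
      ultimately have seg: "y0 \<in> open_segment z y" unfolding in_segment by blast
      show ?thesis using face_ofD[OF E(1) seg] zT yT y0E by blast
    qed (use y0E in simp)
  qed
  ultimately show ?thesis using TT' by blast
qed

lemma is_fan_normal_fan: "is_fan normal_fan"
  unfolding is_fan_def
proof (intro conjI ballI)
  show "finite normal_fan" using finite_lattice_points by (simp add: normal_fan_def)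
next
  fix s assume "s \<in> normal_fan"
  then obtain T where T: "T \<subseteq> L" "T \<noteq> {}" "s = normal_cone T" by (auto simp: normal_fan_def)
  obtain W where "finite W" "cone_over W = normal_cone T" using normal_cone_generated[OF T(1)] by blast
  then show "strongly_convex_rational_cone s"
    using normal_cone_pointed[OF T(1,2)] unfolding strongly_convex_rational_cone_def T(3) by blast
  show "cone_faces s \<subseteq> normal_fan"
  proof
    fix E assume "E \<in> cone_faces s"
    then have "E face_of normal_cone T" "E \<noteq> {}" by (auto simp: cone_faces_def T(3))
    from face_of_normal_cone[OF T(1,2) this] show "E \<in> normal_fan"
      using T(2) unfolding normal_fan_def by blast
  qed
next
  fix s t assume "s \<in> normal_fan" "t \<in> normal_fan"
  then obtain T T' where T: "T \<subseteq> L" "T \<noteq> {}" "s = normal_cone T" "T' \<subseteq> L" "T' \<noteq> {}" "t = normal_cone T'"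
    by (auto simp: normal_fan_def)
  have ne: "s \<inter> t \<noteq> {}" using zero_mem_normal_cone by (auto simp: T)
  show "s \<inter> t \<in> cone_faces s"
    using normal_cone_face[OF T(1,2,4)] ne by (simp add: cone_faces_def T(3,6) normal_cone_Un)
  show "s \<inter> t \<in> cone_faces t"
    using normal_cone_face[OF T(4,5,1)] ne by (simp add: cone_faces_def T(3,6) normal_cone_Un Un_commute)
qed

lemma minimizer_exists: "\<exists>t\<in>L. y \<in> normal_cone {t}"
proof -
  let ?f = "\<lambda>v. y \<bullet> rvec v"
  have "Min (?f ` L) \<in> ?f ` L" using finite_lattice_points L_nonempty by (intro Min_in) auto
  then obtain t where t: "t \<in> L" "?f t = Min (?f ` L)" by auto
  have "?f t \<le> ?f v" if "v \<in> L" for v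
    unfolding t(2) using finite_lattice_points that by (intro Min_le) auto
  then show ?thesis using t(1) by (auto simp: normal_cone_def)
qed

lemma complete_normal_fan: "complete_fan normal_fan"
proof -
  have "y \<in> \<Union>normal_fan" for y
  proof -
    obtain t where "t \<in> L" "y \<in> normal_cone {t}" using minimizer_exists by blast
    then show ?thesis unfolding normal_fan_def by blast
  qed
  then show ?thesis using is_fan_normal_fan by (auto simp: complete_fan_def)
qed

lemma normal_cone_ray_generated:
  assumes "s \<in> normal_fan"
  shows "\<exists>W. finite W \<and> cone_over W = s \<and> W \<subseteq> ray_gens normal_fan \<and> (\<forall>w\<in>W. rvec w \<in> s)"
proof -
  obtain T where T: "T \<subseteq> L" "T \<noteq> {}" "s = normal_cone T" using assms by (auto simp: normal_fan_def)
  obtain V where V: "finite V" "cone_over V = s" using normal_cone_generated[OF T(1)] T(3) by blast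
  have "cone_over V \<inter> uminus ` cone_over V = {0}" using normal_cone_pointed[OF T(1,2)] by (simp add: V(2) T(3))
  from pointed_cone_rays[OF V(1) this] obtain W where
    W: "finite W" "cone_over W = s" "\<And>w. w \<in> W \<Longrightarrow> primitive w \<and> cone_over {w} face_of s" by (auto simp: V(2))
  have "cone_over {w} \<in> normal_fan" if "w \<in> W" for w
  proof -
    have "cone_over {w} \<noteq> {}" using zero_mem_cone_over by blast
    with W(3)[OF that] have "cone_over {w} \<in> cone_faces s" by (simp add: cone_faces_def)
    then show ?thesis using is_fan_normal_fan assms by (auto simp: is_fan_def)
  qed
  then have "W \<subseteq> ray_gens normal_fan" using W(3) by (auto simp: ray_gens_def)
  moreover have "rvec w \<in> s" if "w \<in> W" for w using cone_over_base[OF W(1) that] W(2) by simp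
  ultimately show ?thesis using W(1,2) by blast
qed

text \<open>The support function of Q with its sign changed, so that every inequality of
  \<open>div_polytope\<close> is attained on Q.\<close>

definition support_divisor :: "int^'n \<Rightarrow> int" where
  "support_divisor v = - Min ((\<lambda>u. \<Sum>i\<in>UNIV. u $ i * v $ i) ` L)"

lemma support_divisor_le: "u \<in> L \<Longrightarrow> - real_of_int (support_divisor v) \<le> rvec u \<bullet> rvec v"
  and support_divisor_eq: "u \<in> L \<Longrightarrow> rvec u \<bullet> rvec v = - real_of_int (support_divisor v) \<longleftrightarrow> rvec v \<in> normal_cone {u}"
proof -
  let ?f = "\<lambda>u. \<Sum>i\<in>UNIV. u $ i * v $ i"
  have f: "rvec u \<bullet> rvec v = of_int (?f u)" for u by (simp add: inner_vec_def rvec_def)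
  have fc: "rvec v \<bullet> rvec u = of_int (?f u)" for u by (subst inner_commute) (rule f)
  have fin: "finite (?f ` L)" "?f ` L \<noteq> {}" using finite_lattice_points L_nonempty by auto
  show "- real_of_int (support_divisor v) \<le> rvec u \<bullet> rvec v" if "u \<in> L" for u
  proof -
    have "Min (?f ` L) \<le> ?f u" using fin that by (intro Min_le) auto
    then have "real_of_int (Min (?f ` L)) \<le> of_int (?f u)" by (simp only: of_int_le_iff)
    then show ?thesis unfolding f support_divisor_def by (simp only: minus_minus of_int_minus)
  qed
  show "rvec u \<bullet> rvec v = - real_of_int (support_divisor v) \<longleftrightarrow> rvec v \<in> normal_cone {u}" if u: "u \<in> L" for u
  proof -
    have "rvec u \<bullet> rvec v = - real_of_int (support_divisor v) \<longleftrightarrow> ?f u = Min (?f ` L)"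
      unfolding f support_divisor_def by (simp only: of_int_minus minus_minus of_int_eq_iff)
    also have "\<dots> \<longleftrightarrow> (\<forall>w\<in>L. ?f u \<le> ?f w)"
    proof
      show "\<forall>w\<in>L. ?f u \<le> ?f w" if "?f u = Min (?f ` L)"
        unfolding that using Min_le[OF fin(1)] by blast
      show "?f u = Min (?f ` L)" if "\<forall>w\<in>L. ?f u \<le> ?f w"
        by (rule Min_eqI[symmetric, OF fin(1)]) (use that u in auto)
    qed
    also have "\<dots> \<longleftrightarrow> rvec v \<in> normal_cone {u}"
      by (simp only: normal_cone_def mem_Collect_eq fc of_int_le_iff ball_simps simp_thms)
    finally show ?thesis .
  qed
qed

text \<open>If y separates x from Q, then y lies in the normal cone of some lattice point t and is a
  combination of rays of that cone. The divisor inequalities at these rays are equalities at t, so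
  they add up to y . t \<le> y . x, against the separation.\<close>

lemma div_polytope_normal_fan: "div_polytope normal_fan support_divisor = Q"
proof
  show "Q \<subseteq> div_polytope normal_fan support_divisor"
  proof -
    have "div_polytope normal_fan support_divisor =
        (\<Inter>v\<in>ray_gens normal_fan. {x. rvec v \<bullet> x \<ge> - real_of_int (support_divisor v)})"
      by (auto simp: div_polytope_def inner_commute)
    then have "convex (div_polytope normal_fan support_divisor)" by (simp add: convex_INT convex_halfspace_ge)
    moreover have "rvec ` L \<subseteq> div_polytope normal_fan support_divisor"
      using support_divisor_le by (auto simp: div_polytope_def)
    ultimately have "convex hull (rvec ` L) \<subseteq> div_polytope normal_fan support_divisor" by (intro hull_minimal)
    then show ?thesis by (simp only: convex_hull_lattice_points)
  qed
  show "div_polytope normal_fan support_divisor \<subseteq> Q"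
  proof
    fix x assume x: "x \<in> div_polytope normal_fan support_divisor"
    show "x \<in> Q"
    proof (rule ccontr)
      assume "x \<notin> Q"
      then obtain y b where yb: "y \<bullet> x < b" "\<forall>q\<in>Q. y \<bullet> q > b"
        using separating_hyperplane_closed_point[OF convex compact_imp_closed[OF compact]] by blast
      obtain t where t: "t \<in> L" "y \<in> normal_cone {t}" using minimizer_exists by blast
      have "normal_cone {t} \<in> normal_fan" using t(1) unfolding normal_fan_def by blast
      from normal_cone_ray_generated[OF this] obtain W where
        W: "cone_over W = normal_cone {t}" "W \<subseteq> ray_gens normal_fan" "\<forall>w\<in>W. rvec w \<in> normal_cone {t}" by blast
      obtain c where c: "\<forall>w. c w \<ge> 0" "y = (\<Sum>w\<in>W. c w *\<^sub>R rvec w)"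
        using t(2) unfolding W(1)[symmetric] cone_over_def by blast
      have "y \<bullet> rvec t = (\<Sum>w\<in>W. c w * (rvec w \<bullet> rvec t))" by (simp add: c(2) inner_sum_left)
      also have "\<dots> \<le> (\<Sum>w\<in>W. c w * (rvec w \<bullet> x))"
      proof (intro sum_mono mult_left_mono)
        fix w assume w: "w \<in> W"
        then have "rvec t \<bullet> rvec w = - real_of_int (support_divisor w)" using support_divisor_eq[OF t(1)] W(3) by blast
        also have "\<dots> \<le> x \<bullet> rvec w" using x w W(2) by (auto simp: div_polytope_def)
        finally show "rvec w \<bullet> rvec t \<le> rvec w \<bullet> x" by (simp add: inner_commute)
      qed (use c(1) in auto)
      also have "\<dots> = y \<bullet> x" by (simp add: c(2) inner_sum_left)
      finally have "y \<bullet> rvec t \<le> y \<bullet> x" .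
      moreover have "y \<bullet> rvec t > b" using yb(2) t(1) by (simp add: lattice_points_def)
      ultimately show False using yb(1) by simp
    qed
  qed
qed

lemma trivial_on_normal_cone: "t \<in> T \<Longrightarrow> T \<subseteq> L \<Longrightarrow> trivial_on normal_fan support_divisor t (normal_cone T)"
  unfolding trivial_on_def
proof (intro ballI impI)
  fix v assume "t \<in> T" "T \<subseteq> L" "rvec v \<in> normal_cone T"
  then have "rvec v \<in> normal_cone {t}" "t \<in> L" by (auto simp: normal_cone_def)
  then show "rvec t \<bullet> rvec v = - real_of_int (support_divisor v)" by (simp only: support_divisor_eq)
qed

text \<open>Triviality on s is a condition on the rays in s. As s is generated by its rays, it says
  that s lies in \<open>normal_cone {u}\<close>, and members of the fan inside that cone are its
  faces.\<close>

lemma nonvanishing_normal_fan: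
  assumes u: "u \<in> L"
  shows "nonvanishing_fan normal_fan support_divisor u = cone_faces (normal_cone {u})"
proof (intro equalityI subsetI)
  have nF: "normal_cone {u} \<in> normal_fan" using u unfolding normal_fan_def by blast
  fix s assume s: "s \<in> cone_faces (normal_cone {u})"
  then have "s \<in> normal_fan" using is_fan_normal_fan nF by (auto simp: is_fan_def)
  moreover have "s \<subseteq> normal_cone {u}" using s face_of_imp_subset by (auto simp: cone_faces_def)
  then have "trivial_on normal_fan support_divisor u s"
    using support_divisor_eq[OF u] by (auto simp: trivial_on_def)
  ultimately show "s \<in> nonvanishing_fan normal_fan support_divisor u" by (simp add: nonvanishing_fan_def)
next
  fix s assume "s \<in> nonvanishing_fan normal_fan support_divisor u"
  then have s: "s \<in> normal_fan" "trivial_on normal_fan support_divisor u s" by (auto simp: nonvanishing_fan_def)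
  then obtain T where T: "T \<subseteq> L" "T \<noteq> {}" "s = normal_cone T" by (auto simp: normal_fan_def)
  obtain W where W: "cone_over W = s" "W \<subseteq> ray_gens normal_fan" "\<forall>w\<in>W. rvec w \<in> s"
    using normal_cone_ray_generated[OF s(1)] by blast
  have w: "rvec w \<in> normal_cone {u}" if "w \<in> W" for w
    using s(2) W that support_divisor_eq[OF u] by (auto simp: trivial_on_def)
  obtain U where U: "finite U" "cone_over U = normal_cone {u}" using normal_cone_generated[of "{u}"] u by blast
  have "s \<subseteq> normal_cone {u}" unfolding W(1)[symmetric] U(2)[symmetric] using w
    by (intro cone_over_minimal) (simp add: U(2))
  then have "s = normal_cone ({u} \<union> T)" using T(3) normal_cone_Un[of "{u}" T] by auto
  moreover have "normal_cone ({u} \<union> T) face_of normal_cone {u}" using u T(1) by (intro normal_cone_face) auto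
  ultimately show "s \<in> cone_faces (normal_cone {u})"
    using zero_mem_normal_cone by (auto simp: cone_faces_def)
qed

text \<open>By Farkas, a vector separating a point from the closed cone at u is an inner normal at
  u. Dual lattice points therefore lie in the real cone, and
  \<open>semigroup_at_lattice_point\<close> puts them into the semigroup.\<close>

lemma semigroup_eq_dual_lattice_cone:
  assumes va: "very_ample_polytope Q" and u: "u \<in> L"
  shows "semigroup_gen ((\<lambda>v. v - u) ` L) = dual_lattice_cone (normal_cone {u})"
proof (intro equalityI subsetI)
  fix x assume "x \<in> semigroup_gen ((\<lambda>v. v - u) ` L)"
  then show "x \<in> dual_lattice_cone (normal_cone {u})"
  proof induction
    case (add g x)
    then obtain v where v: "v \<in> L" "g = v - u" by blast
    have "0 \<le> rvec g \<bullet> y" if "y \<in> normal_cone {u}" for y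
      using that v(1) by (simp add: v(2) normal_cone_def rvec_diff inner_diff_left inner_diff_right inner_commute)
    with add.IH show ?case by (simp add: dual_lattice_cone_def rvec_add inner_add_left)
  qed (simp add: dual_lattice_cone_def rvec_zero)
next
  let ?C = "cone_over ((\<lambda>v. v - u) ` L)"
  fix x assume x: "x \<in> dual_lattice_cone (normal_cone {u})"
  have fin: "finite ((\<lambda>v. v - u) ` L)" using finite_lattice_points by simp
  have "rvec x \<in> ?C"
  proof (rule ccontr)
    assume "rvec x \<notin> ?C"
    then obtain a b where ab: "a \<bullet> rvec x < b" "\<forall>z\<in>?C. a \<bullet> z > b"
      using separating_hyperplane_closed_point[OF convex_cone_over closed_cone_over[OF fin]] by blast
    have b0: "b < 0" using ab(2) zero_mem_cone_over by fastforce
    have "a \<bullet> z \<ge> 0" if z: "z \<in> ?C" for z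
    proof (rule ccontr)
      assume n: "\<not> a \<bullet> z \<ge> 0"
      then have "(b / (a \<bullet> z)) *\<^sub>R z \<in> ?C" using b0 z by (intro cone_over_scale divide_nonpos_nonpos) auto
      then have "a \<bullet> ((b / (a \<bullet> z)) *\<^sub>R z) > b" using ab(2) by blast
      then show False using n by simp
    qed
    then have "0 \<le> a \<bullet> rvec (v - u)" if "v \<in> L" for v using cone_over_base[OF fin] that by blast
    then have "a \<in> normal_cone {u}" by (simp add: normal_cone_def rvec_diff inner_diff_right)
    then have "0 \<le> rvec x \<bullet> a" using x by (simp add: dual_lattice_cone_def)
    then show False using ab(1) b0 by (simp add: inner_commute)
  qed
  then show "x \<in> semigroup_gen ((\<lambda>v. v - u) ` L)" by (rule semigroup_at_lattice_point[OF va u])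
qed

lemma toric_pair_normal_fan:
  assumes va: "very_ample_polytope Q"
  shows "toric_pair normal_fan support_divisor"
proof -
  have triv: "\<exists>u\<in>L. trivial_on normal_fan support_divisor u s" if "s \<in> normal_fan" for s
  proof -
    obtain T where T: "T \<subseteq> L" "T \<noteq> {}" "s = normal_cone T" using \<open>s \<in> normal_fan\<close> by (auto simp: normal_fan_def)
    then obtain t where "t \<in> T" by blast
    then show ?thesis using T trivial_on_normal_cone by blast
  qed
  have "\<exists>s\<in>normal_fan. nonvanishing_fan normal_fan support_divisor u = cone_faces s \<and>
      semigroup_gen ((\<lambda>w. w - u) ` L) = dual_lattice_cone s" if u: "u \<in> L" for u
  proof -
    have "normal_cone {u} \<in> normal_fan" using u unfolding normal_fan_def by blast
    then show ?thesis using nonvanishing_normal_fan[OF u] semigroup_eq_dual_lattice_cone[OF va u] by blast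
  qed
  then show ?thesis
    unfolding toric_pair_def very_ample_divisor_def cartier_divisor_def div_polytope_normal_fan
    using complete_normal_fan triv by blast
qed

end

theorem mainTheorem6:
  fixes P :: "(real^'n) set" and d p :: nat and K :: "'k::alg_closed_field itself"
  assumes "d \<ge> 2" and "CARD('n) = d - 1"
    and "rational_polytope P" and "aff_dim P = int (d - 1)"
    and "CHAR('k) = p" and "p > 0"
  shows "(\<forall>n. \<exists>m\<ge>n. m \<ge> 1 \<and> very_ample_polytope (dilate (real m) P)) \<and>
    (\<forall>m n1. m \<ge> 1 \<and> n1 \<ge> 1 \<and> lattice_polytope (dilate (real n1) P) \<and>
        lattice_polytope (dilate (real m) P) \<and> m \<ge> (d - 2) * n1 \<longrightarrow>
        very_ample_polytope (dilate (real m) P)) \<and>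
    (\<forall>m\<ge>1. very_ample_polytope (dilate (real m) P) \<longrightarrow>
        (\<exists>F a. toric_pair F a \<and> div_polytope F a = dilate (real m) P) \<and>
        (\<forall>F a. toric_pair F a \<and> div_polytope F a = dilate (real m) P \<longrightarrow>
           (\<forall>k\<ge>1. convergent (e0_seq K F (div_mult k a)) \<and>
                   convergent (eHK_seq K F (div_mult k a))) \<and>
           convergent (criterion_seq K d F a) \<and>
           (tiles P \<longleftrightarrow>
              criterion_lhs K d F a =
                ((real d - 1) / real d) * fact (d - 1) powr ((2 - real d) / (real d - 1))) \<and>
           (\<forall>j\<ge>1. criterion_lhs K d F (div_mult j a) = criterion_lhs K d F a))) \<and>
    (\<forall>m m' F a F' a'. m \<ge> 1 \<and> very_ample_polytope (dilate (real m) P) \<and>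
        toric_pair F a \<and> div_polytope F a = dilate (real m) P \<and>
        m' \<ge> 1 \<and> very_ample_polytope (dilate (real m') P) \<and>
        toric_pair F' a' \<and> div_polytope F' a' = dilate (real m') P \<longrightarrow>
        criterion_lhs K d F a = criterion_lhs K d F' a') \<and>
    (tiles P \<longrightarrow> tiles_at P (measure lebesgue P powr (- 1 / (real d - 1))))"
proof -
  have D: "CARD('n) \<ge> 1" using zero_less_card_finite[where 'a = 'n] by linarith
  have d: "d = CARD('n) + 1" using assms(1,2) by linarith
  have p: "CHAR('k) > 0" using assms(5,6) by simp
  obtain V where V: "finite V" "P = convex hull V" using assms(3) by (auto simp: rational_polytope_def)
  have convP: "convex P" by (simp add: V convex_convex_hull)
  have "interior P \<noteq> {}"
  proof -
    have "rel_interior P = interior P"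
      using assms(2,4) by (intro interior_rel_interior) simp
    moreover have "P \<noteq> {}" using assms(4) by auto
    ultimately show ?thesis using rel_interior_eq_empty[OF convP] by simp
  qed
  moreover have "compact P" using V by (simp add: finite_imp_compact_convex_hull)
  ultimately interpret P: convex_body P using convP by (intro convex_body.intro)
  have body: "convex_body (dilate (real m) P)" if "m \<ge> 1" for m
    using that by (intro convex_body_dilate P.convex_body_axioms) simp
  have sp: "spanning_polytope (dilate (real m) P)" if "m \<ge> 1" "very_ample_polytope (dilate (real m) P)" for m
    using convex_body.interior[OF body[OF that(1)]] that(2) by (rule very_ample_imp_spanning[rotated])
  \<comment> \<open>Expressed through P itself, the left side no longer mentions m, F or a, which is
    the independence of all choices.\<close>
  have lhs_eq: "criterion_lhs K d F a = fact (d - 1) powr ((2 - real d) / (real d - 1)) * P.criterion_value"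
    if m: "m \<ge> 1" "very_ample_polytope (dilate (real m) P)" and F: "div_polytope F a = dilate (real m) P"
    for m F a
  proof -
    have "convex_body.criterion_value (dilate (real m) P) = P.criterion_value"
      using m(1) by (intro criterion_value_dilate P.convex_body_axioms) simp
    then show ?thesis using spanning_polytope.criterion_lhs_eq[OF sp[OF m] F p d, of K] by simp
  qed
  have 1: "\<forall>n. \<exists>m\<ge>n. m \<ge> 1 \<and> very_ample_polytope (dilate (real m) P)"
    using very_ample_multiples_exist[OF assms(3)] by blast
  have 2: "very_ample_polytope (dilate (real m) P)"
    if "m \<ge> 1" "n1 \<ge> 1" "lattice_polytope (dilate (real n1) P)" "lattice_polytope (dilate (real m) P)"
      "m \<ge> (d - 2) * n1" for m n1
    using that D by (intro very_ample_dilate[OF convP that(1-4)]) (simp add: d)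
  have 3: "\<exists>F a. toric_pair F a \<and> div_polytope F a = dilate (real m) P"
    if m: "m \<ge> 1" "very_ample_polytope (dilate (real m) P)" for m
    using spanning_polytope.toric_pair_normal_fan[OF sp[OF m] m(2)]
      spanning_polytope.div_polytope_normal_fan[OF sp[OF m]] by blast
  have 4: "(\<forall>k\<ge>1. convergent (e0_seq K F (div_mult k a)) \<and> convergent (eHK_seq K F (div_mult k a))) \<and>
      convergent (criterion_seq K d F a) \<and>
      (tiles P \<longleftrightarrow> criterion_lhs K d F a =
        ((real d - 1) / real d) * fact (d - 1) powr ((2 - real d) / (real d - 1))) \<and>
      (\<forall>j\<ge>1. criterion_lhs K d F (div_mult j a) = criterion_lhs K d F a)"
    if m: "m \<ge> 1" "very_ample_polytope (dilate (real m) P)" and F: "div_polytope F a = dilate (real m) P"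
    for m F a
  proof (intro conjI allI impI)
    note S = sp[OF m]
    show "convergent (e0_seq K F (div_mult k a))" "convergent (eHK_seq K F (div_mult k a))" if "1 \<le> k" for k
      using spanning_polytope.convergent_multiplicities[OF S F p d that] by blast+
    show "convergent (criterion_seq K d F a)"
      by (rule spanning_polytope.convergent_criterion_seq[OF S F p d])
    have "tiles P \<longleftrightarrow> tiles (dilate (real m) P)" using m(1) by (simp add: tiles_dilate)
    then show "tiles P \<longleftrightarrow> criterion_lhs K d F a =
        ((real d - 1) / real d) * fact (d - 1) powr ((2 - real d) / (real d - 1))"
      using spanning_polytope.tiles_iff_criterion_lhs[OF S F p d, of K] by simp
    fix j :: nat assume j: "1 \<le> j"
    have Fj: "div_polytope F (div_mult j a) = dilate (real j) (dilate (real m) P)"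
      using div_polytope_mult[OF j, of F a] F by simp
    have "convex_body.criterion_value (dilate (real j) (dilate (real m) P)) =
        convex_body.criterion_value (dilate (real m) P)"
      using j by (intro criterion_value_dilate body m) simp
    then show "criterion_lhs K d F (div_mult j a) = criterion_lhs K d F a"
      using spanning_polytope.criterion_lhs_eq[OF S F p d, of K]
        spanning_polytope.criterion_lhs_eq[OF spanning_polytope_dilate[OF S j] Fj p d, of K] by simp
  qed
  have 5: "criterion_lhs K d F a = criterion_lhs K d F' a'"
    if "m \<ge> 1" "very_ample_polytope (dilate (real m) P)" "div_polytope F a = dilate (real m) P"
      "m' \<ge> 1" "very_ample_polytope (dilate (real m') P)" "div_polytope F' a' = dilate (real m') P"
    for m m' F a F' a'
    using lhs_eq[OF that(1-3)] lhs_eq[OF that(4-6)] by simp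
  have "P \<in> sets lborel" using borel_compact[OF P.compact] by simp
  then have "measure lebesgue P powr (- 1 / (real d - 1)) = P.tile_scale"
    by (simp add: P.tile_scale_def P.V_def d)
  then have 6: "tiles P \<longrightarrow> tiles_at P (measure lebesgue P powr (- 1 / (real d - 1)))"
    using P.tiles_imp_tiles_at_scale by simp
  show ?thesis
  proof (intro conjI)
    show "\<forall>n. \<exists>m\<ge>n. m \<ge> 1 \<and> very_ample_polytope (dilate (real m) P)" by (rule 1)
  next
    show "\<forall>m n1. m \<ge> 1 \<and> n1 \<ge> 1 \<and> lattice_polytope (dilate (real n1) P) \<and>
        lattice_polytope (dilate (real m) P) \<and> m \<ge> (d - 2) * n1 \<longrightarrow>
        very_ample_polytope (dilate (real m) P)"
      using 2 by auto
  next
    show "\<forall>m\<ge>1. very_ample_polytope (dilate (real m) P) \<longrightarrow>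
        (\<exists>F a. toric_pair F a \<and> div_polytope F a = dilate (real m) P) \<and>
        (\<forall>F a. toric_pair F a \<and> div_polytope F a = dilate (real m) P \<longrightarrow>
           (\<forall>k\<ge>1. convergent (e0_seq K F (div_mult k a)) \<and>
                   convergent (eHK_seq K F (div_mult k a))) \<and>
           convergent (criterion_seq K d F a) \<and>
           (tiles P \<longleftrightarrow>
              criterion_lhs K d F a =
                ((real d - 1) / real d) * fact (d - 1) powr ((2 - real d) / (real d - 1))) \<and>
           (\<forall>j\<ge>1. criterion_lhs K d F (div_mult j a) = criterion_lhs K d F a))"
    proof (intro allI impI, rule conjI)
      fix m assume m: "1 \<le> m" "very_ample_polytope (dilate (real m) P)"
      show "\<exists>F a. toric_pair F a \<and> div_polytope F a = dilate (real m) P" by (rule 3[OF m])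
      show "\<forall>F a. toric_pair F a \<and> div_polytope F a = dilate (real m) P \<longrightarrow>
           (\<forall>k\<ge>1. convergent (e0_seq K F (div_mult k a)) \<and>
                   convergent (eHK_seq K F (div_mult k a))) \<and>
           convergent (criterion_seq K d F a) \<and>
           (tiles P \<longleftrightarrow>
              criterion_lhs K d F a =
                ((real d - 1) / real d) * fact (d - 1) powr ((2 - real d) / (real d - 1))) \<and>
           (\<forall>j\<ge>1. criterion_lhs K d F (div_mult j a) = criterion_lhs K d F a)"
        by (intro allI impI, elim conjE) (rule 4[OF m])
    qed
  next
    show "\<forall>m m' F a F' a'. m \<ge> 1 \<and> very_ample_polytope (dilate (real m) P) \<and>
        toric_pair F a \<and> div_polytope F a = dilate (real m) P \<and>
        m' \<ge> 1 \<and> very_ample_polytope (dilate (real m') P) \<and>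
        toric_pair F' a' \<and> div_polytope F' a' = dilate (real m') P \<longrightarrow>
        criterion_lhs K d F a = criterion_lhs K d F' a'"
      by (intro allI impI, elim conjE) (rule 5)
  next
    show "tiles P \<longrightarrow> tiles_at P (measure lebesgue P powr (- 1 / (real d - 1)))" by (rule 6)
  qed
qed

end
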